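(* Let $n\geq d$ be positive integers and let $\lambda,\mu,\nu\in\mathcal{P}_{d,n}$. There is a weight-preserving bijection $\Phi:\mathcal{LP}_{\lambda,\mu}^{\nu\,+}\to\mathcal{LR}_{\lambda,\mu}^{\nu\,+}$. Here weight-preserving means that for every $P\in\mathcal{LP}_{\lambda,\mu}^{\nu\,+}$, $c_P$ and $c_{\Phi(P)}$ are equal, and moreover are identical expressions (the same factors $y_i-y_j$ occur with the same multiplicities in the products defining $c_P$ and $c_{\Phi(P)}$); and similarly for $C_P$ and $C_{\Phi(P)}$.
   Context: Fix positive integers $n\geq d$. $\mathbb{N}$ is the set of nonnegative integers; for an integer $m$, $m':=d+1-m$. $\mathcal{P}_{d,n}$ is the set of partitions $\lambda=(\lambda_1\geq\cdots\geq\lambda_d)\in\mathbb{N}^d$ with $\lambda_1\leq n-d$. For a finite sequence with terms in $\{1,\ldots,d\}$, its content is $\omega\in\mathbb{N}^d$, where $\omega_k$ is the number of $k$'s in the sequence. $(y_i)_{i\ge1}$ and $Y_1,\ldots,Y_n$ are variables. Tableaux. The reverse Young diagram of $\mu$ is the right- and bottom-justified array of boxes whose bottom row has length $\mu_1$, next-to-bottom row length $\mu_2$, etc. Rows are numbered $1,2,\ldots$ from bottom to top and columns $1,2,\ldots$ from right to left; $r(a)$ and $c(a)$ are the row and column numbers of an entry $a$ in $\mu$. The skew diagram $\lambda*\mu$ is obtained by placing the ordinary (top-left justified) Young diagram $\lambda$ above and to the right of the reverse Young diagram $\mu$ (no box of $\lambda$ shares a row or column with a box of $\mu$). A skew barred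 tableau $L$ of shape $\lambda*\mu$ fills each box of $\lambda$ with an element of $\{1,\ldots,d\}$ and each box of $\mu$ with an element of $\{1,\ldots,d\}\cup\{\bar1,\ldots,\bar d\}$ so that the values, disregarding bars, weakly increase along rows from left to right and strictly increase down columns. $|a|$ is the integer value of an entry $a$ (bar disregarded). The unbarred column word $L^u$ is the sequence of unbarred entries read column by column, from the rightmost column to the leftmost, each column from top to bottom, barred entries being skipped. It is Yamanouchi if every initial segment contains at least as many $k$'s as $(k+1)$'s, $k=1,\ldots,d-1$. $\mathcal{LR}_{\lambda,\mu}^{\nu}$ is the set of skew barred tableaux of shape $\lambda*\mu$ whose unbarred column word is Yamanouchi with $\omega(L^u)=\nu$. For $a\in L$, $L^u_{<a}$ is the portion of the unbarred column word that comes before reaching $a$. Set $$c_L=\prod_{a\text{ barred}}\left(y_{|a|'+\omega(L^u_{<a})_{|a|}}-y_{|a|'+c(a)-r(a)}\right),\quad C_L=\prod_{a\text{ barred}}\left(Y_{(n-d)+|a|-(c(a)-r(a))}-Y_{(n-d)+|a|-\omega(L^u_{<a})_{|a|}}\right),$$ products over barred entries $a$ of $L$ (empty product $=1$). $\mathcal{LR}_{\lambda,\mu}^{\nu\,+}$ is the set of $L\in\mathcal{LR}_{\lambda,\mu}^{\nu}$ such that each factor of $c_L$ is of the form $y_i-y_j$ with $i>j$. Puzzles. Use the unit triangular lattice, whose edges are horizontal, of direction "/" (slope $+\sqrt3$), or of direction "\" (slope $-\sqrt3$). The eight puzzle pieces (with fixed orientation, unit edge lengths, edges labelled $0$ or $1$)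 are: the upward and downward unit triangles with all edges labelled $0$; the upward and downward unit triangles with all edges labelled $1$; the rhombus with two horizontal edges labelled $0$ and two "\" edges labelled $1$; the rhombus with two horizontal edges labelled $1$ and two "/" edges labelled $0$; the rhombus with two "/" edges labelled $1$ and two "\" edges labelled $0$; and the equivariant puzzle piece, the rhombus with two "/" edges labelled $0$ and two "\" edges labelled $1$. A puzzle $P$ is a partition of an equilateral triangle of side length $n$ (with horizontal bottom side) into puzzle pieces, such that pieces sharing an edge have the same label on it. Read binary words of length $n$ off the boundary: the NE side from top to bottom, the NW side from bottom to top, the S side from left to right. A binary word $w$ with $d$ ones corresponds to $(\eta_1,\ldots,\eta_d)\in\mathcal{P}_{d,n}$, where $\eta_j$ is the number of zeros of $w$ to the right of the $j$-th one from the left. $\mathcal{LP}_{\lambda,\mu}^{\nu\,+}$ is the set of puzzles whose NE, NW and S words correspond to $\lambda,\mu,\nu$ respectively. For an equivariant puzzle piece of $P$, draw from its center to the S side the line $L_1$ parallel to the NW side and the line $L_2$ parallel to the NE side. Number the $n$ edges of the S side $1,\ldots,n$ from right to left; $L_1$ and $L_2$ meet the S side at the centers of edges $e$ and $f$, with $e>f$. The factorial weight of the piece is $y_e-y_f$ and its equivariant weight is $Y_{n+1-f}-Y_{n+1-e}$. $c_P$ (resp. $C_P$) is the product of the factorial (resp. equivariant) weights of all equivariant puzzle pieces of $P$. *)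

theory Defs
  imports "HOL-Library.Multiset" "HOL-Library.FuncSet" "HOL-Library.Product_Plus"
    "HOL-Library.Poly_Mapping" Complex_Main
begin

section \<open>Partitions, polynomials and formal products\<close>

text \<open>Partitions are lists of length \<open>d\<close>, trailing zeros included; the part with
  subscript \<open>j\<close> is the list entry with index \<open>j - 1\<close>.\<close>

definition partitions :: "nat \<Rightarrow> nat \<Rightarrow> nat list set" where
  "partitions d n = {p. length p = d \<and> sorted_wrt (\<ge>) p \<and> p ! 0 \<le> n - d}"

text \<open>Integer polynomials, with variables indexed by integers so that the index arithmetic
  below is not truncated. The same type serves for the variables \<open>y\<close> and \<open>Y\<close>, which never
  occur together.\<close>

type_synonym zpoly = "(int \<Rightarrow>\<^sub>0 nat) \<Rightarrow>\<^sub>0 int"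

definition var :: "int \<Rightarrow> zpoly" where
  "var i = Poly_Mapping.single (Poly_Mapping.single i 1) 1"

text \<open>The pair \<open>(i, j)\<close> stands for the factor \<open>y\<^sub>i - y\<^sub>j\<close> (or \<open>Y\<^sub>i - Y\<^sub>j\<close>). A product of such
  factors, taken as an expression, is a multiset of pairs; \<open>expand\<close> is the polynomial it
  denotes.\<close>

type_synonym factor = "int \<times> int"

definition expand :: "factor multiset \<Rightarrow> zpoly" where
  "expand F = prod_mset (image_mset (\<lambda>(i, j). var i - var j) F)"


section \<open>Skew barred tableaux\<close>

datatype entry = Plain nat | Barred nat

fun absval :: "entry \<Rightarrow> nat" where
  "absval (Plain k) = k"
| "absval (Barred k) = k"

text \<open>A box is a pair (row, column), with rows numbered from bottom to top and columns from
  right to left. Rows and columns \<open>1, 2, \<dots>\<close> are those of the reverse Young diagram of \<open>mu\<close>.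
  The diagram of \<open>lam\<close> lies in the columns \<open>0, -1, \<dots>\<close> to the right of it and in the rows
  \<open>2d, \<dots>, d + 1\<close> above it: the box in the \<open>i\<close>-th row from the top and the \<open>j\<close>-th column from
  the left of \<open>lam\<close> is \<open>(2 * d + 1 - i, 1 - j)\<close>.\<close>

type_synonym box = "int \<times> int"

definition young_boxes :: "nat \<Rightarrow> nat list \<Rightarrow> box set" where
  "young_boxes d lam =
     {(2 * int d + 1 - int i, 1 - int j) | i j. i \<in> {1..d} \<and> j \<in> {1..lam ! (i - 1)}}"

definition reverse_boxes :: "nat \<Rightarrow> nat list \<Rightarrow> box set" where
  "reverse_boxes d mu = {(int i, int j) | i j. i \<in> {1..d} \<and> j \<in> {1..mu ! (i - 1)}}"

definition skew_boxes :: "nat \<Rightarrow> nat list \<Rightarrow> nat list \<Rightarrow> box set" where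
  "skew_boxes d lam mu = young_boxes d lam \<union> reverse_boxes d mu"

definition tableaux :: "nat \<Rightarrow> nat list \<Rightarrow> nat list \<Rightarrow> (box \<Rightarrow> entry) set" where
  "tableaux d lam mu =
     {L \<in> extensional (skew_boxes d lam mu).
        (\<forall>b \<in> young_boxes d lam. L b \<in> Plain ` {1..d}) \<and>
        (\<forall>b \<in> reverse_boxes d mu. L b \<in> Plain ` {1..d} \<union> Barred ` {1..d}) \<and>
        (\<forall>r c c'. (r, c) \<in> skew_boxes d lam mu \<and> (r, c') \<in> skew_boxes d lam mu \<and> c > c'
           \<longrightarrow> absval (L (r, c)) \<le> absval (L (r, c'))) \<and>
        (\<forall>r r' c. (r, c) \<in> skew_boxes d lam mu \<and> (r', c) \<in> skew_boxes d lam mu \<and> r > r'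
           \<longrightarrow> absval (L (r, c)) < absval (L (r', c)))}"

text \<open>The boxes column by column, from the rightmost column to the leftmost, each from top to
  bottom; for partitions, the ranges contain all rows and columns of the diagram.\<close>

definition reading :: "nat \<Rightarrow> nat list \<Rightarrow> nat list \<Rightarrow> box list" where
  "reading d lam mu =
     [(r, c). c \<leftarrow> [1 - int (lam ! 0)..int (mu ! 0)], r \<leftarrow> rev [1..2 * int d],
              (r, c) \<in> skew_boxes d lam mu]"

definition unbarred :: "(box \<Rightarrow> entry) \<Rightarrow> box list \<Rightarrow> nat list" where
  "unbarred L bs = concat (map (\<lambda>b. case L b of Plain k \<Rightarrow> [k] | Barred k \<Rightarrow> []) bs)"

definition column_word :: "nat \<Rightarrow> nat list \<Rightarrow> nat list \<Rightarrow> (box \<Rightarrow> entry) \<Rightarrow> nat list" where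
  "column_word d lam mu L = unbarred L (reading d lam mu)"

definition column_word_before ::
    "nat \<Rightarrow> nat list \<Rightarrow> nat list \<Rightarrow> (box \<Rightarrow> entry) \<Rightarrow> box \<Rightarrow> nat list" where
  "column_word_before d lam mu L a = unbarred L (takeWhile (\<lambda>b. b \<noteq> a) (reading d lam mu))"

definition content :: "nat \<Rightarrow> nat list \<Rightarrow> nat list" where
  "content d w = map (count_list w) [1..<d + 1]"

definition yamanouchi :: "nat \<Rightarrow> nat list \<Rightarrow> bool" where
  "yamanouchi d w \<longleftrightarrow>
     (\<forall>m \<le> length w. \<forall>k \<in> {1..<d}. count_list (take m w) k \<ge> count_list (take m w) (k + 1))"

definition LR :: "nat \<Rightarrow> nat list \<Rightarrow> nat list \<Rightarrow> nat list \<Rightarrow> (box \<Rightarrow> entry) set" where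
  "LR d lam mu nu =
     {L \<in> tableaux d lam mu.
        yamanouchi d (column_word d lam mu L) \<and> content d (column_word d lam mu L) = nu}"

definition barred_boxes :: "nat \<Rightarrow> nat list \<Rightarrow> nat list \<Rightarrow> (box \<Rightarrow> entry) \<Rightarrow> box set" where
  "barred_boxes d lam mu L = {a \<in> skew_boxes d lam mu. \<exists>k. L a = Barred k}"

definition tableau_c_factors ::
    "nat \<Rightarrow> nat list \<Rightarrow> nat list \<Rightarrow> (box \<Rightarrow> entry) \<Rightarrow> factor multiset" where
  "tableau_c_factors d lam mu L =
     image_mset
       (\<lambda>(r, c). let k = absval (L (r, c)); k' = int d + 1 - int k in
          (k' + int (count_list (column_word_before d lam mu L (r, c)) k), k' + c - r))
       (mset_set (barred_boxes d lam mu L))"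

definition tableau_C_factors ::
    "nat \<Rightarrow> nat \<Rightarrow> nat list \<Rightarrow> nat list \<Rightarrow> (box \<Rightarrow> entry) \<Rightarrow> factor multiset" where
  "tableau_C_factors n d lam mu L =
     image_mset
       (\<lambda>(r, c). let k = absval (L (r, c)) in
          ((int n - int d) + int k - (c - r),
           (int n - int d) + int k - int (count_list (column_word_before d lam mu L (r, c)) k)))
       (mset_set (barred_boxes d lam mu L))"

definition tableau_c :: "nat \<Rightarrow> nat list \<Rightarrow> nat list \<Rightarrow> (box \<Rightarrow> entry) \<Rightarrow> zpoly" where
  "tableau_c d lam mu L = expand (tableau_c_factors d lam mu L)"

definition tableau_C :: "nat \<Rightarrow> nat \<Rightarrow> nat list \<Rightarrow> nat list \<Rightarrow> (box \<Rightarrow> entry) \<Rightarrow> zpoly" where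
  "tableau_C n d lam mu L = expand (tableau_C_factors n d lam mu L)"

definition LR_plus :: "nat \<Rightarrow> nat list \<Rightarrow> nat list \<Rightarrow> nat list \<Rightarrow> (box \<Rightarrow> entry) set" where
  "LR_plus d lam mu nu =
     {L \<in> LR d lam mu nu. \<forall>(i, j) \<in># tableau_c_factors d lam mu L. i > j}"


section \<open>Puzzles\<close>

text \<open>The lattice point \<open>(x, y)\<close> is \<open>x u + y v\<close>, where \<open>u\<close> is the horizontal unit vector and
  \<open>v\<close> the unit vector of direction "/" pointing up. The big triangle has its SW corner at the
  origin: its NW side is \<open>x = 0\<close>, its S side \<open>y = 0\<close> and its NE side \<open>x + y = n\<close>.\<close>

type_synonym point = "int \<times> int"

datatype direction = Horizontal | Slash | Backslash

fun dvec :: "direction \<Rightarrow> int \<times> int" where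
  "dvec Horizontal = (1, 0)"
| "dvec Slash = (0, 1)"
| "dvec Backslash = (-1, 1)"

text \<open>The edge \<open>(p, a)\<close> joins \<open>p\<close> to \<open>p + dvec a\<close>; thus \<open>p\<close> is its left or its lower end.\<close>

type_synonym edge = "point \<times> direction"

text \<open>\<open>Up (x, y)\<close> is the unit triangle with vertices \<open>(x, y)\<close>, \<open>(x + 1, y)\<close>, \<open>(x, y + 1)\<close>, and
  \<open>Down (x, y)\<close> the one with vertices \<open>(x + 1, y)\<close>, \<open>(x, y + 1)\<close>, \<open>(x + 1, y + 1)\<close>.\<close>

datatype cell = Up point | Down point

definition big_triangle :: "nat \<Rightarrow> cell set" where
  "big_triangle n =
     {Up (x, y) | x y. 0 \<le> x \<and> 0 \<le> y \<and> x + y + 1 \<le> int n} \<union>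
     {Down (x, y) | x y. 0 \<le> x \<and> 0 \<le> y \<and> x + y + 2 \<le> int n}"

text \<open>The rhombus kinds are named after the directions of their sides; \<open>SlashBack\<close> has its "/"
  edges labelled 1, and \<open>Equivariant\<close> has them labelled 0.\<close>

datatype kind = Up0 | Down0 | Up1 | Down1 | HorizBack | HorizSlash | SlashBack | Equivariant

text \<open>A piece at \<open>(x, y)\<close>: a triangle as for cells, a rhombus with sides \<open>a\<close>, \<open>b\<close> having the
  vertices \<open>(x, y)\<close>, \<open>(x, y) + dvec a\<close>, \<open>(x, y) + dvec b\<close>, \<open>(x, y) + dvec a + dvec b\<close>.\<close>

type_synonym piece = "kind \<times> point"

fun cells :: "piece \<Rightarrow> cell set" where
  "cells (Up0, (x, y)) = {Up (x, y)}"
| "cells (Up1, (x, y)) = {Up (x, y)}"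
| "cells (Down0, (x, y)) = {Down (x, y)}"
| "cells (Down1, (x, y)) = {Down (x, y)}"
| "cells (HorizBack, (x, y)) = {Up (x, y), Down (x - 1, y)}"
| "cells (HorizSlash, (x, y)) = {Up (x, y), Down (x, y)}"
| "cells (SlashBack, (x, y)) = {Down (x - 1, y), Up (x - 1, y + 1)}"
| "cells (Equivariant, (x, y)) = {Down (x - 1, y), Up (x - 1, y + 1)}"

definition up_edges :: "point \<Rightarrow> nat \<Rightarrow> (edge \<times> nat) set" where
  "up_edges p l =
     {((p, Horizontal), l), ((p, Slash), l), ((p + dvec Horizontal, Backslash), l)}"

definition down_edges :: "point \<Rightarrow> nat \<Rightarrow> (edge \<times> nat) set" where
  "down_edges p l =
     {((p + dvec Slash, Horizontal), l), ((p + dvec Horizontal, Slash), l),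
      ((p + dvec Horizontal, Backslash), l)}"

definition rhombus_edges ::
    "point \<Rightarrow> direction \<Rightarrow> nat \<Rightarrow> direction \<Rightarrow> nat \<Rightarrow> (edge \<times> nat) set" where
  "rhombus_edges p a k b l =
     {((p, a), k), ((p + dvec b, a), k), ((p, b), l), ((p + dvec a, b), l)}"

text \<open>The sides of a piece with their labels; the diagonal inside a rhombus is not among them.\<close>

fun labelled_edges :: "piece \<Rightarrow> (edge \<times> nat) set" where
  "labelled_edges (Up0, p) = up_edges p 0"
| "labelled_edges (Up1, p) = up_edges p 1"
| "labelled_edges (Down0, p) = down_edges p 0"
| "labelled_edges (Down1, p) = down_edges p 1"
| "labelled_edges (HorizBack, p) = rhombus_edges p Horizontal 0 Backslash 1"
| "labelled_edges (HorizSlash, p) = rhombus_edges p Horizontal 1 Slash 0"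
| "labelled_edges (SlashBack, p) = rhombus_edges p Slash 1 Backslash 0"
| "labelled_edges (Equivariant, p) = rhombus_edges p Slash 0 Backslash 1"

definition puzzles :: "nat \<Rightarrow> piece set set" where
  "puzzles n =
     {P. (\<forall>q \<in> P. cells q \<subseteq> big_triangle n) \<and>
         (\<forall>t \<in> big_triangle n. \<exists>!q. q \<in> P \<and> t \<in> cells q) \<and>
         (\<forall>q \<in> P. \<forall>q' \<in> P. \<forall>e l l'.
            (e, l) \<in> labelled_edges q \<and> (e, l') \<in> labelled_edges q' \<longrightarrow> l = l')}"

definition edge_label :: "piece set \<Rightarrow> edge \<Rightarrow> nat" where
  "edge_label P e = (THE l. \<exists>q \<in> P. (e, l) \<in> labelled_edges q)"

definition NE_word :: "nat \<Rightarrow> piece set \<Rightarrow> nat list" where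
  "NE_word n P =
     map (\<lambda>i. edge_label P ((int i + 1, int n - int i - 1), Backslash)) [0..<n]"

definition NW_word :: "nat \<Rightarrow> piece set \<Rightarrow> nat list" where
  "NW_word n P = map (\<lambda>i. edge_label P ((0, int i), Slash)) [0..<n]"

definition S_word :: "nat \<Rightarrow> piece set \<Rightarrow> nat list" where
  "S_word n P = map (\<lambda>i. edge_label P ((int i, 0), Horizontal)) [0..<n]"

text \<open>For each one of the word, from left to right, the number of zeros to its right; so the
  length of the result is the number of ones.\<close>

fun word_partition :: "nat list \<Rightarrow> nat list" where
  "word_partition [] = []"
| "word_partition (b # w) = (if b = 1 then [count_list w 0] else []) @ word_partition w"

definition LP_plus :: "nat \<Rightarrow> nat list \<Rightarrow> nat list \<Rightarrow> nat list \<Rightarrow> piece set set" where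
  "LP_plus n lam mu nu =
     {P \<in> puzzles n. word_partition (NE_word n P) = lam \<and> word_partition (NW_word n P) = mu \<and>
                     word_partition (S_word n P) = nu}"

text \<open>Points of the plane, in the same coordinates.\<close>

type_synonym qpoint = "rat \<times> rat"

text \<open>The equivariant piece at \<open>(x, y)\<close> has top vertex \<open>(x - 1, y + 2)\<close>; its centre is halfway.\<close>

fun centre :: "point \<Rightarrow> qpoint" where
  "centre (x, y) = (of_int x - 1 / 2, of_int y + 1)"

text \<open>The edges of the S side are numbered from right to left, starting with 1.\<close>

definition S_edge_centre :: "nat \<Rightarrow> int \<Rightarrow> qpoint" where
  "S_edge_centre n k = (of_nat n - of_int k + 1 / 2, 0)"

definition on_line :: "qpoint \<Rightarrow> direction \<Rightarrow> qpoint \<Rightarrow> bool" where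
  "on_line z a w \<longleftrightarrow>
     (\<exists>t. fst w = fst z + t * of_int (fst (dvec a)) \<and> snd w = snd z + t * of_int (snd (dvec a)))"

definition S_edge_met :: "nat \<Rightarrow> point \<Rightarrow> direction \<Rightarrow> int" where
  "S_edge_met n p a = (THE k. on_line (centre p) a (S_edge_centre n k))"

lemma S_edge_met_Slash: "S_edge_met n (x, y) Slash = int n + 1 - x"
proof -
  have "on_line (centre (x, y)) Slash (S_edge_centre n k) \<longleftrightarrow> k = int n + 1 - x" for k
  proof -
    have "on_line (centre (x, y)) Slash (S_edge_centre n k) \<longleftrightarrow>
        (of_int (int n - k + 1) :: rat) = of_int x"
      by (auto simp: on_line_def S_edge_centre_def algebra_simps intro: exI[of _ "- of_int y - 1"])
    then show ?thesis by (simp only: of_int_eq_iff) auto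
  qed
  then show ?thesis by (simp add: S_edge_met_def)
qed

lemma S_edge_met_Backslash: "S_edge_met n (x, y) Backslash = int n - x - y"
proof -
  have "on_line (centre (x, y)) Backslash (S_edge_centre n k) \<longleftrightarrow> k = int n - x - y" for k
  proof -
    have "on_line (centre (x, y)) Backslash (S_edge_centre n k) \<longleftrightarrow>
        (of_int (int n - k) :: rat) = of_int (x + y)"
      by (auto simp: on_line_def S_edge_centre_def algebra_simps intro!: exI[of _ "- of_int y - 1"])
    then show ?thesis by (simp only: of_int_eq_iff) auto
  qed
  then show ?thesis by (simp add: S_edge_met_def)
qed

definition equivariant_places :: "piece set \<Rightarrow> point set" where
  "equivariant_places P = {p. (Equivariant, p) \<in> P}"

text \<open>The line parallel to the NW side has direction \<open>Slash\<close>, the one parallel to the NE side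
  has direction \<open>Backslash\<close>.\<close>

definition puzzle_c_factors :: "nat \<Rightarrow> piece set \<Rightarrow> factor multiset" where
  "puzzle_c_factors n P =
     image_mset (\<lambda>p. let e = S_edge_met n p Slash; f = S_edge_met n p Backslash in (e, f))
       (mset_set (equivariant_places P))"

definition puzzle_C_factors :: "nat \<Rightarrow> piece set \<Rightarrow> factor multiset" where
  "puzzle_C_factors n P =
     image_mset (\<lambda>p. let e = S_edge_met n p Slash; f = S_edge_met n p Backslash in
                   (int n + 1 - f, int n + 1 - e))
       (mset_set (equivariant_places P))"

definition puzzle_c :: "nat \<Rightarrow> piece set \<Rightarrow> zpoly" where
  "puzzle_c n P = expand (puzzle_c_factors n P)"

definition puzzle_C :: "nat \<Rightarrow> piece set \<Rightarrow> zpoly" where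
  "puzzle_C n P = expand (puzzle_C_factors n P)"

end

theory Submission
  imports Defs
begin

text \<open>Cut the puzzle along lines parallel to its NE side into \<open>n\<close> strips, numbered from that side,
  and let strand \<open>k\<close> be the path of ones that enters the puzzle through the \<open>k\<close>-th one of the NE
  side. On each line it occupies the position \<open>n - d + k - 1 - N\<^sub>k\<close>, where \<open>N\<^sub>k\<close> is \<open>\<lambda>\<^sub>k\<close> at first
  and finally \<open>\<nu>\<^sub>k\<close>. Where it runs together with a path of ones coming from the NW side, call it
  unmarked, otherwise marked. In each strip a marked strand is crossed by a path of zeros coming from
  the NW side, either in a \<open>HorizBack\<close> piece, so that \<open>N\<^sub>k\<close> grows by 1, or in an equivariant piece,
  so that \<open>N\<^sub>k\<close> stays the same; or else its mark passes to strand \<open>k - 1\<close>, or, for \<open>k = 1\<close>,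
  disappears, and this happens precisely in the strips that start with a one on the NW side.

  In a tableau, assign the entry \<open>a\<close> with value \<open>k\<close> in the box \<open>(r, c)\<close> of \<open>\<mu>\<close> to the strip
  \<open>k' + c - r\<close>. Along each row this number increases strictly with \<open>c\<close>, so the entries of row \<open>r\<close>
  become the crossings of one mark: the mark sits on strand \<open>k\<close> at that moment, and an unbarred entry
  lets \<open>N\<^sub>k\<close> grow. The column reading and the reading strip by strip order the entries \<open>k\<close> and
  \<open>k + 1\<close> in the same way, so the Yamanouchi condition says that \<open>N\<close> is a partition on each line,
  and positivity of the factors says that no strand is crossed by a barred entry once it has reached
  the S side. Hence puzzles and tableaux are the same motions of marks and strands, and the
  equivariant piece on strand \<open>k\<close> in strip \<open>f\<close> has the weight \<open>y\<^bsub>k' + N\<^sub>k\<^esub> - y\<^sub>f\<close> of the barred entry.\<close>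

section \<open>Puzzles as labellings of upward cells\<close>

text \<open>The number k' + c - r is a clock: mark r starts on strand d + 1 - r and in each strip is
  either crossed or drops by one strand, so if its c-th crossing takes place on strand k, then c - 1
  crossings and d + 1 - r - k drops precede it. A row of a tableau is thus a choice of the strips in
  which one mark is crossed. The obstacle is that labels are anonymous: a label 1 does not tell
  which strand or mark it belongs to, and a strand that has reached the S side leaves no label on
  later lines. So puzzles and tableaux are both compared with sequences of pairs of functions in
  which marks and strands keep their indices, vanished marks go on dropping and finished strands
  stand still. The last pair then contains \<mu> and \<nu> in the form in which the first contains
  \<lambda>. Positivity is a matter of room: an equivariant piece extends below its upward half, so
  it does not fit at the end of a strip, and n - S > t + 1 says just this for position S in strip t
  + 1. The map \<Phi> gets no formula; it is chosen from the relation of having the same motion, for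
  which partners exist and are unique on both sides.\<close>

fun slash_label :: "kind \<Rightarrow> nat" where
  "slash_label Up0 = 0" | "slash_label Down0 = 0" | "slash_label Up1 = 1" | "slash_label Down1 = 1"
| "slash_label HorizBack = 2" | "slash_label HorizSlash = 0"
| "slash_label SlashBack = 1" | "slash_label Equivariant = 0"

fun back_label :: "kind \<Rightarrow> nat" where
  "back_label Up0 = 0" | "back_label Down0 = 0" | "back_label Up1 = 1" | "back_label Down1 = 1"
| "back_label HorizBack = 1" | "back_label HorizSlash = 2"
| "back_label SlashBack = 0" | "back_label Equivariant = 1"

text \<open>Two rhombi have a horizontal diagonal. The separate values 2 and 3 force both halves of
  such a rhombus to belong to the same piece.\<close>

fun horiz_label :: "kind \<Rightarrow> nat" where
  "horiz_label Up0 = 0" | "horiz_label Down0 = 0" | "horiz_label Up1 = 1" | "horiz_label Down1 = 1"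
| "horiz_label HorizBack = 0" | "horiz_label HorizSlash = 1"
| "horiz_label SlashBack = 2" | "horiz_label Equivariant = 3"

definition up_kinds :: "kind set" where
  "up_kinds = {Up0, Up1, HorizBack, HorizSlash, SlashBack, Equivariant}"

definition down_kinds :: "kind set" where
  "down_kinds = {Down0, Down1, HorizBack, HorizSlash, SlashBack, Equivariant}"

text \<open>A rhombus with horizontal diagonal is located by its lowest vertex, one row below the
  base of its upward half; hence the shift.\<close>

fun up_piece :: "kind \<Rightarrow> point \<Rightarrow> piece" where
  "up_piece SlashBack (x, y) = (SlashBack, (x + 1, y - 1))"
| "up_piece Equivariant (x, y) = (Equivariant, (x + 1, y - 1))"
| "up_piece k z = (k, z)"

fun down_piece :: "kind \<Rightarrow> point \<Rightarrow> piece" where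
  "down_piece SlashBack (x, y) = (SlashBack, (x + 1, y))"
| "down_piece Equivariant (x, y) = (Equivariant, (x + 1, y))"
| "down_piece HorizBack (x, y) = (HorizBack, (x + 1, y))"
| "down_piece k z = (k, z)"

lemma Up_mem_cells: "Up z \<in> cells q \<longleftrightarrow> (\<exists>k \<in> up_kinds. q = up_piece k z)"
  by (cases q; cases z; cases "fst q") (auto simp: up_kinds_def)

lemma Down_mem_cells: "Down z \<in> cells q \<longleftrightarrow> (\<exists>k \<in> down_kinds. q = down_piece k z)"
  by (cases q; cases z; cases "fst q") (auto simp: down_kinds_def)

lemma fst_up_piece [simp]: "fst (up_piece k z) = k"
  by (cases z; cases k) auto

lemma fst_down_piece [simp]: "fst (down_piece k z) = k"
  by (cases z; cases k) auto

definition up_region :: "nat \<Rightarrow> point set" where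
  "up_region n = {(x, y). 0 \<le> x \<and> 0 \<le> y \<and> x + y + 1 \<le> int n}"

definition down_region :: "nat \<Rightarrow> point set" where
  "down_region n = {(x, y). 0 \<le> x \<and> 0 \<le> y \<and> x + y + 2 \<le> int n}"

lemma big_triangle_Up [simp]: "Up z \<in> big_triangle n \<longleftrightarrow> z \<in> up_region n"
  by (cases z) (auto simp: big_triangle_def up_region_def)

lemma big_triangle_Down [simp]: "Down z \<in> big_triangle n \<longleftrightarrow> z \<in> down_region n"
  by (cases z) (auto simp: big_triangle_def down_region_def)

definition up_kind :: "piece set \<Rightarrow> point \<Rightarrow> kind" where
  "up_kind P z = fst (THE q. q \<in> P \<and> Up z \<in> cells q)"

definition down_kind :: "piece set \<Rightarrow> point \<Rightarrow> kind" where
  "down_kind P z = fst (THE q. q \<in> P \<and> Down z \<in> cells q)"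

text \<open>A puzzle is determined by the kinds of the pieces covering its upward cells, because each
  edge of the triangle is a side of exactly one upward cell. The three edges of a downward cell
  have to carry the labels of one of the six pieces that can cover it; labels greater than 1 stand
  for the diagonals of rhombi.\<close>

definition local_rules :: "nat \<Rightarrow> (point \<Rightarrow> kind) \<Rightarrow> bool" where
  "local_rules n U \<longleftrightarrow>
     (\<forall>z \<in> up_region n. U z \<in> up_kinds) \<and>
     (\<forall>i \<in> {0..<int n}. slash_label (U (0, i)) \<le> 1 \<and> horiz_label (U (i, 0)) \<le> 1 \<and>
        back_label (U (i, int n - 1 - i)) \<le> 1) \<and>
     (\<forall>x y. (x, y) \<in> down_region n \<longrightarrow>
        (\<exists>k \<in> down_kinds. horiz_label k = horiz_label (U (x, y + 1)) \<and>
           back_label k = back_label (U (x, y)) \<and> slash_label k = slash_label (U (x + 1, y))))"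

section \<open>Local rules satisfied by a puzzle\<close>

context
  fixes n :: nat and P :: "piece set"
  assumes P: "P \<in> puzzles n"
begin

lemma puzzle_piece_unique:
  "t \<in> big_triangle n \<Longrightarrow> q \<in> P \<Longrightarrow> q' \<in> P \<Longrightarrow> t \<in> cells q \<Longrightarrow> t \<in> cells q' \<Longrightarrow> q = q'"
proof -
  assume "t \<in> big_triangle n" and q: "q \<in> P" "q' \<in> P" "t \<in> cells q" "t \<in> cells q'"
  then have "\<exists>!q. q \<in> P \<and> t \<in> cells q"
    using P by (simp add: puzzles_def)
  then show "q = q'" using q by blast
qed

lemma puzzle_labels_agree:
  "q \<in> P \<Longrightarrow> q' \<in> P \<Longrightarrow> (e, l) \<in> labelled_edges q \<Longrightarrow> (e, l') \<in> labelled_edges q' \<Longrightarrow> l = l'"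
  using P unfolding puzzles_def by blast

lemma puzzle_cells_subset: "q \<in> P \<Longrightarrow> cells q \<subseteq> big_triangle n"
  using P by (simp add: puzzles_def)

lemma up_piece_mem:
  assumes "z \<in> up_region n"
  shows "up_piece (up_kind P z) z \<in> P" "up_kind P z \<in> up_kinds"
proof -
  have "\<exists>!q. q \<in> P \<and> Up z \<in> cells q"
    using P assms by (simp add: puzzles_def)
  from theI'[OF this] have "(THE q. q \<in> P \<and> Up z \<in> cells q) \<in> P"
    and "Up z \<in> cells (THE q. q \<in> P \<and> Up z \<in> cells q)" by auto
  then show "up_piece (up_kind P z) z \<in> P" "up_kind P z \<in> up_kinds"
    by (auto simp: up_kind_def Up_mem_cells)
qed

lemma down_piece_mem:
  assumes "z \<in> down_region n"
  shows "down_piece (down_kind P z) z \<in> P" "down_kind P z \<in> down_kinds"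
proof -
  have "\<exists>!q. q \<in> P \<and> Down z \<in> cells q"
    using P assms by (simp add: puzzles_def)
  from theI'[OF this] have "(THE q. q \<in> P \<and> Down z \<in> cells q) \<in> P"
    and "Down z \<in> cells (THE q. q \<in> P \<and> Down z \<in> cells q)" by auto
  then show "down_piece (down_kind P z) z \<in> P" "down_kind P z \<in> down_kinds"
    by (auto simp: down_kind_def Down_mem_cells)
qed

lemma up_kind_eqI:
  assumes "up_piece k z \<in> P" "k \<in> up_kinds"
  shows "z \<in> up_region n \<and> up_kind P z = k"
proof -
  have "Up z \<in> cells (up_piece k z)" using assms(2) by (auto simp: Up_mem_cells)
  moreover from this have z: "z \<in> up_region n" using puzzle_cells_subset[OF assms(1)] by auto
  moreover have "Up z \<in> cells (up_piece (up_kind P z) z)"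
    using up_piece_mem[OF z] by (auto simp: Up_mem_cells)
  ultimately have "up_piece k z = up_piece (up_kind P z) z"
    using puzzle_piece_unique[of "Up z"] assms up_piece_mem[OF z] by simp
  then show ?thesis using z by (metis fst_up_piece)
qed

lemma down_kind_eqI:
  assumes "down_piece k z \<in> P" "k \<in> down_kinds"
  shows "z \<in> down_region n \<and> down_kind P z = k"
proof -
  have "Down z \<in> cells (down_piece k z)" using assms(2) by (auto simp: Down_mem_cells)
  moreover from this have z: "z \<in> down_region n" using puzzle_cells_subset[OF assms(1)] by auto
  moreover have "Down z \<in> cells (down_piece (down_kind P z) z)"
    using down_piece_mem[OF z] by (auto simp: Down_mem_cells)
  ultimately have "down_piece k z = down_piece (down_kind P z) z"
    using puzzle_piece_unique[of "Down z"] assms down_piece_mem[OF z] by simp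
  then show ?thesis using z by (metis fst_down_piece)
qed

end

lemma up_labels:
  assumes "k \<in> up_kinds"
  shows "slash_label k \<le> 1 \<Longrightarrow> (((x, y), Slash), slash_label k) \<in> labelled_edges (up_piece k (x, y))"
    and "back_label k \<le> 1 \<Longrightarrow>
      (((x + 1, y), Backslash), back_label k) \<in> labelled_edges (up_piece k (x, y))"
    and "horiz_label k \<le> 1 \<Longrightarrow>
      (((x, y), Horizontal), horiz_label k) \<in> labelled_edges (up_piece k (x, y))"
  using assms by (auto simp: up_kinds_def up_edges_def rhombus_edges_def)

lemma down_labels:
  assumes "k \<in> down_kinds"
  shows "slash_label k \<le> 1 \<Longrightarrow>
      (((x + 1, y), Slash), slash_label k) \<in> labelled_edges (down_piece k (x, y))"
    and "back_label k \<le> 1 \<Longrightarrow>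
      (((x + 1, y), Backslash), back_label k) \<in> labelled_edges (down_piece k (x, y))"
    and "horiz_label k \<le> 1 \<Longrightarrow>
      (((x, y + 1), Horizontal), horiz_label k) \<in> labelled_edges (down_piece k (x, y))"
  using assms by (auto simp: down_kinds_def down_edges_def rhombus_edges_def)

lemma rhombus_piece_eq:
  "down_piece HorizBack (x, y) = up_piece HorizBack (x + 1, y)"
  "down_piece HorizSlash (x, y) = up_piece HorizSlash (x, y)"
  "down_piece SlashBack (x, y) = up_piece SlashBack (x, y + 1)"
  "down_piece Equivariant (x, y) = up_piece Equivariant (x, y + 1)"
  by auto

lemma label_gt_1:
  "k \<in> up_kinds \<union> down_kinds \<Longrightarrow> \<not> slash_label k \<le> 1 \<longleftrightarrow> k = HorizBack"
  "k \<in> up_kinds \<union> down_kinds \<Longrightarrow> \<not> back_label k \<le> 1 \<longleftrightarrow> k = HorizSlash"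
  "k \<in> up_kinds \<union> down_kinds \<Longrightarrow> \<not> horiz_label k \<le> 1 \<longleftrightarrow> k = SlashBack \<or> k = Equivariant"
  by (cases k; simp)+

lemma label_internal:
  "slash_label k = 2 \<longleftrightarrow> k = HorizBack" "back_label k = 2 \<longleftrightarrow> k = HorizSlash"
  "horiz_label k = 2 \<longleftrightarrow> k = SlashBack" "horiz_label k = 3 \<longleftrightarrow> k = Equivariant"
  by (cases k; simp)+

lemma kind_mem [simp]:
  "HorizBack \<in> up_kinds" "HorizSlash \<in> up_kinds" "SlashBack \<in> up_kinds" "Equivariant \<in> up_kinds"
  "HorizBack \<in> down_kinds" "HorizSlash \<in> down_kinds" "SlashBack \<in> down_kinds"
  "Equivariant \<in> down_kinds"
  by (auto simp: up_kinds_def down_kinds_def)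

context
  fixes n :: nat and P :: "piece set"
  assumes P: "P \<in> puzzles n"
begin

text \<open>Across an edge that is a side, both pieces carry the same label. A diagonal is not among
  \<open>labelled_edges\<close>; there both cells belong to one rhombus, so even their kinds agree.
  This is why \<open>rh\<close> compares kinds before labels are compared.\<close>

lemma down_kind_labels:
  assumes "(x, y) \<in> down_region n"
  shows "slash_label (down_kind P (x, y)) = slash_label (up_kind P (x + 1, y))"
    and "back_label (down_kind P (x, y)) = back_label (up_kind P (x, y))"
    and "horiz_label (down_kind P (x, y)) = horiz_label (up_kind P (x, y + 1))"
proof -
  let ?k = "down_kind P (x, y)"
  have z: "(x + 1, y) \<in> up_region n" "(x, y) \<in> up_region n" "(x, y + 1) \<in> up_region n"
    using assms by (auto simp: down_region_def up_region_def)
  note D = down_piece_mem[OF P assms] and U = z[THEN up_piece_mem(1)[OF P]] z[THEN up_piece_mem(2)[OF P]]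
  have rh: "up_kind P (x + 1, y) = HorizBack \<longleftrightarrow> ?k = HorizBack"
    "up_kind P (x, y) = HorizSlash \<longleftrightarrow> ?k = HorizSlash"
    "up_kind P (x, y + 1) = SlashBack \<longleftrightarrow> ?k = SlashBack"
    "up_kind P (x, y + 1) = Equivariant \<longleftrightarrow> ?k = Equivariant"
    using up_kind_eqI[OF P, of _ "(x + 1, y)"] up_kind_eqI[OF P, of _ "(x, y)"]
      up_kind_eqI[OF P, of _ "(x, y + 1)"] down_kind_eqI[OF P, of _ "(x, y)"] D U rhombus_piece_eq[of x y]
    by (metis kind_mem)+
  note agree = puzzle_labels_agree[OF P D(1)]
  show "slash_label ?k = slash_label (up_kind P (x + 1, y))"
    using agree[OF U(1) down_labels(1) up_labels(1)] D U rh label_gt_1(1)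
    by (metis UnCI)
  show "back_label ?k = back_label (up_kind P (x, y))"
    using agree[OF U(2) down_labels(2) up_labels(2)] D U rh label_gt_1(2)
    by (metis UnCI)
  show "horiz_label ?k = horiz_label (up_kind P (x, y + 1))"
    using agree[OF U(3) down_labels(3) up_labels(3)] D U rh label_gt_1(3)
    by (metis UnCI)
qed

text \<open>The rules on the boundary hold because a diagonal there would belong to a rhombus whose
  other half lies outside the big triangle.\<close>

lemma puzzle_local_rules: "local_rules n (up_kind P)"
  unfolding local_rules_def
proof (intro conjI ballI allI impI)
  fix z assume "z \<in> up_region n" then show "up_kind P z \<in> up_kinds"
    by (rule up_piece_mem[OF P])
next
  fix i assume "i \<in> {0..<int n}"
  then have z: "(0, i) \<in> up_region n" "(i, 0) \<in> up_region n" "(i, int n - 1 - i) \<in> up_region n"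
    by (auto simp: up_region_def)
  have "up_kind P (0, i) \<noteq> HorizBack"
  proof
    assume "up_kind P (0, i) = HorizBack"
    then show False
      using up_piece_mem(1)[OF P z(1)] puzzle_cells_subset[OF P, of "(HorizBack, 0, i)"]
      by (auto simp: down_region_def)
  qed
  then show "slash_label (up_kind P (0, i)) \<le> 1"
    using up_piece_mem(2)[OF P z(1)] label_gt_1(1) by blast
  have "up_kind P (i, 0) \<noteq> SlashBack" "up_kind P (i, 0) \<noteq> Equivariant"
    using up_piece_mem(1)[OF P z(2)] puzzle_cells_subset[OF P, of "(SlashBack, i + 1, - 1)"]
      puzzle_cells_subset[OF P, of "(Equivariant, i + 1, - 1)"]
    by (auto simp: down_region_def)
  then show "horiz_label (up_kind P (i, 0)) \<le> 1"
    using up_piece_mem(2)[OF P z(2)] label_gt_1(3) by blast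
  have "up_kind P (i, int n - 1 - i) \<noteq> HorizSlash"
    using up_piece_mem(1)[OF P z(3)] puzzle_cells_subset[OF P, of "(HorizSlash, i, int n - 1 - i)"]
    by (auto simp: down_region_def)
  then show "back_label (up_kind P (i, int n - 1 - i)) \<le> 1"
    using up_piece_mem(2)[OF P z(3)] label_gt_1(2) by blast
next
  fix x y assume "(x, y) \<in> down_region n"
  then show "\<exists>k \<in> down_kinds. horiz_label k = horiz_label (up_kind P (x, y + 1)) \<and>
           back_label k = back_label (up_kind P (x, y)) \<and> slash_label k = slash_label (up_kind P (x + 1, y))"
    using down_kind_labels down_piece_mem[OF P] by metis
qed

lemma edge_label_eqI: "q \<in> P \<Longrightarrow> (e, l) \<in> labelled_edges q \<Longrightarrow> edge_label P e = l"
  unfolding edge_label_def using puzzle_labels_agree[OF P] by blast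

lemma boundary_words:
  "NE_word n P = map (\<lambda>i. back_label (up_kind P (int i, int n - 1 - int i))) [0..<n]"
  "NW_word n P = map (\<lambda>i. slash_label (up_kind P (0, int i))) [0..<n]"
  "S_word n P = map (\<lambda>i. horiz_label (up_kind P (int i, 0))) [0..<n]"
proof -
  have z: "(0, int i) \<in> up_region n" "(int i, 0) \<in> up_region n"
    "(int i, int n - 1 - int i) \<in> up_region n" if "i < n" for i
    using that by (auto simp: up_region_def)
  have b: "slash_label (up_kind P (0, int i)) \<le> 1" "horiz_label (up_kind P (int i, 0)) \<le> 1"
    "back_label (up_kind P (int i, int n - 1 - int i)) \<le> 1" if "i < n" for i
    using puzzle_local_rules that by (auto simp: local_rules_def)
  show "NE_word n P = map (\<lambda>i. back_label (up_kind P (int i, int n - 1 - int i))) [0..<n]"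
    unfolding NE_word_def
  proof (intro map_cong refl)
    fix i assume "i \<in> set [0..<n]"
    then have i: "i < n" by simp
    have "edge_label P ((int i + 1, int n - 1 - int i), Backslash) =
        back_label (up_kind P (int i, int n - 1 - int i))"
      by (intro edge_label_eqI[OF up_piece_mem(1)[OF P] up_labels(2)] up_piece_mem(2)[OF P] z b i)
    then show "edge_label P ((int i + 1, int n - int i - 1), Backslash) =
        back_label (up_kind P (int i, int n - 1 - int i))"
      by (simp add: diff_diff_eq add.commute)
  qed
  show "NW_word n P = map (\<lambda>i. slash_label (up_kind P (0, int i))) [0..<n]"
    unfolding NW_word_def
    using edge_label_eqI[OF up_piece_mem(1)[OF P] up_labels(1)] z b up_piece_mem(2)[OF P] by auto
  show "S_word n P = map (\<lambda>i. horiz_label (up_kind P (int i, 0))) [0..<n]"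
    unfolding S_word_def
    using edge_label_eqI[OF up_piece_mem(1)[OF P] up_labels(3)] z b up_piece_mem(2)[OF P] by auto
qed

lemma equivariant_places_eq:
  "equivariant_places P =
     (\<lambda>(x, y). (x + 1, y - 1)) ` {z \<in> up_region n. up_kind P z = Equivariant}"
proof -
  have "(Equivariant, (x, y)) \<in> P \<longleftrightarrow>
      (x - 1, y + 1) \<in> up_region n \<and> up_kind P (x - 1, y + 1) = Equivariant" for x y
    using up_kind_eqI[OF P, of Equivariant "(x - 1, y + 1)"]
      up_piece_mem(1)[OF P, of "(x - 1, y + 1)"] by auto
  then show ?thesis
    by (force simp: equivariant_places_def image_iff)
qed

end

section \<open>Reconstructing a puzzle from its upward cells\<close>

lemma down_kind_determined:
  "k \<in> down_kinds \<Longrightarrow> k' \<in> down_kinds \<Longrightarrow> horiz_label k = horiz_label k' \<Longrightarrow>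
   back_label k = back_label k' \<Longrightarrow> slash_label k = slash_label k' \<Longrightarrow> k = k'"
  by (auto simp: down_kinds_def)

lemma piece_covers:
  obtains z k where "k \<in> up_kinds" "q = up_piece k z" | z k where "k \<in> down_kinds" "q = down_piece k z"
proof -
  obtain k x y where q: "q = (k, (x, y))" by (metis surj_pair)
  have "q = up_piece k (x, y) \<and> k \<in> up_kinds \<or> q = up_piece k (x - 1, y + 1) \<and> k \<in> up_kinds \<or>
     q = down_piece k (x, y) \<and> k \<in> down_kinds"
    unfolding q by (cases k) (auto simp: up_kinds_def down_kinds_def)
  then show ?thesis using that by blast
qed

lemma puzzle_eqI:
  assumes P: "P \<in> puzzles n" and P': "P' \<in> puzzles n"
    and eq: "\<And>z. z \<in> up_region n \<Longrightarrow> up_kind P z = up_kind P' z"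
  shows "P = P'"
proof -
  have *: "Q \<subseteq> Q'" if Q: "Q \<in> puzzles n" and Q': "Q' \<in> puzzles n"
    and eq: "\<And>z. z \<in> up_region n \<Longrightarrow> up_kind Q z = up_kind Q' z" for Q Q'
  proof
    fix q assume q: "q \<in> Q"
    show "q \<in> Q'"
    proof (cases q rule: piece_covers)
      case (1 z k)
      then show ?thesis using up_kind_eqI[OF Q] q eq up_piece_mem[OF Q'] by metis
    next
      case (2 z k)
      have z: "z \<in> down_region n" and k: "down_kind Q z = k"
        using down_kind_eqI[OF Q] q 2 by auto
      obtain x y where xy: "z = (x, y)" by (cases z)
      have "(x + 1, y) \<in> up_region n" "(x, y) \<in> up_region n" "(x, y + 1) \<in> up_region n"
        using z by (auto simp: xy down_region_def up_region_def)
      then have "down_kind Q z = down_kind Q' z"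
        using down_kind_labels[OF Q, of x y] down_kind_labels[OF Q', of x y] z eq
          down_piece_mem[OF Q z] down_piece_mem[OF Q' z]
        by (intro down_kind_determined) (auto simp: xy)
      then show ?thesis using down_piece_mem[OF Q' z] 2 k by simp
    qed
  qed
  show ?thesis using *[OF P P'] *[OF P' P] eq by (simp add: subset_antisym)
qed


text \<open>The rules provide a kind \<open>D z\<close> for each downward cell. A diagonal label
  names its rhombus, so the two halves of a rhombus choose each other, and the bound 1 on the
  boundary keeps the second half inside. A rhombus arises from both parts of the union
  \<open>P\<close>, as the same piece.\<close>

lemma puzzle_of_local_rules:
  assumes "local_rules n U"
  obtains P where "P \<in> puzzles n" "\<And>z. z \<in> up_region n \<Longrightarrow> up_kind P z = U z"
proof -
  have U: "U z \<in> up_kinds" if "z \<in> up_region n" for z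
    using assms that by (simp add: local_rules_def)
  have "\<forall>z \<in> down_region n. \<exists>k. k \<in> down_kinds \<and> horiz_label k = horiz_label (U (z + (0, 1))) \<and>
           back_label k = back_label (U z) \<and> slash_label k = slash_label (U (z + (1, 0)))"
    using assms by (fastforce simp: local_rules_def)
  from bchoice[OF this] obtain D where D0: "\<forall>z \<in> down_region n. D z \<in> down_kinds \<and>
      horiz_label (D z) = horiz_label (U (z + (0, 1))) \<and> back_label (D z) = back_label (U z) \<and>
      slash_label (D z) = slash_label (U (z + (1, 0)))" by blast
  have D: "D z \<in> down_kinds" if "z \<in> down_region n" for z
    using D0 that by blast
  have D_horiz: "horiz_label (D (x, y)) = horiz_label (U (x, y + 1))"
    and D_back: "back_label (D (x, y)) = back_label (U (x, y))"
    and D_slash: "slash_label (D (x, y)) = slash_label (U (x + 1, y))"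
    if "(x, y) \<in> down_region n" for x y
    using bspec[OF D0 that] by auto
  define P where "P = (\<lambda>z. up_piece (U z) z) ` up_region n \<union> (\<lambda>z. down_piece (D z) z) ` down_region n"
  have up_nb: "(x + 1, y) \<in> up_region n" "(x, y) \<in> up_region n" "(x, y + 1) \<in> up_region n"
    if "(x, y) \<in> down_region n" for x y
    using that by (auto simp: down_region_def up_region_def)
  have bnd: "0 \<le> i \<Longrightarrow> i < int n \<Longrightarrow> slash_label (U (0, i)) \<le> 1 \<and> horiz_label (U (i, 0)) \<le> 1 \<and>
        back_label (U (i, int n - 1 - i)) \<le> 1" for i
    using assms by (simp add: local_rules_def)
  have U_eq: "U (x, y) = HorizBack \<Longrightarrow> (x - 1, y) \<in> down_region n \<and> D (x - 1, y) = HorizBack"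
    "U (x, y) = HorizSlash \<Longrightarrow> (x, y) \<in> down_region n \<and> D (x, y) = HorizSlash"
    "U (x, y) = SlashBack \<Longrightarrow> (x, y - 1) \<in> down_region n \<and> D (x, y - 1) = SlashBack"
    "U (x, y) = Equivariant \<Longrightarrow> (x, y - 1) \<in> down_region n \<and> D (x, y - 1) = Equivariant"
    if z: "(x, y) \<in> up_region n" for x y
  proof -
    assume k: "U (x, y) = HorizBack"
    then have "x \<noteq> 0" using bnd[of y] z by (auto simp: up_region_def)
    then have "(x - 1, y) \<in> down_region n" using z by (auto simp: up_region_def down_region_def)
    then show "(x - 1, y) \<in> down_region n \<and> D (x - 1, y) = HorizBack"
      using D_slash[of "x - 1" y] D[of "(x - 1, y)"] k by (auto simp: down_kinds_def)
  next
    assume k: "U (x, y) = HorizSlash"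
    then have "y \<noteq> int n - 1 - x" using bnd[of x] z by (auto simp: up_region_def)
    then have "(x, y) \<in> down_region n" using z by (auto simp: up_region_def down_region_def)
    then show "(x, y) \<in> down_region n \<and> D (x, y) = HorizSlash"
      using D_back[of x y] D[of "(x, y)"] k by (auto simp: down_kinds_def)
  next
    assume k: "U (x, y) = SlashBack"
    then have "y \<noteq> 0" using bnd[of x] z by (auto simp: up_region_def)
    then have "(x, y - 1) \<in> down_region n" using z by (auto simp: up_region_def down_region_def)
    then show "(x, y - 1) \<in> down_region n \<and> D (x, y - 1) = SlashBack"
      using D_horiz[of x "y - 1"] D[of "(x, y - 1)"] k by (auto simp: down_kinds_def)
  next
    assume k: "U (x, y) = Equivariant"
    then have "y \<noteq> 0" using bnd[of x] z by (auto simp: up_region_def)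
    then have "(x, y - 1) \<in> down_region n" using z by (auto simp: up_region_def down_region_def)
    then show "(x, y - 1) \<in> down_region n \<and> D (x, y - 1) = Equivariant"
      using D_horiz[of x "y - 1"] D[of "(x, y - 1)"] k by (auto simp: down_kinds_def)
  qed
  have D_eq: "D (x, y) = HorizBack \<Longrightarrow> U (x + 1, y) = HorizBack"
    "D (x, y) = HorizSlash \<Longrightarrow> U (x, y) = HorizSlash"
    "D (x, y) = SlashBack \<Longrightarrow> U (x, y + 1) = SlashBack"
    "D (x, y) = Equivariant \<Longrightarrow> U (x, y + 1) = Equivariant"
    if "(x, y) \<in> down_region n" for x y
    using D_slash[OF that] D_back[OF that] D_horiz[OF that] by (metis label_internal)+
  have up_only: "q = up_piece (U z) z" if q: "q \<in> P" and z: "Up z \<in> cells q" for q z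
  proof -
    obtain x y where xy: "z = (x, y)" by (cases z)
    from q consider w where "w \<in> up_region n" "q = up_piece (U w) w"
      | w where "w \<in> down_region n" "q = down_piece (D w) w" by (auto simp: P_def)
    then show ?thesis
    proof cases
      case 1
      moreover have "w = z" using 1 z U[OF 1(1)] by (cases w) (auto simp: up_kinds_def xy)
      ultimately show ?thesis by simp
    next
      case 2
      obtain a b where w: "w = (a, b)" by (cases w)
      from D[OF 2(1)] show ?thesis
        using 2 z D_eq[of a b] by (auto simp: down_kinds_def xy w)
    qed
  qed
  have down_only: "q = down_piece (D z) z" if q: "q \<in> P" and z: "Down z \<in> cells q" for q z
  proof -
    obtain x y where xy: "z = (x, y)" by (cases z)
    from q consider w where "w \<in> up_region n" "q = up_piece (U w) w"
      | w where "w \<in> down_region n" "q = down_piece (D w) w" by (auto simp: P_def)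
    then show ?thesis
    proof cases
      case 2
      moreover have "w = z" using 2 z D[OF 2(1)] by (cases w) (auto simp: down_kinds_def xy)
      ultimately show ?thesis by simp
    next
      case 1
      obtain a b where w: "w = (a, b)" by (cases w)
      from U[OF 1(1)] show ?thesis
        using 1 z U_eq[of a b] by (auto simp: up_kinds_def xy w)
    qed
  qed
  \<comment> \<open>Every edge gets its label from the upward cell having it as a side; all pieces
    agree with this one function, hence with each other. A \<open>Backslash\<close> edge starts at
    the right end of its cell, whence x - 1.\<close>
  define lab where "lab e = (case e of ((x, y), a) \<Rightarrow> (case a of Horizontal \<Rightarrow> horiz_label (U (x, y))
      | Slash \<Rightarrow> slash_label (U (x, y)) | Backslash \<Rightarrow> back_label (U (x - 1, y))))" for e
  have lab_up: "l = lab e" if z: "z \<in> up_region n" and e: "(e, l) \<in> labelled_edges (up_piece (U z) z)"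
    for e l z
  proof -
    obtain x y where xy: "z = (x, y)" by (cases z)
    from U[OF z] show ?thesis
      using e z U_eq[of x y] D_slash[of "x - 1" y] D_back[of "x - 1" y] D_horiz[of "x - 1" y]
        D_slash[of x y] D_back[of x y] D_horiz[of x y]
        D_slash[of x "y - 1"] D_back[of x "y - 1"] D_horiz[of x "y - 1"]
      by (auto simp: up_kinds_def xy lab_def up_edges_def rhombus_edges_def)
  qed
  have lab_down: "l = lab e"
    if z: "z \<in> down_region n" and e: "(e, l) \<in> labelled_edges (down_piece (D z) z)" for e l z
  proof -
    obtain x y where xy: "z = (x, y)" by (cases z)
    have nb: "(x + 1, y) \<in> up_region n" "(x, y) \<in> up_region n" "(x, y + 1) \<in> up_region n"
      using up_nb z by (auto simp: xy)
    have rh: "down_piece (D z) z = up_piece (U w) w \<Longrightarrow> w \<in> up_region n \<Longrightarrow> ?thesis" for w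
      using lab_up e by metis
    from D[OF z] consider "D z = Down0" | "D z = Down1" | "D z = HorizBack" | "D z = HorizSlash"
      | "D z = SlashBack" | "D z = Equivariant" by (auto simp: down_kinds_def)
    then show ?thesis
    proof cases
      case 1 then show ?thesis
        using e z D_slash[of x y] D_back[of x y] D_horiz[of x y]
        by (auto simp: xy lab_def down_edges_def)
    next
      case 2 then show ?thesis
        using e z D_slash[of x y] D_back[of x y] D_horiz[of x y]
        by (auto simp: xy lab_def down_edges_def)
    next
      case 3 then show ?thesis using rh[of "(x + 1, y)"] D_eq[of x y] z nb by (simp add: xy)
    next
      case 4 then show ?thesis using rh[of "(x, y)"] D_eq[of x y] z nb by (simp add: xy)
    next
      case 5 then show ?thesis using rh[of "(x, y + 1)"] D_eq[of x y] z nb by (simp add: xy)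
    next
      case 6 then show ?thesis using rh[of "(x, y + 1)"] D_eq[of x y] z nb by (simp add: xy)
    qed
  qed
  have "P \<in> puzzles n"
    unfolding puzzles_def
  proof (intro CollectI conjI ballI allI impI)
    fix q assume q: "q \<in> P"
    from q consider w where "w \<in> up_region n" "q = up_piece (U w) w"
      | w where "w \<in> down_region n" "q = down_piece (D w) w" by (auto simp: P_def)
    then show "cells q \<subseteq> big_triangle n"
    proof cases
      case 1
      obtain a b where w: "w = (a, b)" by (cases w)
      from U[OF 1(1)] show ?thesis using 1 U_eq[of a b] by (auto simp: up_kinds_def w)
    next
      case 2
      obtain a b where w: "w = (a, b)" by (cases w)
      from D[OF 2(1)] show ?thesis using 2 up_nb[of a b] by (auto simp: down_kinds_def w)
    qed
  next
    fix t assume t: "t \<in> big_triangle n"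
    show "\<exists>!q. q \<in> P \<and> t \<in> cells q"
    proof (cases t)
      case (Up z)
      then have z: "z \<in> up_region n" using t by simp
      show ?thesis
      proof (rule ex1I[of _ "up_piece (U z) z"])
        show "up_piece (U z) z \<in> P \<and> t \<in> cells (up_piece (U z) z)"
          using z U[OF z] Up by (auto simp: P_def Up_mem_cells)
      qed (use up_only Up in simp)
    next
      case (Down z)
      then have z: "z \<in> down_region n" using t by simp
      show ?thesis
      proof (rule ex1I[of _ "down_piece (D z) z"])
        show "down_piece (D z) z \<in> P \<and> t \<in> cells (down_piece (D z) z)"
          using z D[OF z] Down by (auto simp: P_def Down_mem_cells)
      qed (use down_only Down in simp)
    qed
  next
    fix q q' e l l'
    assume "q \<in> P" "q' \<in> P" and e: "(e, l) \<in> labelled_edges q \<and> (e, l') \<in> labelled_edges q'"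
    then have "l = lab e" "l' = lab e" using lab_up lab_down unfolding P_def by blast+
    then show "l = l'" by simp
  qed
  moreover have "up_kind P z = U z" if "z \<in> up_region n" for z
    using up_kind_eqI[OF \<open>P \<in> puzzles n\<close>, of "U z" z] that U[OF that] by (auto simp: P_def)
  ultimately show ?thesis using that by blast
qed

section \<open>Marks and strands in a strip\<close>

definition decreasing_upto :: "nat \<Rightarrow> (int \<Rightarrow> int) \<Rightarrow> bool" where
  "decreasing_upto d m \<longleftrightarrow> (\<forall>i j. 1 \<le> i \<and> i < j \<and> j \<le> int d \<longrightarrow> m j < m i)"

definition increasing_upto :: "nat \<Rightarrow> (int \<Rightarrow> int) \<Rightarrow> bool" where
  "increasing_upto d s \<longleftrightarrow> (\<forall>i j. 1 \<le> i \<and> i < j \<and> j \<le> int d \<longrightarrow> s i < s j)"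

lemma increasing_uptoI:
  assumes "\<And>k. 1 \<le> k \<Longrightarrow> k < int d \<Longrightarrow> s k < s (k + 1)"
  shows "increasing_upto d s"
  unfolding increasing_upto_def
proof (intro allI impI)
  fix i j assume "1 \<le> i \<and> i < j \<and> j \<le> int d"
  then show "s i < s j"
  proof (induction "nat (j - i)" arbitrary: j)
    case (Suc x)
    have last: "s (j - 1) < s j" using assms[of "j - 1"] Suc.prems by simp
    show ?case
    proof (cases "j = i + 1")
      case False
      then have "s i < s (j - 1)" using Suc.hyps(2) Suc.prems by (intro Suc.hyps(1)) auto
      then show ?thesis using last by simp
    qed (use last in simp)
  qed simp
qed

text \<open>In the following \<open>s k\<close> is the position of strand \<open>k\<close> on a line, and \<open>m r\<close> is the strand that
  carries the \<open>r\<close>-th mark. Marks at \<open>m r \<le> 0\<close> have disappeared; they keep moving so that all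
  steps have the same form. Strands beyond the end \<open>n - 1 - t\<close> of line \<open>t\<close> have reached the S side.\<close>

definition marked :: "nat \<Rightarrow> (int \<Rightarrow> int) \<Rightarrow> int \<Rightarrow> bool" where
  "marked d m k \<longleftrightarrow> (\<exists>r \<in> {1..int d}. m r = k)"

text \<open>Only marked strands have to lie on line t; an unmarked one may have left through the S
  side. Bounding the first mark by d bounds them all, since m decreases.\<close>

definition config :: "nat \<Rightarrow> nat \<Rightarrow> nat \<Rightarrow> (int \<Rightarrow> int) \<Rightarrow> (int \<Rightarrow> int) \<Rightarrow> bool" where
  "config n d t m s \<longleftrightarrow> decreasing_upto d m \<and> increasing_upto d s \<and> 0 \<le> s 1 \<and> m 1 \<le> int d \<and>
     (\<forall>k \<in> {1..int d}. marked d m k \<longrightarrow> s k \<le> int n - 1 - int t)"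

text \<open>The values are those of \<open>back_label\<close>: an unmarked strand on the line lies
  on the diagonal of a \<open>HorizSlash\<close> piece, with label 2.\<close>

definition line_label :: "nat \<Rightarrow> (int \<Rightarrow> int) \<Rightarrow> (int \<Rightarrow> int) \<Rightarrow> int \<Rightarrow> nat" where
  "line_label d m s x =
     (if \<exists>k \<in> {1..int d}. s k = x \<and> marked d m k then 1 else if \<exists>k \<in> {1..int d}. s k = x then 2 else 0)"

definition leaves :: "nat \<Rightarrow> (int \<Rightarrow> int) \<Rightarrow> (int \<Rightarrow> int) \<Rightarrow> int \<Rightarrow> bool" where
  "leaves d m m' k \<longleftrightarrow> (\<exists>r \<in> {1..int d}. m r = k \<and> m' r = k - 1)"

definition crosses :: "nat \<Rightarrow> (int \<Rightarrow> int) \<Rightarrow> (int \<Rightarrow> int) \<Rightarrow> int \<Rightarrow> bool" where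
  "crosses d m m' k \<longleftrightarrow> (\<exists>r \<in> {1..int d}. m r = k \<and> m' r = k)"

text \<open>The values of \<open>slash_label\<close> along a strip. A mark leaving strand k travels
  along ones, from the position of strand k to the one right after strand k - 1, or to the NW side
  if k = 1. The value 2 is the diagonal of the \<open>HorizBack\<close> piece in which a strand
  moves by one position.\<close>

definition strip_label ::
    "nat \<Rightarrow> (int \<Rightarrow> int) \<Rightarrow> (int \<Rightarrow> int) \<Rightarrow> (int \<Rightarrow> int) \<Rightarrow> (int \<Rightarrow> int) \<Rightarrow> int \<Rightarrow> nat" where
  "strip_label d m m' s s' x =
     (if \<exists>k \<in> {1..int d}. leaves d m m' k \<and> x \<le> s k \<and> (k = 1 \<or> s (k - 1) < x) then 1
      else if \<exists>k \<in> {1..int d}. s k = x \<and> s' k \<noteq> x then 2 else 0)"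

text \<open>A vanished mark can only drop, whence \<open>1 \<le> m r\<close>. The last clause
  concerns equivariant pieces: their upward half must have room below it, so it is not the last cell
  of the strip.\<close>

definition strip_step :: "nat \<Rightarrow> nat \<Rightarrow> nat \<Rightarrow> (int \<Rightarrow> int) \<Rightarrow> (int \<Rightarrow> int) \<Rightarrow> (int \<Rightarrow> int) \<Rightarrow> (int \<Rightarrow> int) \<Rightarrow> bool"
  where
  "strip_step n d t m m' s s' \<longleftrightarrow>
     (\<forall>r \<in> {1..int d}. m' r = m r \<and> 1 \<le> m r \<or> m' r = m r - 1) \<and>
     (\<forall>k \<in> {1..int d}. s' k = s k \<or> s' k = s k - 1 \<and> crosses d m m' k) \<and>
     (\<forall>k \<in> {1..int d}. crosses d m m' k \<and> s' k = s k \<longrightarrow> s k < int n - 1 - int t)"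

text \<open>The values of \<^term>\<open>slash_label\<close> and \<^term>\<open>back_label\<close> at an upward cell, and those of the next
  edges to the left and below: the six downward pieces allow exactly these combinations.\<close>

definition transitions :: "(nat \<times> nat \<times> nat \<times> nat) set" where
  "transitions = {(0, 0, 0, 0), (0, 0, 1, 2), (0, 1, 1, 0), (0, 2, 1, 1), (0, 2, 2, 0), (1, 0, 0, 1),
     (1, 1, 1, 1), (1, 1, 2, 0), (2, 1, 0, 0), (2, 1, 1, 2)}"

text \<open>The last upward cell of a strip rests on the S side, which cannot be the diagonal of a
  rhombus.\<close>

definition final_labels :: "(nat \<times> nat) set" where
  "final_labels = {(0, 0), (0, 2), (1, 1), (2, 1)}"

section \<open>Positions relative to the strands\<close>

lemma decreasing_upto_inj:
  "decreasing_upto d m \<Longrightarrow> i \<in> {1..int d} \<Longrightarrow> j \<in> {1..int d} \<Longrightarrow> m i = m j \<Longrightarrow> i = j"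
  unfolding decreasing_upto_def by (metis atLeastAtMost_iff less_irrefl linorder_neqE)

lemma increasing_upto_less_iff:
  "increasing_upto d s \<Longrightarrow> i \<in> {1..int d} \<Longrightarrow> j \<in> {1..int d} \<Longrightarrow> s i < s j \<longleftrightarrow> i < j"
  unfolding increasing_upto_def by (metis atLeastAtMost_iff less_asym less_irrefl linorder_neqE)

lemma increasing_upto_le_iff:
  "increasing_upto d s \<Longrightarrow> i \<in> {1..int d} \<Longrightarrow> j \<in> {1..int d} \<Longrightarrow> s i \<le> s j \<longleftrightarrow> i \<le> j"
  using increasing_upto_less_iff[of d s j i] by (simp flip: not_less)

lemma increasing_upto_inj:
  "increasing_upto d s \<Longrightarrow> i \<in> {1..int d} \<Longrightarrow> j \<in> {1..int d} \<Longrightarrow> s i = s j \<Longrightarrow> i = j"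
  using increasing_upto_le_iff by (metis order_antisym order_refl)

text \<open>Here k is the number of strands before position x. Once it is known, the labels at x
  involve strand k + 1 alone, so the quantifiers over strands disappear.\<close>

definition gap :: "nat \<Rightarrow> (int \<Rightarrow> int) \<Rightarrow> int \<Rightarrow> int \<Rightarrow> bool" where
  "gap d s k x \<longleftrightarrow> 0 \<le> k \<and> k \<le> int d \<and> (\<forall>i \<in> {1..int d}. s i < x \<longleftrightarrow> i \<le> k)"

lemma gap_exists:
  assumes "increasing_upto d s"
  obtains k where "gap d s k x"
proof -
  let ?S = "{0} \<union> {i \<in> {1..int d}. s i < x}"
  define k where "k = Max ?S"
  have fin: "finite ?S" by (rule finite_subset[of _ "{0..int d}"]) auto
  have k: "k \<in> ?S" unfolding k_def by (rule Max_in[OF fin]) auto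
  have "s i < x \<longleftrightarrow> i \<le> k" if i: "i \<in> {1..int d}" for i
  proof
    assume "s i < x" then show "i \<le> k" unfolding k_def using i by (intro Max_ge[OF fin]) auto
  next
    assume "i \<le> k"
    then show "s i < x" using k i increasing_upto_le_iff[OF assms i, of k] by auto
  qed
  then have "gap d s k x" using k by (auto simp: gap_def)
  then show ?thesis using that by blast
qed

lemma gapI:
  assumes "increasing_upto d s" "0 \<le> k" "k \<le> int d" "1 \<le> k \<Longrightarrow> s k < x" "k < int d \<Longrightarrow> x \<le> s (k + 1)"
  shows "gap d s k x"
  unfolding gap_def
proof (intro conjI ballI assms)
  fix i assume i: "i \<in> {1..int d}"
  show "s i < x \<longleftrightarrow> i \<le> k"
  proof
    assume "i \<le> k" then show "s i < x"
      using i assms increasing_upto_le_iff[OF assms(1) i, of k] by force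
  next
    assume *: "s i < x" show "i \<le> k"
    proof (rule ccontr)
      assume "\<not> i \<le> k"
      then show False using i assms * increasing_upto_le_iff[OF assms(1) _ i, of "k + 1"] by force
    qed
  qed
qed

lemma gap_strand: "gap d s k x \<Longrightarrow> j \<in> {1..int d} \<Longrightarrow> increasing_upto d s \<Longrightarrow> s j = x \<Longrightarrow> j = k + 1"
  unfolding gap_def using increasing_upto_le_iff[of d s j "k + 1"]
  by (smt (verit, ccfv_threshold) atLeastAtMost_iff)

lemma line_label_gap:
  assumes inc: "increasing_upto d s" and g: "gap d s k x"
  shows "line_label d m s x = (if k < int d \<and> s (k + 1) = x then if marked d m (k + 1) then 1 else 2 else 0)"
proof -
  have 1: "(\<exists>j \<in> {1..int d}. s j = x \<and> marked d m j) \<longleftrightarrow> k < int d \<and> s (k + 1) = x \<and> marked d m (k + 1)"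
    using gap_strand[OF g _ inc] g by (auto simp: gap_def intro: bexI[of _ "k + 1"])
  have 2: "(\<exists>j \<in> {1..int d}. s j = x) \<longleftrightarrow> k < int d \<and> s (k + 1) = x"
    using gap_strand[OF g _ inc] g by (auto simp: gap_def intro: bexI[of _ "k + 1"])
  show ?thesis unfolding line_label_def 1 2 by auto
qed

section \<open>Labels produced by a step\<close>

context
  fixes n d t :: nat and m m' s s' :: "int \<Rightarrow> int"
  assumes d: "1 \<le> d" and conf: "config n d t m s" and dec': "decreasing_upto d m'"
    and inc': "increasing_upto d s'" and s'1: "0 \<le> s' 1"
    and stp: "strip_step n d t m m' s s'"
begin

private lemma dec: "decreasing_upto d m" and inc: "increasing_upto d s"
  using conf by (auto simp: config_def)

lemma mark_le: "r \<in> {1..int d} \<Longrightarrow> m r \<le> int d"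
  using conf unfolding config_def decreasing_upto_def by (cases "r = 1") force+

lemma marked_le: "k \<in> {1..int d} \<Longrightarrow> marked d m k \<Longrightarrow> s k \<le> int n - 1 - int t"
  using conf by (auto simp: config_def)

lemma mark_cases: "r \<in> {1..int d} \<Longrightarrow> m' r = m r \<and> 1 \<le> m r \<or> m' r = m r - 1"
  using stp by (auto simp: strip_step_def)

lemma marked_iff: "1 \<le> k \<Longrightarrow> marked d m k \<longleftrightarrow> crosses d m m' k \<or> leaves d m m' k"
  unfolding marked_def crosses_def leaves_def using mark_cases by fastforce

lemma marked'_iff: "1 \<le> k \<Longrightarrow> marked d m' k \<longleftrightarrow> crosses d m m' k \<or> leaves d m m' (k + 1)"
  unfolding marked_def crosses_def leaves_def using mark_cases by fastforce

lemma crosses_not_leaves: "crosses d m m' k \<Longrightarrow> \<not> leaves d m m' k"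
  unfolding crosses_def leaves_def using decreasing_upto_inj[OF dec] by fastforce

lemma crosses_not_leaves_Suc: "crosses d m m' k \<Longrightarrow> \<not> leaves d m m' (k + 1)"
  unfolding crosses_def leaves_def using decreasing_upto_inj[OF dec'] by fastforce

lemma leaves_le: "leaves d m m' k \<Longrightarrow> k \<le> int d"
  using mark_le by (auto simp: leaves_def)

lemma strand_moves: "k \<in> {1..int d} \<Longrightarrow> s' k \<noteq> s k \<Longrightarrow> s' k = s k - 1 \<and> crosses d m m' k"
  using stp by (auto simp: strip_step_def)

lemma strip_label_gap:
  assumes g: "gap d s k x"
  shows "strip_label d m m' s s' x = (if leaves d m m' (k + 1) then 1
     else if k < int d \<and> s (k + 1) = x \<and> s' (k + 1) \<noteq> x then 2 else 0)"
proof -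
  have 1: "(\<exists>j \<in> {1..int d}. leaves d m m' j \<and> x \<le> s j \<and> (j = 1 \<or> s (j - 1) < x)) \<longleftrightarrow> leaves d m m' (k + 1)"
    (is "?L \<longleftrightarrow> _")
  proof
    assume ?L
    then obtain j where j: "j \<in> {1..int d}" "leaves d m m' j" "x \<le> s j" "j = 1 \<or> s (j - 1) < x" by blast
    then have "k < j" "j - 1 \<le> k" using g by (auto simp: gap_def not_less[symmetric])
    then have "j = k + 1" by simp
    then show "leaves d m m' (k + 1)" using j by simp
  next
    assume l: "leaves d m m' (k + 1)"
    then have "k + 1 \<in> {1..int d}" using leaves_le g by (auto simp: gap_def)
    then show ?L using l g by (intro bexI[of _ "k + 1"]) (auto simp: gap_def not_less[symmetric])
  qed
  have 2: "(\<exists>j \<in> {1..int d}. s j = x \<and> s' j \<noteq> x) \<longleftrightarrow> k < int d \<and> s (k + 1) = x \<and> s' (k + 1) \<noteq> x"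
    using gap_strand[OF g _ inc] g by (auto simp: gap_def intro: bexI[of _ "k + 1"])
  show ?thesis unfolding strip_label_def 1 2 ..
qed

text \<open>Line t + 1 is shorter by one position. A crossed strand either moves left or, by the
  last clause of \<open>strip_step\<close>, is not at the end; a mark that arrives from strand k + 1
  finds strand k at least one position further left.\<close>

lemma config_step: "config n d (Suc t) m' s'"
proof -
  have "m' 1 \<le> int d"
    using mark_cases[of 1] mark_le[of 1] d by auto
  moreover have "s' k \<le> int n - 1 - int (Suc t)" if k: "k \<in> {1..int d}" "marked d m' k" for k
  proof -
    from k have "crosses d m m' k \<or> leaves d m m' (k + 1)"
      using marked'_iff by auto
    then show ?thesis
    proof
      assume c: "crosses d m m' k"
      then have "s k \<le> int n - 1 - int t"
        using marked_iff marked_le k by auto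
      then show ?thesis using c k stp by (force simp: strip_step_def)
    next
      assume l: "leaves d m m' (k + 1)"
      then have k1: "k + 1 \<in> {1..int d}" using leaves_le k by auto
      then have "s (k + 1) \<le> int n - 1 - int t"
        using marked_iff marked_le l by auto
      moreover have "s k < s (k + 1)" using increasing_upto_less_iff[OF inc k(1) k1] by simp
      moreover have "s' k \<le> s k" using strand_moves[OF k(1)] by fastforce
      ultimately show ?thesis by simp
    qed
  qed
  ultimately show ?thesis using dec' inc' s'1 by (auto simp: config_def)
qed

text \<open>The labels involved are governed by the strand at x, if any, and by the next one, which
  may move from x + 1 to x. In each case the gaps of x on the new line and of x + 1 on the old one
  turn all labels into conditions on these strands.\<close>

lemma strip_transition:
  "(strip_label d m m' s s' x, line_label d m s x, line_label d m' s' x, strip_label d m m' s s' (x + 1))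
     \<in> transitions"
proof -
  note inc_iff = increasing_upto_less_iff[OF inc] and inc'_iff = increasing_upto_less_iff[OF inc']
  obtain k where g: "gap d s k x" using gap_exists[OF inc] .
  then have k: "0 \<le> k" "k \<le> int d" by (auto simp: gap_def)
  have at_k: "s k < x" if "1 \<le> k"
    using g k that by (auto simp: gap_def)
  have below: "s' k < x" if "1 \<le> k"
  proof -
    show ?thesis using at_k strand_moves[of k] k that by fastforce
  qed
  have above: "x \<le> s (k + 1)" if "k < int d"
    using g k that by (auto simp: gap_def not_less[symmetric])
  note A = strip_label_gap and W = line_label_gap[OF inc g, of m] and W' = line_label_gap[OF inc', of _ x m']
  show ?thesis
  proof (cases "k < int d \<and> s (k + 1) = x")
    case False
    then have gt: "x + 1 \<le> s (k + 1)" if "k < int d" using above that by force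
    have g1: "gap d s k (x + 1)"
      using at_k gt k by (intro gapI[OF inc]) auto
    have g': "gap d s' k x"
      using below k gt strand_moves[of "k + 1"] by (intro gapI[OF inc']) fastforce+
    have c: "leaves d m m' (k + 1) \<Longrightarrow> k < int d \<Longrightarrow> s' (k + 1) = s (k + 1)"
      using crosses_not_leaves[of "k + 1"] strand_moves[of "k + 1"] k by auto
    have l: "leaves d m m' (k + 1) \<Longrightarrow> k < int d" using leaves_le by force
    show ?thesis
      using False c l gt marked'_iff[of "k + 1"] strand_moves[of "k + 1"] k
      by (auto simp: A[OF g] A[OF g1] W W'[OF g'] transitions_def)
  next
    case True
    define j where "j = k + 1"
    have j: "j \<in> {1..int d}" "s j = x" using True k by (auto simp: j_def)
    have next_s: "x + 1 \<le> s (j + 1)" if "j < int d"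
      using inc_iff[of j "j + 1"] j that by auto
    have g1: "gap d s j (x + 1)"
      using j next_s by (intro gapI[OF inc]) auto
    have A1: "strip_label d m m' s s' x = (if leaves d m m' j then 1 else if s' j \<noteq> x then 2 else 0)"
      using A[OF g] True by (simp add: j_def)
    have W1: "line_label d m s x = (if marked d m j then 1 else 2)"
      using W True by (simp add: j_def)
    have move1: "s' (j + 1) = x" if "j < int d" "s (j + 1) = x + 1" "s' (j + 1) \<noteq> x + 1"
      using strand_moves[of "j + 1"] that j by auto
    have move2: "s' (j + 1) = x \<Longrightarrow> j < int d \<Longrightarrow> s (j + 1) = x + 1 \<and> crosses d m m' (j + 1)"
      using strand_moves[of "j + 1"] next_s j by fastforce
    note mk = marked_iff[of j] marked'_iff[of j] marked'_iff[of "j + 1"]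
      crosses_not_leaves[of j] crosses_not_leaves_Suc[of j] crosses_not_leaves[of "j + 1"]
      leaves_le[of "j + 1"]
    show ?thesis
    proof (cases "s' j = x")
      case True
      have g': "gap d s' k x"
        using below k True j by (intro gapI[OF inc']) (auto simp: j_def)
      have W2: "line_label d m' s' x = (if marked d m' j then 1 else 2)"
        using W'[OF g'] True j by (simp add: j_def)
      have "\<not> (j < int d \<and> s (j + 1) = x + 1 \<and> s' (j + 1) \<noteq> x + 1)"
        using move1 inc'_iff[of j "j + 1"] True j by fastforce
      then have A2: "strip_label d m m' s s' (x + 1) = (if leaves d m m' (j + 1) then 1 else 0)"
        using A[OF g1] by auto
      show ?thesis using A1 W1 W2 A2 mk j True by (auto simp: transitions_def)
    next
      case False
      then have c: "s' j = x - 1" "crosses d m m' j" using strand_moves[of j] j by auto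
      have g': "gap d s' j x"
        using j c inc'_iff[of j "j + 1"] by (intro gapI[OF inc']) auto
      show ?thesis using A1 W1 W'[OF g'] A[OF g1] mk j False c move1 move2 by (auto simp: transitions_def)
    qed
  qed
qed

lemma strip_labels_legal:
  "(strip_label d m m' s s' x, line_label d m s x) \<in> {(0, 0), (1, 1), (2, 1), (0, 2), (1, 0), (0, 1)}"
  using strip_transition[of x] by (auto simp: transitions_def)

lemma strip_label_0: "strip_label d m m' s s' 0 \<le> 1"
proof -
  have "s' k \<ge> 0" if "k \<in> {1..int d}" for k
    using s'1 increasing_upto_le_iff[OF inc', of 1 k] that by auto
  then have "\<not> (s k = 0 \<and> s' k \<noteq> 0)" if "k \<in> {1..int d}" for k
    using strand_moves[OF that] that by force
  then show ?thesis by (auto simp: strip_label_def)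
qed

text \<open>Of the legal pairs, (1, 0) and (0, 1) have to be excluded at the end of the strip. In
  the former, the mark that leaves sits on a strand of this line, which can only be at x. The latter
  would be an equivariant piece, which the last clause of \<open>strip_step\<close> forbids
  there.\<close>

lemma strip_final:
  assumes x: "x = int n - 1 - int t"
  shows "(strip_label d m m' s s' x, line_label d m s x) \<in> final_labels"
proof -
  obtain k where g: "gap d s k x" using gap_exists[OF inc] .
  then have k: "0 \<le> k" "k \<le> int d" by (auto simp: gap_def)
  have 1: False if "strip_label d m m' s s' x = 1" "line_label d m s x = 0"
  proof -
    have l: "leaves d m m' (k + 1)"
      using that(1) unfolding strip_label_gap[OF g] by (simp split: if_splits)
    then have k1: "k + 1 \<in> {1..int d}" using leaves_le k by force
    moreover have "s (k + 1) \<le> x"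
      using marked_le[OF k1] marked_iff[of "k + 1"] l k x by simp
    moreover have "\<not> s (k + 1) < x" using g k1 by (simp add: gap_def)
    ultimately show False using that(2) unfolding line_label_gap[OF inc g] by (simp split: if_splits)
  qed
  have 2: False if "strip_label d m m' s s' x = 0" "line_label d m s x = 1"
  proof -
    have k1: "k < int d" "s (k + 1) = x" "marked d m (k + 1)"
      using that(2) unfolding line_label_gap[OF inc g] by (simp_all split: if_splits)
    moreover have "\<not> leaves d m m' (k + 1)" "s' (k + 1) = x"
      using that(1) k1 unfolding strip_label_gap[OF g] by (simp_all split: if_splits)
    ultimately show False using stp marked_iff[of "k + 1"] k x by (auto simp: strip_step_def)
  qed
  show ?thesis using strip_labels_legal[of x] 1 2 by (auto simp: final_labels_def)
qed

text \<open>A step can be recovered from its labels at the old positions of the strands; the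
  uniqueness of motions rests on this.\<close>

lemma next_mark:
  assumes r: "r \<in> {1..int d}"
  shows "m' r = (if 1 \<le> m r \<and> strip_label d m m' s s' (s (m r)) \<noteq> 1 then m r else m r - 1)"
proof (cases "1 \<le> m r")
  case True
  then have k: "m r \<in> {1..int d}" using mark_le[OF r] by simp
  have "gap d s (m r - 1) (s (m r))"
    using k by (intro gapI[OF inc]) (auto simp: increasing_upto_less_iff[OF inc])
  then have "strip_label d m m' s s' (s (m r)) = 1 \<longleftrightarrow> leaves d m m' (m r)"
    using strip_label_gap[of "m r - 1"] by auto
  moreover have "leaves d m m' (m r) \<longleftrightarrow> m' r = m r - 1"
    using r decreasing_upto_inj[OF dec _ r] by (force simp: leaves_def)
  ultimately show ?thesis using mark_cases[OF r] True by auto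
next
  case False
  then show ?thesis using mark_cases[OF r] by auto
qed

lemma next_strand:
  assumes k: "k \<in> {1..int d}"
  shows "s' k = (if strip_label d m m' s s' (s k) = 2 then s k - 1 else s k)"
proof -
  have "gap d s (k - 1) (s k)"
    using k by (intro gapI[OF inc]) (auto simp: increasing_upto_less_iff[OF inc])
  then show ?thesis
    using strip_label_gap[of "k - 1" "s k"] strand_moves[OF k] crosses_not_leaves[of k] k by auto
qed

end

section \<open>The step read off from given labels\<close>

lemma transitions_determine:
  "(a, w, w1, a') \<in> transitions \<Longrightarrow> (a, w, w2, a') \<in> transitions \<Longrightarrow> w1 = w2"
  by (auto simp: transitions_def)

context
  fixes n d t :: nat and m s :: "int \<Rightarrow> int" and a w' :: "int \<Rightarrow> nat"
  assumes d: "1 \<le> d" and conf: "config n d t m s"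
    and trans: "\<And>x. 0 \<le> x \<Longrightarrow> x < int n - 1 - int t \<Longrightarrow>
      (a x, line_label d m s x, w' x, a (x + 1)) \<in> transitions"
    and final: "(a (int n - 1 - int t), line_label d m s (int n - 1 - int t)) \<in> final_labels"
    and first: "a 0 \<le> 1"
begin

private abbreviation "last_pos \<equiv> int n - 1 - int t"

definition next_m :: "int \<Rightarrow> int" where
  "next_m r = (if 1 \<le> m r \<and> a (s (m r)) \<noteq> 1 then m r else m r - 1)"

text \<open>The labels a are constrained only up to \<open>last_pos\<close>; strands beyond it have
  to stay, whatever the value of a there.\<close>

definition next_s :: "int \<Rightarrow> int" where
  "next_s k = (if s k \<le> last_pos \<and> a (s k) = 2 then s k - 1 else s k)"

private lemma dec_m: "decreasing_upto d m" and inc_s: "increasing_upto d s"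
  using conf by (auto simp: config_def)

private lemma strand_ge_0: "k \<in> {1..int d} \<Longrightarrow> 0 \<le> s k"
  using conf increasing_upto_le_iff[OF inc_s, of 1 k] by (force simp: config_def)

private lemma mark_le': "r \<in> {1..int d} \<Longrightarrow> m r \<le> int d"
  using conf unfolding config_def decreasing_upto_def by (cases "r = 1") force+

private lemma line_label_strand:
  "k \<in> {1..int d} \<Longrightarrow> line_label d m s (s k) = (if marked d m k then 1 else 2)"
proof -
  assume k: "k \<in> {1..int d}"
  then have "(\<exists>j \<in> {1..int d}. s j = s k \<and> marked d m j) \<longleftrightarrow> marked d m k"
    and "\<exists>j \<in> {1..int d}. s j = s k"
    using increasing_upto_inj[OF inc_s] by blast+
  then show ?thesis by (simp only: line_label_def if_True)
qed

private lemma label_cases: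
  assumes "0 \<le> x" "x \<le> last_pos"
  shows "(a x, line_label d m s x) \<in> {(0, 0), (1, 1), (2, 1), (0, 2), (1, 0), (0, 1)}"
  using trans[of x] final assms
  by (cases "x = last_pos") (auto simp: transitions_def final_labels_def)

private lemma line_label_0_iff: "line_label d m s x = 0 \<longleftrightarrow> (\<forall>k \<in> {1..int d}. s k \<noteq> x)"
  by (auto simp: line_label_def)

text \<open>The label 1 is transported unchanged along a stretch without strands.\<close>

private lemma label_1_forward:
  assumes "0 \<le> x" "x \<le> last_pos" "a x = 1"
  shows "\<exists>k \<in> {1..int d}. x \<le> s k \<and> s k \<le> last_pos \<and> (k = 1 \<or> s (k - 1) < x) \<and> a (s k) = 1"
  using assms
proof (induction "nat (last_pos - x)" arbitrary: x rule: less_induct)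
  case less
  show ?case
  proof (cases "line_label d m s x = 0")
    case True
    then have lt: "x < last_pos"
      using final less by (cases "x = last_pos") (auto simp: final_labels_def)
    then have "a (x + 1) = 1" using trans[of x] True less by (auto simp: transitions_def)
    then have "\<exists>k \<in> {1..int d}. x + 1 \<le> s k \<and> s k \<le> last_pos \<and>
        (k = 1 \<or> s (k - 1) < x + 1) \<and> a (s k) = 1"
      using lt less.prems by (intro less.hyps) auto
    then obtain k where k: "k \<in> {1..int d}" "x + 1 \<le> s k" "s k \<le> last_pos"
      "k = 1 \<or> s (k - 1) < x + 1" "a (s k) = 1" by blast
    moreover have "k = 1 \<or> s (k - 1) \<noteq> x"
      using True k by (auto simp: line_label_0_iff)
    ultimately show ?thesis by (intro bexI[of _ k]) auto
  next
    case False
    then obtain k where k: "k \<in> {1..int d}" "s k = x" by (auto simp: line_label_0_iff)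
    moreover have "k = 1 \<or> s (k - 1) < s k"
      using k increasing_upto_less_iff[OF inc_s, of "k - 1" k] by fastforce
    ultimately show ?thesis using less.prems by (intro bexI[of _ k]) auto
  qed
qed

private lemma label_1_backward:
  assumes k: "k \<in> {1..int d}" "s k \<le> last_pos" "a (s k) = 1"
    and x: "0 \<le> x" "x \<le> s k" "k = 1 \<or> s (k - 1) < x"
  shows "a x = 1"
  using x
proof (induction "nat (s k - x)" arbitrary: x rule: less_induct)
  case less
  show ?case
  proof (cases "x = s k")
    case True
    then show ?thesis using k by simp
  next
    case False
    then have "a (x + 1) = 1" using less by (intro less.hyps) auto
    moreover have "s i \<noteq> x" if i: "i \<in> {1..int d}" for i
    proof (cases "i < k")
      case True
      then have "s i \<le> s (k - 1)" using i k increasing_upto_le_iff[OF inc_s i, of "k - 1"] by auto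
      then show ?thesis using less.prems True i by auto
    next
      case False
      then have "s k \<le> s i" using i k increasing_upto_le_iff[OF inc_s k(1) i] by auto
      then show ?thesis using less.prems \<open>x \<noteq> s k\<close> by auto
    qed
    then have "line_label d m s x = 0" by (simp add: line_label_0_iff)
    ultimately show ?thesis using trans[of x] less.prems False k by (auto simp: transitions_def)
  qed
qed

private lemma label_strand_marked:
  assumes "k \<in> {1..int d}" "s k \<le> last_pos" "a (s k) \<noteq> 0"
  shows "marked d m k"
  using label_cases[OF strand_ge_0] line_label_strand assms by (fastforce split: if_splits)

text \<open>The mark leaving strand k + 1 travels along ones back to the position after strand k,
  and the only transition in which a marked strand receives a one also passes a one on. So a marked
  strand gives up its mark whenever it gets another.\<close>

private lemma label_1_adjacent:
  assumes k: "k \<in> {1..int d}" "k + 1 \<in> {1..int d}" "s (k + 1) \<le> last_pos"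
    "a (s (k + 1)) = 1" "marked d m k"
  shows "a (s k) = 1"
proof -
  have lt: "s k < s (k + 1)" using k increasing_upto_less_iff[OF inc_s k(1,2)] by simp
  have "a (s k + 1) = 1"
    using lt strand_ge_0[OF k(1)] by (intro label_1_backward[OF k(2-4)]) simp_all
  moreover have "(a (s k), line_label d m s (s k), w' (s k), a (s k + 1)) \<in> transitions"
    using lt strand_ge_0[OF k(1)] k(3) by (intro trans) simp_all
  ultimately show ?thesis
    using line_label_strand[OF k(1)] k(5) by (auto simp: transitions_def)
qed

lemma next_m_decreasing: "decreasing_upto d next_m"
proof -
  have "next_m j < next_m i" if ij: "i \<in> {1..int d}" "j \<in> {1..int d}" "i < j" for i j
  proof -
    have lt: "m j < m i" using ij dec_m by (auto simp: decreasing_upto_def)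
    \<comment> \<open>Marks drop by at most one, so only a mark that drops onto a resting neighbour
      could destroy strictness.\<close>
    show ?thesis
    proof (cases "m i = m j + 1 \<and> 1 \<le> m j \<and> a (s (m i)) = 1")
      case True
      have k: "m j \<in> {1..int d}" "m j + 1 \<in> {1..int d}"
        using True mark_le'[of i] mark_le'[of j] ij by auto
      have mk: "marked d m (m j)" "marked d m (m j + 1)" using True ij by (auto simp: marked_def)
      have "s (m j + 1) \<le> last_pos" using mk k conf by (auto simp: config_def)
      moreover have "a (s (m j + 1)) = 1" using True by metis
      ultimately have "a (s (m j)) = 1" using label_1_adjacent[OF k] mk(1) by blast
      then show ?thesis using True by (simp add: next_m_def)
    next
      case False
      then show ?thesis using lt by (cases "m i = m j + 1") (auto simp: next_m_def)
    qed
  qed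
  then show ?thesis by (auto simp: decreasing_upto_def)
qed

text \<open>A label 2 is handed on only by an empty position or by a strand that moves as well.
  Hence no strand moves onto another one, and none leaves position 0, where the label is at most
  1.\<close>

private lemma label_2_prev:
  assumes k: "k \<in> {1..int d}" "s k \<le> last_pos" "a (s k) = 2"
  shows "1 \<le> s k \<and> (a (s k - 1) = 2 \<or> line_label d m s (s k - 1) = 0)"
proof -
  have "s k \<noteq> 0" using first k by auto
  then show ?thesis using trans[of "s k - 1"] strand_ge_0[of k] k by (auto simp: transitions_def)
qed

lemma next_s_increasing: "increasing_upto d next_s"
proof -
  have "next_s i < next_s j" if ij: "i \<in> {1..int d}" "j \<in> {1..int d}" "i < j" for i j
  proof -
    have lt: "s i < s j" using ij inc_s by (auto simp: increasing_upto_def)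
    show ?thesis
    proof (cases "s i = s j - 1 \<and> s j \<le> last_pos \<and> a (s j) = 2")
      case True
      then have "a (s i) = 2" using label_2_prev[of j] ij by (auto simp: line_label_0_iff)
      then show ?thesis using True by (simp add: next_s_def)
    next
      case False
      then show ?thesis using lt by (auto simp: next_s_def)
    qed
  qed
  then show ?thesis by (auto simp: increasing_upto_def)
qed

lemma next_s_nonneg: "0 \<le> next_s 1"
  using label_2_prev[of 1] strand_ge_0[of 1] d by (auto simp: next_s_def)

lemma next_step: "strip_step n d t m next_m s next_s"
  unfolding strip_step_def
proof (intro conjI ballI impI)
  fix r assume "r \<in> {1..int d}"
  show "next_m r = m r \<and> 1 \<le> m r \<or> next_m r = m r - 1" by (simp add: next_m_def)
next
  fix k assume k: "k \<in> {1..int d}"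
  show "next_s k = s k \<or> next_s k = s k - 1 \<and> crosses d m next_m k"
  proof (cases "s k \<le> last_pos \<and> a (s k) = 2")
    case True
    then have "marked d m k" using label_strand_marked[OF k] by simp
    then obtain r where "r \<in> {1..int d}" "m r = k" by (auto simp: marked_def)
    then have "crosses d m next_m k" using True k by (auto simp: crosses_def next_m_def)
    then show ?thesis using True by (simp add: next_s_def)
  next
    case False
    then show ?thesis unfolding next_s_def by presburger
  qed
next
  fix k assume k: "k \<in> {1..int d}" and c: "crosses d m next_m k \<and> next_s k = s k"
  then obtain r where r: "r \<in> {1..int d}" "m r = k" "next_m r = k" by (auto simp: crosses_def)
  then have mk: "marked d m k" by (auto simp: marked_def)
  then have le: "s k \<le> last_pos" using conf k by (auto simp: config_def)
  have "a (s k) \<noteq> 1" using r by (auto simp: next_m_def split: if_splits)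
  moreover have "a (s k) \<noteq> 2" using c le by (auto simp: next_s_def split: if_splits)
  \<comment> \<open>The remaining label 0 together with a marked strand is the pair (0, 1), which is
    not in \<open>final_labels\<close>.\<close>
  ultimately have "s k \<noteq> last_pos"
    using final line_label_strand[OF k] mk by (auto simp: final_labels_def)
  then show "s k < last_pos" using le by simp
qed

private lemma leaves_next_iff:
  assumes k: "k \<in> {1..int d}"
  shows "leaves d m next_m k \<longleftrightarrow> s k \<le> last_pos \<and> a (s k) = 1"
proof
  assume "leaves d m next_m k"
  then obtain r where r: "r \<in> {1..int d}" "m r = k" "next_m r = k - 1" by (auto simp: leaves_def)
  then have "marked d m k" by (auto simp: marked_def)
  then have "s k \<le> last_pos" using conf k by (auto simp: config_def)
  then show "s k \<le> last_pos \<and> a (s k) = 1"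
    using r k by (auto simp: next_m_def split: if_splits)
next
  assume l: "s k \<le> last_pos \<and> a (s k) = 1"
  then have "marked d m k" using label_strand_marked[OF k] by simp
  then obtain r where "r \<in> {1..int d}" "m r = k" by (auto simp: marked_def)
  then show "leaves d m next_m k" using l by (auto simp: leaves_def next_m_def)
qed

lemma next_strip_label:
  assumes x: "0 \<le> x" "x \<le> last_pos"
  shows "strip_label d m next_m s next_s x = a x"
proof -
  have "(\<exists>k \<in> {1..int d}. leaves d m next_m k \<and> x \<le> s k \<and> (k = 1 \<or> s (k - 1) < x)) \<longleftrightarrow> a x = 1"
    using label_1_forward[OF x] label_1_backward[OF _ _ _ x(1)] leaves_next_iff by metis
  moreover have "(\<exists>k \<in> {1..int d}. s k = x \<and> next_s k \<noteq> x) \<longleftrightarrow> a x = 2"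
  proof
    assume "a x = 2"
    then have "line_label d m s x \<noteq> 0" using label_cases[OF x] by auto
    then obtain k where "k \<in> {1..int d}" "s k = x" by (auto simp: line_label_0_iff)
    then show "\<exists>k \<in> {1..int d}. s k = x \<and> next_s k \<noteq> x"
      using \<open>a x = 2\<close> x by (auto simp: next_s_def)
  qed (auto simp: next_s_def split: if_splits)
  ultimately show ?thesis using label_cases[OF x] by (auto simp: strip_label_def)
qed

text \<open>No second case analysis is made: the computed line and the given one fit into the same
  transitions, and three of the four labels determine the one on the next line.\<close>

lemma next_line_label:
  assumes x: "0 \<le> x" "x < last_pos"
  shows "line_label d next_m next_s x = w' x"
  using strip_transition[OF d conf next_m_decreasing next_s_increasing next_s_nonneg next_step, of x]
    trans[OF x] next_strip_label[of x] next_strip_label[of "x + 1"] x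
  by (auto intro: transitions_determine)

lemma next_exists:
  "\<exists>m' s'. config n d (Suc t) m' s' \<and> strip_step n d t m m' s s' \<and>
     (\<forall>x. 0 \<le> x \<and> x \<le> last_pos \<longrightarrow> strip_label d m m' s s' x = a x) \<and>
     (\<forall>x. 0 \<le> x \<and> x < last_pos \<longrightarrow> line_label d m' s' x = w' x)"
  using next_strip_label next_line_label next_step
    config_step[OF d conf next_m_decreasing next_s_increasing next_s_nonneg next_step]
  by blast

end

section \<open>Words and partitions\<close>

lemma word_partition_length: "length (word_partition w) = count_list w 1"
  by (induction w) auto

lemma word_partition_le: "q \<in> set (word_partition w) \<Longrightarrow> q \<le> count_list w 0"
  by (induction w) (auto split: if_splits intro: le_SucI)

lemma binary_length: "set w \<subseteq> {0, 1} \<Longrightarrow> length w = count_list w 0 + count_list w (1 :: nat)"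
  by (induction w) auto

text \<open>The \<open>j\<close>-th one has \<open>p ! j\<close> zeros and \<open>length p - j - 1\<close> ones to its right.\<close>

lemma word_ones:
  assumes "set w \<subseteq> {0, 1}" "i < length w"
  shows "w ! i = 1 \<longleftrightarrow> (\<exists>j < length (word_partition w).
     int i = int (length w) - int (length (word_partition w)) + int j - int (word_partition w ! j))"
  using assms
proof (induction w arbitrary: i)
  case (Cons b w)
  let ?p = "word_partition w"
  have len: "int (length w) = int (count_list w 0) + int (length ?p)"
    using Cons binary_length[of w] by (simp add: word_partition_length)
  have le: "?p ! j \<le> count_list w 0" if "j < length ?p" for j
    using word_partition_le that by (metis nth_mem)
  show ?case
  proof (cases i)
    case 0
    then show ?thesis using Cons.prems len le by (force intro: exI[of _ 0])
  next
    case (Suc i')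
    then have IH: "w ! i' = 1 \<longleftrightarrow> (\<exists>j < length ?p. int i' = int (length w) - int (length ?p) + int j - int (?p ! j))"
      using Cons by auto
    show ?thesis
    proof (cases "b = 1")
      case True
      then show ?thesis using Suc IH len by (auto simp: All_less_Suc2 Ex_less_Suc2)
    next
      case False
      then show ?thesis using Suc IH by (auto simp: algebra_simps)
    qed
  qed
qed simp

text \<open>The word is built from the left: a one is written exactly when the first part and the
  number of parts together fill the remaining length, otherwise a zero.\<close>

lemma word_of_partition:
  assumes "sorted_wrt (\<ge>) p" "\<forall>q \<in> set p. q + length p \<le> n"  "length p \<le> n"
  shows "\<exists>w. length w = n \<and> set w \<subseteq> {0, 1} \<and> word_partition w = p"
  using assms
proof (induction n arbitrary: p)
  case 0
  then show ?case by (intro exI[of _ "[]"]) auto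
next
  case (Suc n)
  show ?case
  proof (cases "\<exists>q ps. p = q # ps \<and> q + length p = Suc n")
    case True
    then obtain q ps where p: "p = q # ps" "q + length p = Suc n" by blast
    have "\<exists>w. length w = n \<and> set w \<subseteq> {0, 1} \<and> word_partition w = ps"
      using Suc.prems p by (intro Suc.IH) auto
    then obtain w where w: "length w = n" "set w \<subseteq> {0, 1}" "word_partition w = ps" by blast
    then have "count_list w 0 = q" using binary_length[of w] p word_partition_length[of w] by simp
    then have "length (1 # w) = Suc n \<and> set (1 # w) \<subseteq> {0, 1} \<and> word_partition (1 # w) = p"
      using w p(1) by simp
    then show ?thesis by blast
  next
    case False
    have le: "\<forall>q \<in> set p. q + length p \<le> n" and len: "length p \<le> n"
    proof -
      have "(\<forall>q \<in> set p. q + length p \<le> n) \<and> length p \<le> n"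
      proof (cases p)
        case (Cons a ps)
        have "a + length p \<le> Suc n" using Suc.prems(2) Cons by auto
        moreover have "a + length p \<noteq> Suc n" using False Cons by blast
        moreover have "q \<le> a" if "q \<in> set p" for q
          using Suc.prems(1) that Cons by auto
        ultimately show ?thesis by fastforce
      qed simp
      then show "\<forall>q \<in> set p. q + length p \<le> n" "length p \<le> n" by blast+
    qed
    have "\<exists>w. length w = n \<and> set w \<subseteq> {0, 1} \<and> word_partition w = p"
      by (rule Suc.IH[OF Suc.prems(1) le len])
    then obtain w where "length w = n" "set w \<subseteq> {0, 1}" "word_partition w = p" by blast
    then have "length (0 # w) = Suc n \<and> set (0 # w) \<subseteq> {0, 1} \<and> word_partition (0 # w) = p"
      by simp
    then show ?thesis by blast
  qed
qed

lemma partitions_nth_mono: "p \<in> partitions d n \<Longrightarrow> i \<le> j \<Longrightarrow> j < d \<Longrightarrow> p ! j \<le> p ! i"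
  by (cases "i = j") (auto simp: partitions_def sorted_wrt_iff_nth_less)

lemma partitions_nth_le: "p \<in> partitions d n \<Longrightarrow> j < d \<Longrightarrow> p ! j \<le> n - d"
  using partitions_nth_mono[of p d n 0 j] by (auto simp: partitions_def)

lemma word_partition_eqI:
  assumes p: "p \<in> partitions d n" and dn: "d \<le> n" and w: "length w = n" "set w \<subseteq> {0, 1}"
    and ones: "\<And>i. i < n \<Longrightarrow> w ! i = 1 \<longleftrightarrow> (\<exists>j < d. int i = int n - int d + int j - int (p ! j))"
  shows "word_partition w = p"
proof -
  have len: "length p = d" using p by (simp add: partitions_def)
  have "\<exists>v. length v = n \<and> set v \<subseteq> {0, 1} \<and> word_partition v = p"
  proof (rule word_of_partition)
    show "sorted_wrt (\<ge>) p" using p by (simp add: partitions_def)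
    show "\<forall>q \<in> set p. q + length p \<le> n"
      using partitions_nth_le[OF p] len dn by (fastforce simp: in_set_conv_nth)
  qed (use len dn in simp)
  then obtain v where v: "length v = n" "set v \<subseteq> {0, 1}" "word_partition v = p" by blast
  have "w ! i = v ! i" if i: "i < n" for i
  proof -
    have "w ! i = 1 \<longleftrightarrow> v ! i = 1" using word_ones[OF v(2), of i] ones[OF i] v len i by simp
    moreover have "w ! i \<in> {0, 1}" "v ! i \<in> {0, 1}" using w v i by (auto simp: subset_iff)
    ultimately show ?thesis by auto
  qed
  then have "w = v" using w v by (intro nth_equalityI) auto
  then show ?thesis using v by simp
qed

lemma increasing_upto_spread:
  assumes "increasing_upto d f" "1 \<le> i" "i \<le> j" "j \<le> int d"
  shows "f i + (j - i) \<le> f j"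
  using assms(3,4)
proof (induction "nat (j - i)" arbitrary: j)
  case (Suc x)
  then have "f i + (j - 1 - i) \<le> f (j - 1)" by (intro Suc.hyps) auto
  moreover have "f (j - 1) < f j" using Suc assms by (auto simp: increasing_upto_def)
  ultimately show ?case by simp
qed auto

text \<open>Each boundary of a puzzle will have its ones at increasing positions f k, with f given
  by strands or marks. The partition \<open>q\<close> computed from f is that of w, so p is compared
  with \<open>q\<close> part by part.\<close>

lemma word_partition_iff:
  assumes p: "p \<in> partitions d n" and d: "1 \<le> d" "d \<le> n" and w: "length w = n" "set w \<subseteq> {0, 1}"
    and f: "increasing_upto d f" "0 \<le> f 1" "f (int d) < int n"
    and ones: "\<And>i. i < n \<Longrightarrow> w ! i = 1 \<longleftrightarrow> (\<exists>k \<in> {1..int d}. f k = int i)"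
  shows "word_partition w = p \<longleftrightarrow> (\<forall>k \<in> {1..int d}. f k = int n - int d + k - 1 - int (p ! nat (k - 1)))"
proof -
  have bnd: "k - 1 \<le> f k" "f k \<le> int n - 1 - int d + k" if "k \<in> {1..int d}" for k
    using increasing_upto_spread[OF f(1), of 1 k] increasing_upto_spread[OF f(1), of k "int d"] that f by auto
  define q where "q = map (\<lambda>j. nat (int n - int d + int j - f (int j + 1))) [0..<d]"
  have q: "q ! j = nat (int n - int d + int j - f (int j + 1))" "int (q ! j) = int n - int d + int j - f (int j + 1)"
    if "j < d" for j
    using that bnd[of "int j + 1"] by (auto simp: q_def)
  have "q \<in> partitions d n"
    unfolding partitions_def
  proof (intro CollectI conjI)
    have "q ! j \<le> q ! i" if "i < j" "j < d" for i j
      using increasing_upto_spread[OF f(1), of "int i + 1" "int j + 1"] that q[of i] q[of j] by simp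
    then show "sorted_wrt (\<ge>) q" by (auto simp: sorted_wrt_iff_nth_less q_def)
    show "q ! 0 \<le> n - d" using q[of 0] f d by simp
  qed (simp add: q_def)
  moreover have "w ! i = 1 \<longleftrightarrow> (\<exists>j < d. int i = int n - int d + int j - int (q ! j))" if "i < n" for i
  proof -
    have "(\<exists>k \<in> {1..int d}. f k = int i) \<longleftrightarrow> (\<exists>j < d. int i = int n - int d + int j - int (q ! j))"
    proof
      assume "\<exists>k \<in> {1..int d}. f k = int i"
      then obtain k where "k \<in> {1..int d}" "f k = int i" by blast
      then show "\<exists>j < d. int i = int n - int d + int j - int (q ! j)"
        using q(2)[of "nat (k - 1)"] by (intro exI[of _ "nat (k - 1)"]) auto
    next
      assume "\<exists>j < d. int i = int n - int d + int j - int (q ! j)"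
      then obtain j where "j < d" "int i = int n - int d + int j - int (q ! j)" by blast
      then show "\<exists>k \<in> {1..int d}. f k = int i"
        using q(2)[of j] by (intro bexI[of _ "int j + 1"]) auto
    qed
    then show ?thesis using ones[OF that] by simp
  qed
  ultimately have wq: "word_partition w = q" using word_partition_eqI d w by blast
  have "q = p \<longleftrightarrow> (\<forall>j < d. q ! j = p ! j)"
    using p by (auto simp: list_eq_iff_nth_eq q_def partitions_def)
  also have "\<dots> \<longleftrightarrow> (\<forall>j < d. f (int j + 1) = int n - int d + int j - int (p ! j))"
    using q(2) by (smt (verit) of_nat_eq_iff)
  also have "\<dots> \<longleftrightarrow> (\<forall>k \<in> {1..int d}. f k = int n - int d + k - 1 - int (p ! nat (k - 1)))"
  proof (intro iffI ballI allI impI)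
    fix k assume h: "\<forall>j < d. f (int j + 1) = int n - int d + int j - int (p ! j)" and "k \<in> {1..int d}"
    then show "f k = int n - int d + k - 1 - int (p ! nat (k - 1))"
      using h[rule_format, of "nat (k - 1)"] by auto
  next
    fix j assume h: "\<forall>k \<in> {1..int d}. f k = int n - int d + k - 1 - int (p ! nat (k - 1))" and "j < d"
    then show "f (int j + 1) = int n - int d + int j - int (p ! j)"
      using h[rule_format, of "int j + 1"] by auto
  qed
  finally show ?thesis using wq by simp
qed

section \<open>Puzzles as motions\<close>

definition motion :: "nat \<Rightarrow> nat \<Rightarrow> (nat \<Rightarrow> int \<Rightarrow> int) \<Rightarrow> (nat \<Rightarrow> int \<Rightarrow> int) \<Rightarrow> bool" where
  "motion n d M S \<longleftrightarrow>
     (\<forall>r \<in> {1..int d}. M 0 r = int d + 1 - r) \<and>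
     (\<forall>t \<le> n. config n d t (M t) (S t)) \<and>
     (\<forall>t < n. strip_step n d t (M t) (M (Suc t)) (S t) (S (Suc t)))"

text \<open>The six pairs in \<open>legal_labels\<close> belong to six different kinds, so the
  \<open>Slash\<close> and \<open>Backslash\<close> labels of an upward cell determine its piece; at
  other pairs the value is arbitrary.\<close>

fun kind_of_labels :: "nat \<Rightarrow> nat \<Rightarrow> kind" where
  "kind_of_labels a w = (if w = 2 then HorizSlash else if a = 2 then HorizBack
     else if a = 1 then (if w = 1 then Up1 else SlashBack) else (if w = 1 then Equivariant else Up0))"


fun motion_kind :: "nat \<Rightarrow> nat \<Rightarrow> (nat \<Rightarrow> int \<Rightarrow> int) \<Rightarrow> (nat \<Rightarrow> int \<Rightarrow> int) \<Rightarrow> point \<Rightarrow> kind" where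
  "motion_kind n d M S (x, y) =
     (let t = nat (int n - 1 - x - y) in
        kind_of_labels (strip_label d (M t) (M (Suc t)) (S t) (S (Suc t)) x) (line_label d (M t) (S t) x))"

declare kind_of_labels.simps [simp del] motion_kind.simps [simp del]

definition legal_labels :: "(nat \<times> nat) set" where
  "legal_labels = {(0, 0), (1, 1), (2, 1), (0, 2), (1, 0), (0, 1)}"

lemma kind_of_labels:
  assumes "(a, w) \<in> legal_labels"
  shows "slash_label (kind_of_labels a w) = a" "back_label (kind_of_labels a w) = w"
    "kind_of_labels a w \<in> up_kinds"
  using assms by (auto simp: legal_labels_def kind_of_labels.simps up_kinds_def)

lemma up_kind_labels:
  assumes "k \<in> up_kinds"
  shows "(slash_label k, back_label k) \<in> legal_labels" "kind_of_labels (slash_label k) (back_label k) = k"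
  using assms by (auto simp: legal_labels_def kind_of_labels.simps up_kinds_def)

lemma transitions_iff:
  assumes "u \<in> up_kinds"
  shows "(slash_label u, back_label u, w, a) \<in> transitions \<longleftrightarrow>
    (\<exists>k \<in> down_kinds. horiz_label k = horiz_label u \<and> back_label k = w \<and> slash_label k = a)"
  using assms unfolding up_kinds_def
  by (elim insertE emptyE; simp add: down_kinds_def transitions_def; presburger)

lemma final_labels_iff:
  assumes "u \<in> up_kinds"
  shows "(slash_label u, back_label u) \<in> final_labels \<longleftrightarrow> horiz_label u \<le> 1"
  using assms by (auto simp: up_kinds_def final_labels_def)

section \<open>Labels and boundary words of a motion\<close>

context
  fixes n d :: nat and M S :: "nat \<Rightarrow> int \<Rightarrow> int"
  assumes d: "1 \<le> d" and mot: "motion n d M S"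
begin

lemma motion_config: "t \<le> n \<Longrightarrow> config n d t (M t) (S t)"
  using mot by (simp add: motion_def)

lemma motion_step: "t < n \<Longrightarrow> strip_step n d t (M t) (M (Suc t)) (S t) (S (Suc t))"
  using mot by (simp add: motion_def)

lemma motion_0: "r \<in> {1..int d} \<Longrightarrow> M 0 r = int d + 1 - r"
  using mot by (simp add: motion_def)

lemma motion_increasing: "t \<le> n \<Longrightarrow> increasing_upto d (S t)"
  and motion_decreasing: "t \<le> n \<Longrightarrow> decreasing_upto d (M t)"
  and motion_nonneg: "t \<le> n \<Longrightarrow> 0 \<le> S t 1"
  using motion_config[of t] by (simp_all add: config_def)

abbreviation "slab t \<equiv> strip_label d (M t) (M (Suc t)) (S t) (S (Suc t))"
abbreviation "llab t \<equiv> line_label d (M t) (S t)"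

context
  fixes t :: nat
  assumes t: "t < n"
begin

lemmas motion_facts = d motion_config[OF less_imp_le[OF t]] motion_decreasing[OF Suc_leI[OF t]]
  motion_increasing[OF Suc_leI[OF t]] motion_nonneg[OF Suc_leI[OF t]] motion_step[OF t]

lemmas motion_transition = strip_transition[OF motion_facts]
lemmas motion_final = strip_final[OF motion_facts]
lemmas motion_first = strip_label_0[OF motion_facts]
lemmas motion_next_mark = next_mark[OF motion_facts]
lemmas motion_next_strand = next_strand[OF motion_facts]
lemmas motion_label_gap = strip_label_gap[OF motion_facts]
lemmas motion_mark_cases = mark_cases[OF motion_facts]
lemmas motion_strand_moves = strand_moves[OF motion_facts]
lemmas motion_marked_iff = marked_iff[OF motion_facts]
lemmas motion_marked_le = marked_le[OF motion_facts]

lemma motion_legal: "(slab t x, llab t x) \<in> legal_labels"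
  using strip_labels_legal[OF motion_facts] by (simp add: legal_labels_def)

end

lemma motion_kind_labels:
  assumes "t < n" "x + y = int n - 1 - int t"
  shows "slash_label (motion_kind n d M S (x, y)) = slab t x"
    and "back_label (motion_kind n d M S (x, y)) = llab t x"
    and "motion_kind n d M S (x, y) \<in> up_kinds"
proof -
  have "nat (int n - 1 - x - y) = t" using assms by auto
  then show "slash_label (motion_kind n d M S (x, y)) = slab t x"
    "back_label (motion_kind n d M S (x, y)) = llab t x" "motion_kind n d M S (x, y) \<in> up_kinds"
    using kind_of_labels[OF motion_legal[OF assms(1)]] by (simp_all add: motion_kind.simps Let_def)
qed

lemma strip_of_point:
  assumes "(x, y) \<in> up_region n"
  obtains t where "t < n" "x + y = int n - 1 - int t"
  using that[of "nat (int n - 1 - x - y)"] assms by (auto simp: up_region_def)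

lemma marked_0: "k \<in> {1..int d} \<Longrightarrow> marked d (M 0) k"
  unfolding marked_def using motion_0 by (intro bexI[of _ "int d + 1 - k"]) auto

lemma line_label_0: "llab 0 x = (if \<exists>k \<in> {1..int d}. S 0 k = x then 1 else 0)"
  using marked_0 by (auto simp: line_label_def)

lemma motion_local_rules: "local_rules n (motion_kind n d M S)"
  unfolding local_rules_def
proof (intro conjI ballI allI impI)
  fix z assume "z \<in> up_region n"
  then show "motion_kind n d M S z \<in> up_kinds"
    using motion_kind_labels(3) strip_of_point by (metis surj_pair)
next
  fix i assume "i \<in> {0..<int n}"
  then obtain t where t: "t < n" "i = int n - 1 - int t"
    using that[of "nat (int n - 1 - i)"] by auto
  note lab = motion_kind_labels[OF t(1), of 0 i] motion_kind_labels[OF t(1), of i 0]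
  show "slash_label (motion_kind n d M S (0, i)) \<le> 1"
    using lab t motion_first[of t] by simp
  have "(slab t i, llab t i) \<in> final_labels"
    using motion_final[OF t(1)] t by simp
  then show "horiz_label (motion_kind n d M S (i, 0)) \<le> 1"
    using lab t final_labels_iff[of "motion_kind n d M S (i, 0)"] by simp
  have n: "0 < n" using t by simp
  have "llab 0 i \<le> 1" by (simp add: line_label_0)
  then show "back_label (motion_kind n d M S (i, int n - 1 - i)) \<le> 1"
    using motion_kind_labels(2)[OF n, of i "int n - 1 - i"] by simp
next
  fix x y assume xy: "(x, y) \<in> down_region n"
  then obtain t where t: "Suc t < n" "x + y = int n - 2 - int t"
    using that[of "nat (int n - 2 - x - y)"] by (auto simp: down_region_def)
  have "(slab t x, llab t x, llab (Suc t) x, slab t (x + 1)) \<in> transitions"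
    using motion_transition[of t x] t by simp
  then show "\<exists>k \<in> down_kinds. horiz_label k = horiz_label (motion_kind n d M S (x, y + 1)) \<and>
      back_label k = back_label (motion_kind n d M S (x, y)) \<and>
      slash_label k = slash_label (motion_kind n d M S (x + 1, y))"
    using motion_kind_labels[of t x "y + 1"] motion_kind_labels[of "Suc t" x y]
      motion_kind_labels[of t "x + 1" y] t transitions_iff[of "motion_kind n d M S (x, y + 1)"] by simp
qed

text \<open>A strand that moves is marked and hence lies on the line, so labels beyond the end of a
  strip, where the puzzle has no cells, never influence it.\<close>

lemma next_strand_bounded:
  assumes t: "t < n" and k: "k \<in> {1..int d}"
  shows "S (Suc t) k = (if S t k \<le> int n - 1 - int t \<and> slab t (S t k) = 2 then S t k - 1 else S t k)"
proof (cases "S (Suc t) k = S t k")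
  case True
  then show ?thesis using motion_next_strand[OF t k] by auto
next
  case False
  then have "crosses d (M t) (M (Suc t)) k"
    using motion_strand_moves[OF t k] by blast
  then have "S t k \<le> int n - 1 - int t"
    using motion_marked_iff[OF t, of k] motion_marked_le[OF t k] k by auto
  then show ?thesis using motion_next_strand[OF t k] by auto
qed

lemma strand_ge: "t \<le> n \<Longrightarrow> k \<in> {1..int d} \<Longrightarrow> k - 1 \<le> S t k"
  using increasing_upto_spread[OF motion_increasing, of t 1 k] motion_nonneg[of t] by auto

lemma strand_0_less: "S 0 (int d) < int n"
  using motion_config[of 0] marked_0[of "int d"] d by (force simp: config_def)

lemma mark_decrease:
  assumes "t \<le> t'" "t' \<le> n" "r \<in> {1..int d}"
  shows "M t r - int (t' - t) \<le> M t' r \<and> M t' r \<le> M t r \<and> (M t r \<le> 0 \<longrightarrow> M t' r = M t r - int (t' - t))"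
  using assms(1,2)
proof (induction t' rule: dec_induct)
  case (step t')
  then show ?case using motion_mark_cases[of t' r] assms(3) by auto
qed simp

lemma strand_decrease:
  assumes "t \<le> t'" "t' \<le> n" "k \<in> {1..int d}"
  shows "S t' k \<le> S t k"
  using assms(1,2)
proof (induction t' rule: dec_induct)
  case (step t')
  then show ?case using motion_strand_moves[of t' k] assms(3) by fastforce
qed simp

text \<open>Line n has no positions at all, so a mark still on a strand would put that strand at a
  negative position.\<close>

lemma mark_n_le: "r \<in> {1..int d} \<Longrightarrow> M n r \<le> 0"
proof (rule ccontr)
  assume r: "r \<in> {1..int d}" and pos: "\<not> M n r \<le> 0"
  have "M n r \<le> M 0 r" using mark_decrease[of 0 n r] r by simp
  then have k: "M n r \<in> {1..int d}" using pos motion_0[OF r] r by simp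
  then have "S n (M n r) \<le> int n - 1 - int n"
    using motion_config[OF order_refl] k r unfolding config_def marked_def by blast
  then show False using strand_ge[of n "M n r"] k by simp
qed

text \<open>A mark that vanishes in this strip is 0 on line t + 1 and then drops once per strip, so
  its last value remembers where it vanished. The strip starts at height n - 1 - t of the NW side,
  so the ones there are at the heights \<open>- M n r\<close>.\<close>

lemma leaves_1_iff:
  assumes t: "t < n"
  shows "leaves d (M t) (M (Suc t)) 1 \<longleftrightarrow> (\<exists>r \<in> {1..int d}. M n r = int t + 1 - int n)"
proof
  assume "leaves d (M t) (M (Suc t)) 1"
  then obtain r where "r \<in> {1..int d}" "M (Suc t) r = 0" by (auto simp: leaves_def)
  then show "\<exists>r \<in> {1..int d}. M n r = int t + 1 - int n"
    using mark_decrease[of "Suc t" n r] t by (intro bexI[of _ r]) auto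
next
  assume "\<exists>r \<in> {1..int d}. M n r = int t + 1 - int n"
  then obtain r where r: "r \<in> {1..int d}" "M n r = int t + 1 - int n" by blast
  have "M t r = 1 \<and> M (Suc t) r = 0"
    using mark_decrease[of "Suc t" n r] mark_decrease[of t n r] motion_mark_cases[OF t r(1)] r t by auto
  then show "leaves d (M t) (M (Suc t)) 1" using r by (auto simp: leaves_def)
qed

lemma slab_0_iff:
  assumes "t < n"
  shows "slab t 0 = 1 \<longleftrightarrow> (\<exists>r \<in> {1..int d}. - M n r = int n - 1 - int t)"
proof -
  have "0 \<le> S t k" if "k \<in> {1..int d}" for k
    using strand_ge[of t k] that assms by auto
  then have "gap d (S t) 0 0" by (force simp: gap_def)
  then have "slab t 0 = 1 \<longleftrightarrow> leaves d (M t) (M (Suc t)) 1"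
    using motion_label_gap[OF assms] by simp
  also have "\<dots> \<longleftrightarrow> (\<exists>r \<in> {1..int d}. - M n r = int n - 1 - int t)"
    unfolding leaves_1_iff[OF assms] by (intro bex_cong refl) auto
  finally show ?thesis .
qed

lemma strand_frozen:
  assumes "t \<le> t'" "t' \<le> n" "k \<in> {1..int d}" "int n - 1 - int t < S t k"
  shows "S t' k = S t k"
  using assms(1,2)
proof (induction t' rule: dec_induct)
  case (step t')
  then have "S (Suc t') k = S t' k" using next_strand_bounded[of t' k] assms(3,4) by auto
  then show ?case using step by simp
qed simp

text \<open>A strand that stays at the end of a line lies beyond the ends of all later lines and is
  frozen. Conversely, a strand with last position x cannot be further right on line t, since it
  would be frozen there already.\<close>

lemma horiz_label_1_iff:
  assumes t: "t < n" and x: "x = int n - 1 - int t"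
  shows "horiz_label (motion_kind n d M S (x, 0)) = 1 \<longleftrightarrow> (\<exists>k \<in> {1..int d}. S n k = x)"
proof -
  let ?u = "motion_kind n d M S (x, 0)"
  have u: "?u \<in> up_kinds" "slash_label ?u = slab t x" "back_label ?u = llab t x"
    using motion_kind_labels[OF t, of x 0] x by simp_all
  have fin: "(slab t x, llab t x) \<in> final_labels" using motion_final[OF t x] .
  have "horiz_label ?u = 1 \<longleftrightarrow> slab t x \<noteq> 2 \<and> llab t x \<noteq> 0"
    using u fin by (auto simp: up_kinds_def final_labels_def)
  also have "\<dots> \<longleftrightarrow> (\<exists>k \<in> {1..int d}. S t k = x \<and> S (Suc t) k = x)"
    unfolding line_label_def using motion_next_strand[OF t] by force
  also have "\<dots> \<longleftrightarrow> (\<exists>k \<in> {1..int d}. S n k = x)"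
  proof (intro bex_cong refl iffI)
    fix k assume k: "k \<in> {1..int d}" and "S t k = x \<and> S (Suc t) k = x"
    then show "S n k = x" using strand_frozen[of "Suc t" n k] t x by simp
  next
    fix k assume k: "k \<in> {1..int d}" and Sn: "S n k = x"
    have le: "x \<le> S (Suc t) k" "S (Suc t) k \<le> S t k"
      using strand_decrease[of "Suc t" n k] strand_decrease[of t "Suc t" k] t k Sn by auto
    have "S t k = x" using strand_frozen[of t n k] t k Sn x le by fastforce
    then show "S t k = x \<and> S (Suc t) k = x" using le by simp
  qed
  finally show ?thesis .
qed

text \<open>With the position functions \<open>S 0\<close>, \<open>- M n\<close> and
  \<open>S n\<close>, the three boundary words become instances of
  \<open>word_partition_iff\<close>.\<close>

lemma motion_words:
  assumes dn: "d \<le> n" and p: "p \<in> partitions d n"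
    and U: "\<And>z. z \<in> up_region n \<Longrightarrow> U z = motion_kind n d M S z"
  shows "word_partition (map (\<lambda>i. back_label (U (int i, int n - 1 - int i))) [0..<n]) = p \<longleftrightarrow>
      (\<forall>k \<in> {1..int d}. S 0 k = int n - int d + k - 1 - int (p ! nat (k - 1)))"
    and "word_partition (map (\<lambda>i. slash_label (U (0, int i))) [0..<n]) = p \<longleftrightarrow>
      (\<forall>k \<in> {1..int d}. - M n k = int n - int d + k - 1 - int (p ! nat (k - 1)))"
    and "word_partition (map (\<lambda>i. horiz_label (U (int i, 0))) [0..<n]) = p \<longleftrightarrow>
      (\<forall>k \<in> {1..int d}. S n k = int n - int d + k - 1 - int (p ! nat (k - 1)))"
proof -
  let ?NE = "map (\<lambda>i. back_label (U (int i, int n - 1 - int i))) [0..<n]"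
  let ?NW = "map (\<lambda>i. slash_label (U (0, int i))) [0..<n]"
  let ?S = "map (\<lambda>i. horiz_label (U (int i, 0))) [0..<n]"
  have z: "U (0, int i) = motion_kind n d M S (0, int i)" "U (int i, 0) = motion_kind n d M S (int i, 0)"
    "U (int i, int n - 1 - int i) = motion_kind n d M S (int i, int n - 1 - int i)" if "i < n" for i
    using that by (auto simp: up_region_def intro!: U)
  have st: "n - 1 - i < n" "int n - 1 - int (n - 1 - i) = int i" if "i < n" for i
    using that by auto
  have le1: "slash_label (U (0, int i)) \<in> {0, 1}" "horiz_label (U (int i, 0)) \<in> {0, 1}"
    "back_label (U (int i, int n - 1 - int i)) \<in> {0, 1}" if "i < n" for i
    using motion_local_rules that z[OF that] by (auto simp: local_rules_def le_Suc_eq)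
  have bin: "set (?NE) \<subseteq> {0, 1}"
    "set (?NW) \<subseteq> {0, 1}"
    "set (?S) \<subseteq> {0, 1}"
    unfolding set_map image_subset_iff by (intro ballI le1; simp)+
  show "word_partition (?NE) = p \<longleftrightarrow>
      (\<forall>k \<in> {1..int d}. S 0 k = int n - int d + k - 1 - int (p ! nat (k - 1)))"
  proof (rule word_partition_iff[OF p d dn _ bin(1)])
    fix i assume i: "i < n"
    then have "back_label (U (int i, int n - 1 - int i)) = llab 0 (int i)"
      using motion_kind_labels(2)[of 0 "int i" "int n - 1 - int i"] z by simp
    then show "?NE ! i = 1 \<longleftrightarrow>
        (\<exists>k \<in> {1..int d}. S 0 k = int i)"
      using i line_label_0[of "int i"] by simp
  qed (use motion_increasing motion_nonneg strand_0_less in auto)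
  show "word_partition (?NW) = p \<longleftrightarrow>
      (\<forall>k \<in> {1..int d}. - M n k = int n - int d + k - 1 - int (p ! nat (k - 1)))"
  proof (rule word_partition_iff[OF p d dn _ bin(2)])
    show "increasing_upto d (\<lambda>k. - M n k)"
      using motion_decreasing[of n] by (simp add: increasing_upto_def decreasing_upto_def)
    show "0 \<le> - M n 1" using mark_n_le[of 1] d by simp
    show "- M n (int d) < int n" using mark_decrease[of 0 n "int d"] motion_0[of "int d"] d by simp
    fix i assume i: "i < n"
    then have "slash_label (U (0, int i)) = slab (n - 1 - i) 0"
      using motion_kind_labels(1)[of "n - 1 - i" 0 "int i"] z st[OF i] by simp
    then show "?NW ! i = 1 \<longleftrightarrow>
        (\<exists>k \<in> {1..int d}. - M n k = int i)"
      using i slab_0_iff[OF st(1)[OF i]] st(2)[OF i] by simp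
  qed auto
  show "word_partition (?S) = p \<longleftrightarrow>
      (\<forall>k \<in> {1..int d}. S n k = int n - int d + k - 1 - int (p ! nat (k - 1)))"
  proof (rule word_partition_iff[OF p d dn _ bin(3)])
    show "S n (int d) < int n" using strand_decrease[of 0 n "int d"] strand_0_less d by simp
    fix i assume i: "i < n"
    then show "?S ! i = 1 \<longleftrightarrow>
        (\<exists>k \<in> {1..int d}. S n k = int i)"
      using horiz_label_1_iff[OF st(1)[OF i], of "int i"] st(2)[OF i] z by simp
  qed (use motion_increasing motion_nonneg in auto)
qed

lemma motion_equivariant_iff:
  assumes t: "t < n" and x: "0 \<le> x" "x \<le> int n - 1 - int t"
  shows "motion_kind n d M S (x, int n - 1 - int t - x) = Equivariant \<longleftrightarrow>
    (\<exists>k \<in> {1..int d}. crosses d (M t) (M (Suc t)) k \<and> S t k = x \<and> S (Suc t) k = x)"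
proof -
  let ?u = "motion_kind n d M S (x, int n - 1 - int t - x)"
  have u: "?u \<in> up_kinds" "slash_label ?u = slab t x" "back_label ?u = llab t x"
    using motion_kind_labels[OF t, of x "int n - 1 - int t - x"] x by simp_all
  then have "?u = Equivariant \<longleftrightarrow> slab t x = 0 \<and> llab t x = 1"
    by (auto simp: up_kinds_def)
  also have "\<dots> \<longleftrightarrow> (\<exists>k \<in> {1..int d}. S t k = x \<and> marked d (M t) k \<and> slab t x = 0)"
    by (auto simp: line_label_def)
  also have "\<dots> \<longleftrightarrow> (\<exists>k \<in> {1..int d}. crosses d (M t) (M (Suc t)) k \<and> S t k = x \<and> S (Suc t) k = x)"
  proof (intro bex_cong refl)
    fix k assume k: "k \<in> {1..int d}"
    have "gap d (S t) (k - 1) (S t k)"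
      using k motion_increasing[of t] t
      by (intro gapI) (auto simp: increasing_upto_less_iff)
    then have "slab t (S t k) = 0 \<longleftrightarrow> \<not> leaves d (M t) (M (Suc t)) k \<and> S (Suc t) k = S t k"
      using motion_label_gap[OF t, of "k - 1" "S t k"] k by auto
    then show "S t k = x \<and> marked d (M t) k \<and> slab t x = 0 \<longleftrightarrow>
        crosses d (M t) (M (Suc t)) k \<and> S t k = x \<and> S (Suc t) k = x"
      using motion_marked_iff[OF t, of k] crosses_not_leaves[OF motion_facts[OF t], of k] k by auto
  qed
  finally show ?thesis .
qed

end

section \<open>The motion of a puzzle\<close>

lemma motion_unique:
  assumes d: "1 \<le> d" and mot: "motion n d M S" and mot': "motion n d M' S'"
    and S0: "\<And>k. k \<in> {1..int d} \<Longrightarrow> S 0 k = S' 0 k"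
    and eq: "\<And>z. z \<in> up_region n \<Longrightarrow> motion_kind n d M S z = motion_kind n d M' S' z"
    and t: "t \<le> n" and r: "r \<in> {1..int d}"
  shows "M t r = M' t r \<and> S t r = S' t r"
  using t r
proof (induction t arbitrary: r)
  case 0
  then show ?case using S0 motion_0[OF d mot] motion_0[OF d mot'] by simp
next
  case (Suc t)
  then have t: "t < n" by simp
  have IH: "M t r = M' t r" "S t r = S' t r" if "r \<in> {1..int d}" for r
    using Suc that by auto
  define a where "a x = strip_label d (M t) (M (Suc t)) (S t) (S (Suc t)) x" for x
  \<comment> \<open>Kinds fix the labels of a strip only at positions inside the triangle; what
    follows makes sure that labels are consulted only there.\<close>
  have a': "strip_label d (M' t) (M' (Suc t)) (S' t) (S' (Suc t)) x = a x"
    if "0 \<le> x" "x \<le> int n - 1 - int t" for x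
    using motion_kind_labels(1)[OF d mot t, of x "int n - 1 - int t - x"]
      motion_kind_labels(1)[OF d mot' t, of x "int n - 1 - int t - x"]
      eq[of "(x, int n - 1 - int t - x)"] that by (simp add: a_def up_region_def)
  have S: "S (Suc t) k = S' (Suc t) k" if k: "k \<in> {1..int d}" for k
  proof (cases "S t k \<le> int n - 1 - int t")
    case True
    have "0 \<le> S t k" using strand_ge[OF d mot, of t k] t k by simp
    then show ?thesis
      using next_strand_bounded[OF d mot t k] next_strand_bounded[OF d mot' t k] a'[of "S t k"] IH[OF k] True
      by (simp add: a_def)
  next
    case False
    then show ?thesis
      using next_strand_bounded[OF d mot t k] next_strand_bounded[OF d mot' t k] IH[OF k] by simp
  qed
  have M: "M (Suc t) r = M' (Suc t) r" if r: "r \<in> {1..int d}" for r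
  proof (cases "1 \<le> M t r")
    case True
    have "M t r \<le> int d" using mark_le[OF motion_facts[OF d mot t] r] .
    then have k: "M t r \<in> {1..int d}" using True by simp
    have "S t (M t r) \<le> int n - 1 - int t"
      using motion_marked_le[OF d mot t k] r unfolding marked_def by blast
    moreover have "0 \<le> S t (M t r)" using strand_ge[OF d mot, of t "M t r"] t k by simp
    ultimately have "strip_label d (M' t) (M' (Suc t)) (S' t) (S' (Suc t)) (S' t (M' t r)) = a (S t (M t r))"
      using a' IH[OF r] IH[OF k] by simp
    then show ?thesis
      using motion_next_mark[OF d mot t r] motion_next_mark[OF d mot' t r] IH[OF r] by (simp add: a_def)
  next
    case False
    then show ?thesis
      using motion_next_mark[OF d mot t r] motion_next_mark[OF d mot' t r] IH[OF r] by simp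
  qed
  show ?case using S M Suc by simp
qed

text \<open>Lines are built one after another by \<open>next_exists\<close>, which relies on the
  labels of the current line. The invariant \<open>P\<close> therefore asserts that marks and
  strands reproduce the labels \<open>w t\<close> of U, and it also pins down the start.\<close>

lemma local_rules_motion:
  assumes d: "1 \<le> d" and U: "local_rules n U"
    and S0: "increasing_upto d S0" "0 \<le> S0 1" "S0 (int d) < int n"
    and ones: "\<And>i. i < n \<Longrightarrow> back_label (U (int i, int n - 1 - int i)) = (if \<exists>k \<in> {1..int d}. S0 k = int i then 1 else 0)"
  obtains M S where "motion n d M S" "S 0 = S0" "\<And>z. z \<in> up_region n \<Longrightarrow> motion_kind n d M S z = U z"
proof -
  define a where "a t x = slash_label (U (x, int n - 1 - int t - x))" for t x
  define w where "w t x = back_label (U (x, int n - 1 - int t - x))" for t x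
  have kinds: "U z \<in> up_kinds" if "z \<in> up_region n" for z
    using U that by (simp add: local_rules_def)
  have trans: "(a t x, w t x, w (Suc t) x, a t (x + 1)) \<in> transitions"
    if "0 \<le> x" "x < int n - 1 - int t" for t x
  proof -
    have "(x, int n - 2 - int t - x) \<in> down_region n" using that by (simp add: down_region_def)
    then have "\<exists>k \<in> down_kinds. horiz_label k = horiz_label (U (x, int n - 2 - int t - x + 1)) \<and>
        back_label k = back_label (U (x, int n - 2 - int t - x)) \<and>
        slash_label k = slash_label (U (x + 1, int n - 2 - int t - x))"
      using U unfolding local_rules_def by blast
    moreover have "(x, int n - 1 - int t - x) \<in> up_region n" using that by (simp add: up_region_def)
    moreover have "int n - 2 - int t - x + 1 = int n - 1 - int t - x" by simp
    moreover have "w (Suc t) x = back_label (U (x, int n - 2 - int t - x))"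
      "a t (x + 1) = slash_label (U (x + 1, int n - 2 - int t - x))"
      by (simp_all add: w_def a_def algebra_simps)
    ultimately show ?thesis using transitions_iff[OF kinds] by (simp add: a_def w_def)
  qed
  have final: "(a t (int n - 1 - int t), w t (int n - 1 - int t)) \<in> final_labels" if "t < n" for t
  proof -
    have "(int n - 1 - int t, 0) \<in> up_region n" using that by (simp add: up_region_def)
    moreover have "horiz_label (U (int n - 1 - int t, 0)) \<le> 1"
      using U that by (auto simp: local_rules_def)
    ultimately show ?thesis using final_labels_iff[OF kinds] by (simp add: a_def w_def)
  qed
  have first: "a t 0 \<le> 1" if "t < n" for t
    using U that by (auto simp: local_rules_def a_def)
  define P where "P t st \<longleftrightarrow> (t = 0 \<longrightarrow> st = (\<lambda>r. int d + 1 - r, S0)) \<and> (t \<le> n \<longrightarrow> config n d t (fst st) (snd st) \<and>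
      (\<forall>x. 0 \<le> x \<and> x \<le> int n - 1 - int t \<longrightarrow> line_label d (fst st) (snd st) x = w t x))" for t and st :: "(int \<Rightarrow> int) \<times> (int \<Rightarrow> int)"
  define Q where "Q t st st' \<longleftrightarrow> (t < n \<longrightarrow> strip_step n d t (fst st) (fst st') (snd st) (snd st') \<and>
      (\<forall>x. 0 \<le> x \<and> x \<le> int n - 1 - int t \<longrightarrow>
         strip_label d (fst st) (fst st') (snd st) (snd st') x = a t x))"
    for t and st st' :: "(int \<Rightarrow> int) \<times> (int \<Rightarrow> int)"
  have "\<exists>f. \<forall>t. P t (f t) \<and> Q t (f t) (f (Suc t))"
  proof (rule dependent_nat_choice)
    let ?M0 = "\<lambda>r. int d + 1 - r"
    have mk: "marked d ?M0 k" if "k \<in> {1..int d}" for k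
      unfolding marked_def using that by (intro bexI[of _ "int d + 1 - k"]) auto
    have "S0 k < int n" if "k \<in> {1..int d}" for k
      using increasing_upto_le_iff[OF S0(1) that, of "int d"] that d S0(3) by auto
    then have "config n d 0 ?M0 S0"
      using S0 d by (auto simp: config_def decreasing_upto_def)
    moreover have "line_label d ?M0 S0 x = w 0 x" if "0 \<le> x" "x \<le> int n - 1 - int 0" for x
    proof -
      have "line_label d ?M0 S0 x = (if \<exists>k \<in> {1..int d}. S0 k = x then 1 else 0)"
        using mk by (auto simp: line_label_def)
      also have "\<dots> = w 0 x" using ones[of "nat x"] that by (simp add: w_def)
      finally show ?thesis .
    qed
    ultimately show "\<exists>st. P 0 st" by (intro exI[of _ "(?M0, S0)"]) (simp add: P_def)
  next
    fix st t assume P: "P t st"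
    show "\<exists>st'. P (Suc t) st' \<and> Q t st st'"
    proof (cases "t < n")
      case True
      obtain m s where st: "st = (m, s)" by (cases st)
      have conf: "config n d t m s" and lab: "\<And>x. 0 \<le> x \<Longrightarrow> x \<le> int n - 1 - int t \<Longrightarrow> line_label d m s x = w t x"
        using P True by (auto simp: P_def st)
      have "\<exists>m' s'. config n d (Suc t) m' s' \<and> strip_step n d t m m' s s' \<and>
         (\<forall>x. 0 \<le> x \<and> x \<le> int n - 1 - int t \<longrightarrow> strip_label d m m' s s' x = a t x) \<and>
         (\<forall>x. 0 \<le> x \<and> x < int n - 1 - int t \<longrightarrow> line_label d m' s' x = w (Suc t) x)"
        using trans[of _ t] final[OF True] first[OF True] lab True
        by (intro next_exists[OF d conf]) auto
      then obtain m' s' where "config n d (Suc t) m' s'" "strip_step n d t m m' s s'"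
        "\<forall>x. 0 \<le> x \<and> x \<le> int n - 1 - int t \<longrightarrow> strip_label d m m' s s' x = a t x"
        "\<forall>x. 0 \<le> x \<and> x < int n - 1 - int t \<longrightarrow> line_label d m' s' x = w (Suc t) x"
        by blast
      then show ?thesis by (intro exI[of _ "(m', s')"]) (auto simp: P_def Q_def st)
    qed (auto simp: P_def Q_def)
  qed
  then obtain f where f: "\<And>t. P t (f t)" "\<And>t. Q t (f t) (f (Suc t))" by blast
  define M S where "M t = fst (f t)" and "S t = snd (f t)" for t
  have mot: "motion n d M S"
    unfolding motion_def using f by (auto simp: P_def Q_def M_def S_def)
  moreover have "S 0 = S0" using f(1)[of 0] by (simp add: P_def S_def)
  moreover have "motion_kind n d M S z = U z" if z: "z \<in> up_region n" for z
  proof -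
    obtain x y where xy: "z = (x, y)" by (cases z)
    obtain t where t: "t < n" "x + y = int n - 1 - int t" using strip_of_point[OF d mot] z xy by blast
    have y: "y = int n - 1 - int t - x" "0 \<le> x" "x \<le> int n - 1 - int t"
      using t z by (auto simp: xy up_region_def)
    have zx: "z = (x, int n - 1 - int t - x)" and xt: "x + (int n - 1 - int t - x) = int n - 1 - int t"
      using xy y by simp_all
    have "slash_label (motion_kind n d M S z) = slash_label (U z)"
      using motion_kind_labels(1)[OF d mot t(1) xt] f(2)[of t] y t by (simp add: zx Q_def a_def M_def S_def)
    moreover have "back_label (motion_kind n d M S z) = back_label (U z)"
      using motion_kind_labels(2)[OF d mot t(1) xt] f(1)[of t] y t by (simp add: zx P_def w_def M_def S_def)
    moreover have "motion_kind n d M S z \<in> up_kinds" using motion_kind_labels(3)[OF d mot t(1) xt] by (simp add: zx)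
    ultimately show ?thesis using up_kind_labels(2) kinds[OF z] by metis
  qed
  ultimately show ?thesis using that by blast
qed

section \<open>The column reading\<close>

lemma reverse_boxes_iff:
  "(r, c) \<in> reverse_boxes d mu \<longleftrightarrow> 1 \<le> r \<and> r \<le> int d \<and> 1 \<le> c \<and> c \<le> int (mu ! nat (r - 1))"
proof
  assume "1 \<le> r \<and> r \<le> int d \<and> 1 \<le> c \<and> c \<le> int (mu ! nat (r - 1))"
  moreover from this have "nat r - 1 = nat (r - 1)" by simp
  ultimately show "(r, c) \<in> reverse_boxes d mu"
    unfolding reverse_boxes_def by (intro CollectI exI[of _ "nat r"] exI[of _ "nat c"]) auto
qed (auto simp: reverse_boxes_def nat_diff_distrib')

lemma young_boxes_iff:
  "(r, c) \<in> young_boxes d lam \<longleftrightarrow>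
     int d + 1 \<le> r \<and> r \<le> 2 * int d \<and> c \<le> 0 \<and> 1 - c \<le> int (lam ! nat (2 * int d - r))"
proof
  assume "int d + 1 \<le> r \<and> r \<le> 2 * int d \<and> c \<le> 0 \<and> 1 - c \<le> int (lam ! nat (2 * int d - r))"
  moreover from this have "nat (2 * int d + 1 - r) - 1 = nat (2 * int d - r)" by simp
  ultimately show "(r, c) \<in> young_boxes d lam"
    unfolding young_boxes_def
    by (intro CollectI exI[of _ "nat (2 * int d + 1 - r)"] exI[of _ "nat (1 - c)"]) auto
next
  assume "(r, c) \<in> young_boxes d lam"
  then obtain i j where ij: "r = 2 * int d + 1 - int i" "c = 1 - int j" "i \<in> {1..d}" "j \<in> {1..lam ! (i - 1)}"
    by (auto simp: young_boxes_def)
  then have "nat (2 * int d - r) = i - 1" by auto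
  then show "int d + 1 \<le> r \<and> r \<le> 2 * int d \<and> c \<le> 0 \<and> 1 - c \<le> int (lam ! nat (2 * int d - r))"
    using ij by auto
qed

lemma finite_skew_boxes: "finite (skew_boxes d lam mu)"
proof -
  have "young_boxes d lam = (\<Union>i \<in> {1..d}. (\<lambda>j. (2 * int d + 1 - int i, 1 - int j)) ` {1..lam ! (i - 1)})"
    "reverse_boxes d mu = (\<Union>i \<in> {1..d}. (\<lambda>j. (int i, int j)) ` {1..mu ! (i - 1)})"
    by (auto simp: young_boxes_def reverse_boxes_def)
  then show ?thesis unfolding skew_boxes_def by simp
qed

lemma finite_reverse_boxes: "finite (reverse_boxes d mu)"
  using finite_skew_boxes[of d "[]" mu] finite_subset[of "reverse_boxes d mu"]
  by (metis finite_Un skew_boxes_def)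

text \<open>With the reading order as a relation, counts in initial segments of the word become
  cardinalities of sets of boxes.\<close>

definition read_before :: "box \<Rightarrow> box \<Rightarrow> bool" where
  "read_before b a \<longleftrightarrow> snd b < snd a \<or> snd b = snd a \<and> fst a < fst b"

lemma sorted_wrt_concat_map:
  assumes "\<And>x. x \<in> set xs \<Longrightarrow> sorted_wrt R (f x)"
    and "sorted_wrt (\<lambda>x y. \<forall>a \<in> set (f x). \<forall>b \<in> set (f y). R a b) xs"
  shows "sorted_wrt R (concat (map f xs))"
  using assms by (induction xs) (auto simp: sorted_wrt_append)

lemma reading_sorted: "sorted_wrt read_before (reading d lam mu)"
proof -
  let ?col = "\<lambda>c. concat (map (\<lambda>r. if (r, c) \<in> skew_boxes d lam mu then [(r, c)] else []) (rev [1..2 * int d]))"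
  have col: "sorted_wrt read_before (?col c)" for c
    by (rule sorted_wrt_concat_map)
      (auto simp: sorted_wrt_rev read_before_def intro: sorted_wrt_mono_rel[OF _ sorted_wrt_upto])
  have cols: "sorted_wrt (\<lambda>c c'. \<forall>a \<in> set (?col c). \<forall>b \<in> set (?col c'). read_before a b)
      [1 - int (lam ! 0)..int (mu ! 0)]"
    by (rule sorted_wrt_mono_rel[OF _ sorted_wrt_upto]) (auto simp: read_before_def split: if_splits)
  show ?thesis unfolding reading_def by (rule sorted_wrt_concat_map[OF col cols])
qed

lemma set_reading:
  assumes "lam \<in> partitions d n" "mu \<in> partitions d n"
  shows "set (reading d lam mu) = skew_boxes d lam mu"
proof
  show "set (reading d lam mu) \<subseteq> skew_boxes d lam mu" by (auto simp: reading_def split: if_splits)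
  show "skew_boxes d lam mu \<subseteq> set (reading d lam mu)"
  proof
    fix b assume b: "b \<in> skew_boxes d lam mu"
    obtain r c where rc: "b = (r, c)" by (cases b)
    have "1 \<le> r \<and> r \<le> 2 * int d \<and> 1 - int (lam ! 0) \<le> c \<and> c \<le> int (mu ! 0)"
    proof (cases "b \<in> young_boxes d lam")
      case True
      then have y: "int d + 1 \<le> r" "r \<le> 2 * int d" "c \<le> 0" "1 - c \<le> int (lam ! nat (2 * int d - r))"
        by (auto simp: rc young_boxes_iff)
      then have "lam ! nat (2 * int d - r) \<le> lam ! 0"
        by (intro partitions_nth_mono[OF assms(1)]) auto
      then show ?thesis using y by linarith
    next
      case False
      then have y: "1 \<le> r" "r \<le> int d" "1 \<le> c" "c \<le> int (mu ! nat (r - 1))"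
        using b by (auto simp: rc skew_boxes_def reverse_boxes_iff)
      then have "mu ! nat (r - 1) \<le> mu ! 0"
        by (intro partitions_nth_mono[OF assms(2)]) auto
      then show ?thesis using y by linarith
    qed
    then show "b \<in> set (reading d lam mu)"
      using b by (auto simp: reading_def rc)
  qed
qed

lemma distinct_reading: "distinct (reading d lam mu)"
proof -
  have "sorted_wrt (\<noteq>) (reading d lam mu)"
    by (rule sorted_wrt_mono_rel[OF _ reading_sorted]) (auto simp: read_before_def)
  then show ?thesis unfolding distinct_conv_nth sorted_wrt_iff_nth_less by (metis linorder_neqE_nat)
qed

lemma takeWhile_reading:
  assumes "j < length (reading d lam mu)"
  shows "takeWhile (\<lambda>b. b \<noteq> reading d lam mu ! j) (reading d lam mu) = take j (reading d lam mu)"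
  using assms distinct_reading[of d lam mu]
  by (intro takeWhile_eq_take_P_nth) (auto simp: nth_eq_iff_index_eq)

lemma set_take_reading:
  assumes "j < length (reading d lam mu)"
  shows "set (take j (reading d lam mu)) =
    {b \<in> set (reading d lam mu). read_before b (reading d lam mu ! j)}"
proof -
  let ?R = "reading d lam mu"
  have less: "read_before (?R ! i) (?R ! i')" if "i < i'" "i' < length ?R" for i i'
    using reading_sorted[of d lam mu] that by (auto simp: sorted_wrt_iff_nth_less)
  have "i < j" if "i < length ?R" "read_before (?R ! i) (?R ! j)" for i
  proof (rule ccontr)
    assume "\<not> i < j"
    then have "i = j \<or> read_before (?R ! j) (?R ! i)" using less[of j i] that by fastforce
    then show False using that by (auto simp: read_before_def)
  qed
  note i_less = this
  show ?thesis
  proof (intro set_eqI iffI)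
    fix b assume "b \<in> set (take j ?R)"
    then obtain i where i: "i < j" "b = ?R ! i" using assms by (auto simp: in_set_conv_nth)
    then show "b \<in> {b \<in> set ?R. read_before b (?R ! j)}" using less[of i j] assms by simp
  next
    fix b assume "b \<in> {b \<in> set ?R. read_before b (?R ! j)}"
    then obtain i where i: "i < length ?R" "b = ?R ! i" "read_before b (?R ! j)"
      by (auto simp: in_set_conv_nth)
    then have "i < j" using i_less by simp
    then have "take j ?R ! i = b" "i < length (take j ?R)" using i by simp_all
    then show "b \<in> set (take j ?R)" by (metis nth_mem)
  qed
qed

lemma unbarred_simps [simp]:
  "unbarred L [] = []"
  "unbarred L (b # bs) = (case L b of Plain k \<Rightarrow> [k] | Barred k \<Rightarrow> []) @ unbarred L bs"
  "unbarred L (bs @ bs') = unbarred L bs @ unbarred L bs'"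
  by (auto simp: unbarred_def)

lemma count_unbarred:
  assumes "distinct bs"
  shows "count_list (unbarred L bs) k = card {b \<in> set bs. L b = Plain k}"
  using assms
proof (induction bs)
  case (Cons b bs)
  have "{x \<in> set (b # bs). L x = Plain k} =
      (if L b = Plain k then insert b {x \<in> set bs. L x = Plain k} else {x \<in> set bs. L x = Plain k})"
    by auto
  then show ?case using Cons by (auto split: entry.split)
qed simp

definition count_before ::
    "nat \<Rightarrow> nat list \<Rightarrow> nat list \<Rightarrow> (box \<Rightarrow> entry) \<Rightarrow> box \<Rightarrow> nat \<Rightarrow> nat" where
  "count_before d lam mu L a k = card {b \<in> skew_boxes d lam mu. read_before b a \<and> L b = Plain k}"

context
  fixes d n :: nat and lam mu :: "nat list"
  assumes lam: "lam \<in> partitions d n" and mu: "mu \<in> partitions d n"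
begin

lemma count_take_reading:
  assumes "j < length (reading d lam mu)"
  shows "count_list (unbarred L (take j (reading d lam mu))) k = count_before d lam mu L (reading d lam mu ! j) k"
  unfolding count_unbarred[OF distinct_take[OF distinct_reading]] set_take_reading[OF assms]
    set_reading[OF lam mu] count_before_def by (simp add: conj_assoc)

lemma count_column_word_before:
  assumes "a \<in> skew_boxes d lam mu"
  shows "count_list (column_word_before d lam mu L a) k = count_before d lam mu L a k"
proof -
  obtain j where j: "j < length (reading d lam mu)" "a = reading d lam mu ! j"
    using assms set_reading[OF lam mu] by (metis in_set_conv_nth)
  then show ?thesis
    using takeWhile_reading[OF j(1)] count_take_reading[OF j(1)] by (simp add: column_word_before_def)
qed

lemma count_column_word:
  "count_list (column_word d lam mu L) k = card {b \<in> skew_boxes d lam mu. L b = Plain k}"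
  using count_unbarred[OF distinct_reading] set_reading[OF lam mu] by (simp add: column_word_def)

lemma take_unbarred: "\<exists>j \<le> length bs. take m (unbarred L bs) = unbarred L (take j bs)"
proof (induction bs arbitrary: m)
  case (Cons b bs)
  show ?case
  proof (cases "\<exists>k m'. L b = Plain k \<and> m = Suc m' \<or> L b = Barred k \<and> m' = m")
    case True
    then obtain k m' where "L b = Plain k \<and> m = Suc m' \<or> L b = Barred k \<and> m' = m" by blast
    moreover obtain j where "j \<le> length bs" "take m' (unbarred L bs) = unbarred L (take j bs)"
      using Cons by blast
    ultimately show ?thesis by (intro exI[of _ "Suc j"]) auto
  next
    case False
    then have "m = 0" by (cases "L b"; cases m) auto
    then show ?thesis by (intro exI[of _ 0]) auto
  qed
qed simp

text \<open>The number of k + 1 can overtake that of k only when a k + 1 is read, so it suffices to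
  compare the counts right before each such entry.\<close>

lemma yamanouchi_iff:
  "yamanouchi d (column_word d lam mu L) \<longleftrightarrow>
     (\<forall>a \<in> skew_boxes d lam mu. \<forall>k \<in> {1..<d}. L a = Plain (k + 1) \<longrightarrow>
        count_before d lam mu L a (k + 1) < count_before d lam mu L a k)" (is "?Y \<longleftrightarrow> ?R")
proof
  let ?rd = "reading d lam mu"
  have split: "take (Suc j) ?rd = take j ?rd @ [?rd ! j]" if "j < length ?rd" for j
    using that by (rule take_Suc_conv_app_nth)
  {
    assume Y: ?Y
    show ?R
    proof (intro ballI impI)
      fix a k assume "a \<in> skew_boxes d lam mu" and k: "k \<in> {1..<d}" and La: "L a = Plain (k + 1)"
      then obtain j where j: "j < length ?rd" "a = ?rd ! j"
        using set_reading[OF lam mu] by (metis in_set_conv_nth)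
      let ?w = "unbarred L (take (Suc j) ?rd)"
      have "column_word d lam mu L = ?w @ unbarred L (drop (Suc j) ?rd)"
        unfolding column_word_def by (metis append_take_drop_id unbarred_simps(3))
      then have "take (length ?w) (column_word d lam mu L) = ?w" "length ?w \<le> length (column_word d lam mu L)"
        by simp_all
      then have "count_list ?w (k + 1) \<le> count_list ?w k"
        using Y k unfolding yamanouchi_def by metis
      then show "count_before d lam mu L a (k + 1) < count_before d lam mu L a k"
        using j La by (simp add: split count_take_reading)
    qed
  next
    assume R: ?R
    have le: "count_list (unbarred L (take j ?rd)) (k + 1) \<le> count_list (unbarred L (take j ?rd)) k"
      if "j \<le> length ?rd" "k \<in> {1..<d}" for j k
      using that(1)
    proof (induction j)
      case (Suc j)
      then have j: "j < length ?rd" by simp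
      then have "?rd ! j \<in> skew_boxes d lam mu" using set_reading[OF lam mu] nth_mem by blast
      then have "L (?rd ! j) = Plain (k + 1) \<longrightarrow>
          count_list (unbarred L (take j ?rd)) (k + 1) < count_list (unbarred L (take j ?rd)) k"
        using R that(2) j by (simp add: count_take_reading)
      then show ?case using Suc.IH j by (auto simp: split split: entry.split)
    qed simp
    show ?Y
      unfolding yamanouchi_def
    proof (intro allI impI ballI)
      fix m k assume "k \<in> {1..<d}"
      then show "count_list (take m (column_word d lam mu L)) (k + 1) \<le> count_list (take m (column_word d lam mu L)) k"
        using take_unbarred[of ?rd m L] le unfolding column_word_def by metis
    qed
  }
qed

end

section \<open>Tableaux as motions\<close>

definition box_time :: "nat \<Rightarrow> (box \<Rightarrow> entry) \<Rightarrow> box \<Rightarrow> int" where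
  "box_time d L b = int d + 1 - int (absval (L b)) + snd b - fst b"

definition unbarred_until :: "nat \<Rightarrow> nat list \<Rightarrow> (box \<Rightarrow> entry) \<Rightarrow> int \<Rightarrow> nat \<Rightarrow> nat" where
  "unbarred_until d mu L t k = card {b \<in> reverse_boxes d mu. L b = Plain k \<and> box_time d L b \<le> t}"

text \<open>The i-th row from the top is filled with i, the only filling of \<lambda> that a
  Yamanouchi word admits.\<close>

definition standard_on_young :: "nat \<Rightarrow> nat list \<Rightarrow> (box \<Rightarrow> entry) \<Rightarrow> bool" where
  "standard_on_young d lam L \<longleftrightarrow> (\<forall>(r, c) \<in> young_boxes d lam. L (r, c) = Plain (nat (2 * int d + 1 - r)))"

lemma young_left:
  assumes "(r, c) \<in> young_boxes d lam" "lam \<in> partitions d n" "r \<le> r'" "r' \<le> 2 * int d" "c \<le> c'" "c' \<le> 0"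
  shows "(r', c') \<in> young_boxes d lam"
proof -
  have "lam ! nat (2 * int d - r) \<le> lam ! nat (2 * int d - r')"
    using assms by (intro partitions_nth_mono[OF assms(2)]) (auto simp: young_boxes_iff)
  then show ?thesis using assms by (auto simp: young_boxes_iff)
qed

lemma reverse_right:
  assumes "(r, c) \<in> reverse_boxes d mu" "mu \<in> partitions d n" "1 \<le> r'" "r' \<le> r" "1 \<le> c'" "c' \<le> c"
  shows "(r', c') \<in> reverse_boxes d mu"
proof -
  have "mu ! nat (r - 1) \<le> mu ! nat (r' - 1)"
    using assms by (intro partitions_nth_mono[OF assms(2)]) (auto simp: reverse_boxes_iff)
  then show ?thesis using assms by (auto simp: reverse_boxes_iff)
qed

lemma young_reverse_disjoint: "young_boxes d lam \<inter> reverse_boxes d mu = {}"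
  by (auto simp: young_boxes_iff reverse_boxes_iff)

lemma finite_young_boxes: "finite (young_boxes d lam)"
  using finite_skew_boxes[of d lam "[]"] by (simp add: skew_boxes_def)

lemma young_read_before: "b \<in> young_boxes d lam \<Longrightarrow> a \<in> reverse_boxes d mu \<Longrightarrow> read_before b a"
  by (cases b; cases a) (auto simp: young_boxes_iff reverse_boxes_iff read_before_def)

lemma reverse_not_read_before: "b \<in> reverse_boxes d mu \<Longrightarrow> a \<in> young_boxes d lam \<Longrightarrow> \<not> read_before b a"
  by (cases b; cases a) (auto simp: young_boxes_iff reverse_boxes_iff read_before_def)

lemma standard_entry_iff:
  assumes "standard_on_young d lam L" "(r, c) \<in> young_boxes d lam"
  shows "L (r, c) = Plain j \<longleftrightarrow> r = 2 * int d + 1 - int j"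
proof -
  have "L (r, c) = Plain (nat (2 * int d + 1 - r))" using assms unfolding standard_on_young_def by blast
  then show ?thesis using assms(2) by (auto simp: young_boxes_iff)
qed

lemma standard_count:
  assumes "standard_on_young d lam L" "k \<in> {1..d}"
  shows "card {b \<in> young_boxes d lam. L b = Plain k} = lam ! (k - 1)"
proof -
  have "{b \<in> young_boxes d lam. L b = Plain k} = (\<lambda>j. (2 * int d + 1 - int k, 1 - int j)) ` {1..lam ! (k - 1)}"
    (is "?A = ?f ` _")
  proof (intro set_eqI iffI)
    fix b assume b: "b \<in> ?A"
    obtain r c where rc: "b = (r, c)" by (cases b)
    have y: "int d + 1 \<le> r" "r \<le> 2 * int d" "c \<le> 0" "1 - c \<le> int (lam ! nat (2 * int d - r))"
      using b by (auto simp: rc young_boxes_iff)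
    have "nat (2 * int d + 1 - r) = k" using b assms(1) by (auto simp: rc standard_on_young_def)
    then have r: "r = 2 * int d + 1 - int k" using y by auto
    then have "nat (2 * int d - r) = k - 1" by auto
    then show "b \<in> ?f ` {1..lam ! (k - 1)}"
      using y r by (intro image_eqI[of _ _ "nat (1 - c)"]) (auto simp: rc)
  next
    fix b assume "b \<in> ?f ` {1..lam ! (k - 1)}"
    then obtain j where j: "j \<in> {1..lam ! (k - 1)}" "b = ?f j" by blast
    then have "b \<in> young_boxes d lam" using assms(2) by (auto simp: young_boxes_def)
    then show "b \<in> ?A" using assms(1) j by (auto simp: standard_on_young_def)
  qed
  moreover have "inj_on ?f {1..lam ! (k - 1)}" by (auto simp: inj_on_def)
  ultimately show ?thesis by (simp add: card_image)
qed

section \<open>Times of entries and the reading order\<close>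

context
  fixes d n :: nat and lam mu :: "nat list" and L :: "box \<Rightarrow> entry"
  assumes lam: "lam \<in> partitions d n" and mu: "mu \<in> partitions d n" and dn: "d \<le> n"
    and L: "L \<in> tableaux d lam mu"
begin

private abbreviation "val b \<equiv> absval (L b)"
private abbreviation "rev_b \<equiv> reverse_boxes d mu"
private abbreviation "time \<equiv> box_time d L"
private abbreviation "unb \<equiv> unbarred_until d mu L"
private abbreviation "cnt \<equiv> count_before d lam mu L"
private abbreviation "word \<equiv> column_word d lam mu L"

lemma reverse_entry: "b \<in> rev_b \<Longrightarrow> L b \<in> Plain ` {1..d} \<union> Barred ` {1..d}"
  using L unfolding tableaux_def by blast

lemma reverse_val: "b \<in> rev_b \<Longrightarrow> 1 \<le> val b \<and> val b \<le> d"
  using reverse_entry by fastforce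

lemma reverse_row:
  "(r, c) \<in> rev_b \<Longrightarrow> (r, c') \<in> rev_b \<Longrightarrow> c' \<le> c \<Longrightarrow> val (r, c) \<le> val (r, c')"
  using L unfolding tableaux_def skew_boxes_def by (cases "c = c'") auto

lemma reverse_col:
  "(r, c) \<in> rev_b \<Longrightarrow> (r', c) \<in> rev_b \<Longrightarrow> r' < r \<Longrightarrow> val (r, c) < val (r', c)"
  using L unfolding tableaux_def skew_boxes_def by auto

lemma reverse_col_spread:
  assumes "(r, c) \<in> rev_b" "1 \<le> r'" "r' \<le> r"
  shows "int (val (r, c)) + (r - r') \<le> int (val (r', c))"
  using assms
proof (induction "nat (r - r')" arbitrary: r)
  case (Suc x)
  have c: "1 \<le> c" using Suc.prems by (simp add: reverse_boxes_iff)
  have b: "(r - 1, c) \<in> rev_b" using Suc.hyps Suc.prems c by (intro reverse_right[OF Suc.prems(1) mu]) auto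
  then have "int (val (r - 1, c)) + (r - 1 - r') \<le> int (val (r', c))" using Suc by (intro Suc.hyps) auto
  moreover have "val (r, c) < val (r - 1, c)" using reverse_col[OF Suc.prems(1) b] by simp
  ultimately show ?case by simp
qed auto

lemma time_row: "(r, c) \<in> rev_b \<Longrightarrow> (r, c') \<in> rev_b \<Longrightarrow> c' < c \<Longrightarrow> time (r, c') < time (r, c)"
  using reverse_row[of r c c'] by (simp add: box_time_def)

lemma time_col: "(r, c) \<in> rev_b \<Longrightarrow> 1 \<le> r' \<Longrightarrow> r' \<le> r \<Longrightarrow> time (r', c) \<le> time (r, c)"
  using reverse_col_spread[of r c r'] by (simp add: box_time_def)

text \<open>The r - 1 boxes below this one carry larger and larger values, at most d, so its own
  value is at most d + 1 - r. The upper bound comes from c \<le> n - d.\<close>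

lemma time_bounds:
  assumes "(r, c) \<in> rev_b"
  shows "c \<le> time (r, c)" "1 \<le> time (r, c)" "time (r, c) \<le> int n"
proof -
  have rc: "1 \<le> r" "r \<le> int d" "1 \<le> c" "c \<le> int (mu ! nat (r - 1))"
    using assms by (auto simp: reverse_boxes_iff)
  have "(1, c) \<in> rev_b" using rc by (intro reverse_right[OF assms mu]) auto
  then have "int (val (r, c)) + (r - 1) \<le> int d"
    using reverse_col_spread[OF assms, of 1] reverse_val[of "(1, c)"] rc by auto
  then show "c \<le> time (r, c)" by (simp add: box_time_def)
  then show "1 \<le> time (r, c)" using rc by simp
  have "mu ! nat (r - 1) \<le> n - d" using rc by (intro partitions_nth_le[OF mu]) auto
  then show "time (r, c) \<le> int n" using rc reverse_val[OF assms] dn by (auto simp: box_time_def)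
qed

text \<open>Otherwise the diagram contains (r, c'), in the row of the first box and above the
  second, and its value would be at least the former and less than the latter.\<close>

lemma equal_value_rows:
  assumes "(r, c) \<in> rev_b" "(r', c') \<in> rev_b" "val (r, c) = val (r', c')" "c' < c"
  shows "r \<le> r'"
proof (rule ccontr)
  assume "\<not> r \<le> r'"
  then have "(r, c') \<in> rev_b"
    using assms by (intro reverse_right[OF assms(1) mu]) (auto simp: reverse_boxes_iff)
  then show False
    using reverse_row[of r c c'] reverse_col[of r c' r'] assms \<open>\<not> r \<le> r'\<close> by auto
qed

lemma read_before_iff_time_less:
  assumes "b \<in> rev_b" "a \<in> rev_b" "val b = val a"
  shows "read_before b a \<longleftrightarrow> time b < time a"
proof -
  obtain r c r' c' where rc: "a = (r, c)" "b = (r', c')" by (cases a; cases b)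
  consider "c' < c" | "c < c'" | "c' = c" by linarith
  then show ?thesis
  proof cases
    case 1
    then show ?thesis using equal_value_rows[of r c r' c'] assms
      by (simp add: rc read_before_def box_time_def)
  next
    case 2
    then show ?thesis using equal_value_rows[of r' c' r c] assms
      by (simp add: rc read_before_def box_time_def)
  next
    case 3
    then have "r = r'" using reverse_col[of r c r'] reverse_col[of r' c r] assms by (force simp: rc)
    then show ?thesis using 3 by (simp add: rc read_before_def box_time_def)
  qed
qed

text \<open>A tie counts as before: when strands k and k + 1 are both crossed in one strip, the k is
  read first. This matches the fact that neighbouring strands may move together without
  meeting.\<close>

lemma read_before_iff_time_le:
  assumes "b \<in> rev_b" "a \<in> rev_b" "val a = val b + 1"
  shows "read_before b a \<longleftrightarrow> time b \<le> time a"
proof -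
  obtain r c r' c' where rc: "a = (r, c)" "b = (r', c')" by (cases a; cases b)
  have A: "(r, c) \<in> rev_b" and B: "(r', c') \<in> rev_b" and V: "val (r, c) = val (r', c') + 1"
    using assms unfolding rc by simp_all
  have bnd: "1 \<le> r" "1 \<le> c" "1 \<le> r'" "1 \<le> c'" using A B by (simp_all add: reverse_boxes_iff)
  consider "c' < c" | "c < c'" | "c' = c" by linarith
  then show ?thesis
  proof cases
    case 1
    have "r \<le> r'"
    proof (rule ccontr)
      assume r: "\<not> r \<le> r'"
      have x: "(r, c') \<in> rev_b" using 1 bnd by (intro reverse_right[OF A mu]) simp_all
      have "val (r, c) \<le> val (r, c')" using reverse_row[OF A x] 1 by simp
      moreover have "val (r, c') < val (r', c')" using reverse_col[OF x B] r by simp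
      ultimately show False using V by simp
    qed
    then show ?thesis using 1 V by (simp add: rc read_before_def box_time_def)
  next
    case 2
    \<comment> \<open>Row r' makes the value at (r', c) at least that of b, and column c then grows
      by at least r' - r down to a, whose value exceeds that of b by only 1.\<close>
    have "r' - r < c' - c + 1"
    proof (rule ccontr)
      assume r: "\<not> r' - r < c' - c + 1"
      have x: "(r', c) \<in> rev_b" using 2 bnd by (intro reverse_right[OF B mu]) simp_all
      have "val (r', c') \<le> val (r', c)" using reverse_row[OF B x] 2 by simp
      moreover have "int (val (r', c)) + (r' - r) \<le> int (val (r, c))"
        using reverse_col_spread[OF x, of r] r 2 bnd by simp
      ultimately show False using V r 2 by simp
    qed
    then show ?thesis using 2 V by (simp add: rc read_before_def box_time_def)
  next
    case 3
    have "r < r'"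
      using reverse_col[OF A B[unfolded 3]] V 3 by (cases r r' rule: linorder_cases) simp_all
    then show ?thesis using 3 V by (simp add: rc read_before_def box_time_def)
  qed
qed

text \<open>In each strip a strand is crossed at most once: of two such boxes neither is read before
  the other.\<close>

lemma value_time_inj:
  "b \<in> rev_b \<Longrightarrow> a \<in> rev_b \<Longrightarrow> val b = val a \<Longrightarrow> time b = time a \<Longrightarrow> b = a"
  using read_before_iff_time_less[of b a] read_before_iff_time_less[of a b]
  by (cases a; cases b) (auto simp: read_before_def)

lemma count_before_reverse:
  assumes st: "standard_on_young d lam L" and k: "k \<in> {1..d}" and a: "a \<in> rev_b"
  shows "cnt a k = lam ! (k - 1) + card {b \<in> rev_b. L b = Plain k \<and> read_before b a}"
proof -
  have "{b \<in> skew_boxes d lam mu. read_before b a \<and> L b = Plain k} =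
      {b \<in> young_boxes d lam. L b = Plain k} \<union> {b \<in> rev_b. L b = Plain k \<and> read_before b a}"
    using young_read_before[OF _ a] by (auto simp: skew_boxes_def)
  then show ?thesis
    unfolding count_before_def standard_count[OF st k, symmetric]
    using young_reverse_disjoint[of d lam mu]
    by (simp add: finite_young_boxes finite_reverse_boxes)
      (subst card_Un_disjoint, auto simp: finite_young_boxes finite_reverse_boxes)
qed

lemma count_before_same:
  assumes st: "standard_on_young d lam L" and a: "a \<in> rev_b"
  shows "cnt a (val a) = lam ! (val a - 1) + unb (time a - 1) (val a)"
proof -
  have "{b \<in> rev_b. L b = Plain (val a) \<and> read_before b a} =
      {b \<in> rev_b. L b = Plain (val a) \<and> time b \<le> time a - 1}"
    using read_before_iff_time_less[OF _ a] by force
  then show ?thesis using count_before_reverse[OF st _ a, of "val a"] reverse_val[OF a]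
    by (simp add: unbarred_until_def)
qed

text \<open>Entries k with the time of a itself are included here, unlike in
  \<open>count_before_same\<close>; this is the tie in the reading order.\<close>

lemma count_before_pred:
  assumes st: "standard_on_young d lam L" and a: "a \<in> rev_b" "val a = k + 1" "1 \<le> k"
  shows "cnt a k = lam ! (k - 1) + unb (time a) k"
proof -
  have "{b \<in> rev_b. L b = Plain k \<and> read_before b a} =
      {b \<in> rev_b. L b = Plain k \<and> time b \<le> time a}"
    using read_before_iff_time_le[OF _ a(1)] a(2) by force
  then show ?thesis using count_before_reverse[OF st _ a(1), of k] reverse_val[OF a(1)] a
    by (simp add: unbarred_until_def)
qed

lemma unbarred_until_step:
  "unb t k = unb (t - 1) k + (if \<exists>b \<in> rev_b. L b = Plain k \<and> time b = t then 1 else 0)"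
proof -
  let ?A = "{b \<in> rev_b. L b = Plain k \<and> time b \<le> t - 1}"
  show ?thesis
  proof (cases "\<exists>b \<in> rev_b. L b = Plain k \<and> time b = t")
    case True
    then obtain b where b: "b \<in> rev_b" "L b = Plain k" "time b = t" by blast
    have "x = b" if "x \<in> rev_b" "L x = Plain k" "time x = t" for x
      using value_time_inj[of x b] that b by simp
    then have "{b \<in> rev_b. L b = Plain k \<and> time b \<le> t} = insert b ?A" using b by force
    moreover have "finite ?A" "b \<notin> ?A" using b by (auto simp: finite_reverse_boxes)
    ultimately show ?thesis using True by (simp add: unbarred_until_def)
  next
    case False
    then have "{b \<in> rev_b. L b = Plain k \<and> time b \<le> t} = ?A" by force
    then show ?thesis using False by (simp add: unbarred_until_def)
  qed
qed

lemma unbarred_until_0: "t \<le> 0 \<Longrightarrow> unb t k = 0"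
proof -
  assume "t \<le> 0"
  then have "{b \<in> rev_b. L b = Plain k \<and> time b \<le> t} = {}" using time_bounds(2) by force
  then show ?thesis unfolding unbarred_until_def by (simp only: card.empty)
qed

lemma unbarred_until_n: "unb (int n) k = card {b \<in> rev_b. L b = Plain k}"
  unfolding unbarred_until_def using time_bounds(3) by (intro arg_cong[of _ _ card]) auto

lemma unbarred_until_mono: "t \<le> t' \<Longrightarrow> unb t k \<le> unb t' k"
  unfolding unbarred_until_def by (intro card_mono) (auto simp: finite_reverse_boxes)

lemma content_eq_iff:
  assumes "standard_on_young d lam L" "length nu = d"
  shows "content d word = nu \<longleftrightarrow>
    (\<forall>k \<in> {1..d}. nu ! (k - 1) = lam ! (k - 1) + unb (int n) k)"
proof -
  have "count_list (word) k = lam ! (k - 1) + unb (int n) k"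
    if k: "k \<in> {1..d}" for k
  proof -
    have "{b \<in> skew_boxes d lam mu. L b = Plain k} = {b \<in> young_boxes d lam. L b = Plain k} \<union> {b \<in> rev_b. L b = Plain k}"
      by (auto simp: skew_boxes_def)
    moreover have "card \<dots> = card {b \<in> young_boxes d lam. L b = Plain k} + card {b \<in> rev_b. L b = Plain k}"
      using young_reverse_disjoint[of d lam mu]
      by (intro card_Un_disjoint) (auto simp: finite_young_boxes finite_reverse_boxes)
    ultimately show ?thesis
      using standard_count[OF assms(1) k] by (simp add: count_column_word[OF lam mu] unbarred_until_n)
  qed
  note * = this
  have "content d word = nu \<longleftrightarrow>
      (\<forall>i < d. count_list (word) (i + 1) = nu ! i)"
    using assms(2) by (auto simp: content_def list_eq_iff_nth_eq simp del: upt_Suc)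
  also have "\<dots> \<longleftrightarrow> (\<forall>i < d. nu ! i = lam ! i + unb (int n) (i + 1))"
    using * by (intro all_cong) auto
  also have "\<dots> \<longleftrightarrow> (\<forall>k \<in> {1..d}. nu ! (k - 1) = lam ! (k - 1) + unb (int n) k)"
  proof (intro iffI ballI allI impI)
    fix k assume h: "\<forall>i < d. nu ! i = lam ! i + unb (int n) (i + 1)" and "k \<in> {1..d}"
    then show "nu ! (k - 1) = lam ! (k - 1) + unb (int n) k"
      using h[rule_format, of "k - 1"] by auto
  next
    fix i assume h: "\<forall>k \<in> {1..d}. nu ! (k - 1) = lam ! (k - 1) + unb (int n) k" and "i < d"
    then show "nu ! i = lam ! i + unb (int n) (i + 1)"
      using h[rule_format, of "i + 1"] by auto
  qed
  finally show ?thesis .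
qed

text \<open>Columns are treated from the right, each from the top. Strict columns give at least the
  row index i. A larger value k + 1 needs an earlier k; earlier boxes are already standard, so this
  k is in row k, at or below row i, in a column further right. Then row i has a box in the next
  column to the right, with value i, and weak increase of the row gives a contradiction.\<close>

lemma yamanouchi_standard:
  assumes Y: "yamanouchi d word"
  shows "standard_on_young d lam L"
proof -
  have "\<forall>r. (r, c) \<in> young_boxes d lam \<longrightarrow> L (r, c) = Plain (nat (2 * int d + 1 - r))" for c
  proof (induction "nat (c + int (lam ! 0))" arbitrary: c rule: less_induct)
    case (less c)
    have right: "L (r, c') = Plain (nat (2 * int d + 1 - r))"
      if "(r, c') \<in> young_boxes d lam" "c' < c" for r c'
    proof -
      have "lam ! nat (2 * int d - r) \<le> lam ! 0"
        using that by (intro partitions_nth_mono[OF lam]) (auto simp: young_boxes_iff)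
      then have "nat (c' + int (lam ! 0)) < nat (c + int (lam ! 0))"
        using that by (auto simp: young_boxes_iff)
      then show ?thesis using less that by blast
    qed
    have "L (r, c) = Plain (nat (2 * int d + 1 - r))" if "(r, c) \<in> young_boxes d lam" for r
      using that
    proof (induction "nat (2 * int d - r)" arbitrary: r rule: less_induct)
      case (less r)
      note rb = less.prems
      then have bnd: "int d + 1 \<le> r" "r \<le> 2 * int d" "c \<le> 0" by (auto simp: young_boxes_iff)
      have above: "L (r', c) = Plain (nat (2 * int d + 1 - r'))" if "(r', c) \<in> young_boxes d lam" "r < r'" for r'
        using less.hyps that bnd by (auto simp: young_boxes_iff)
      obtain v where v: "L (r, c) = Plain v" "1 \<le> v" "v \<le> d"
        using L rb unfolding tableaux_def by force
      have ge: "2 * int d + 1 - r \<le> int v"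
      proof (cases "r = 2 * int d")
        case False
        then have b: "(r + 1, c) \<in> young_boxes d lam"
          using bnd by (intro young_left[OF rb lam]) auto
        have "absval (L (r + 1, c)) < absval (L (r, c))"
          using L rb b unfolding tableaux_def skew_boxes_def by auto
        then show ?thesis using above[OF b] v by simp
      qed (use v in simp)
      have "int v \<le> 2 * int d + 1 - r"
      proof (rule ccontr)
        assume gt: "\<not> int v \<le> 2 * int d + 1 - r"
        define k where "k = v - 1"
        have k: "k \<in> {1..<d}" "v = k + 1" "2 * int d + 1 - r \<le> int k"
          using gt v bnd by (auto simp: k_def)
        have "cnt (r, c) k > 0"
          using Y k v rb unfolding yamanouchi_iff[OF lam mu] by (fastforce simp: skew_boxes_def)
        then obtain b where b: "b \<in> skew_boxes d lam mu" "read_before b (r, c)" "L b = Plain k"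
          unfolding count_before_def by (metis (mono_tags, lifting) card_gt_0_iff Collect_empty_eq)
        obtain r' c' where rc': "b = (r', c')" by (cases b)
        have y': "(r', c') \<in> young_boxes d lam"
          using b reverse_not_read_before[OF _ rb] unfolding rc' skew_boxes_def by blast
        have std: "L (r', c') = Plain (nat (2 * int d + 1 - r'))"
          using b(2) right[OF y'] above[of r'] y' by (auto simp: rc' read_before_def)
        then have r': "r' = 2 * int d + 1 - int k" using b y' by (auto simp: rc' young_boxes_iff)
        then have c': "c' < c" using b(2) k by (auto simp: rc' read_before_def)
        have nb: "(r, c - 1) \<in> young_boxes d lam"
          using y' c' r' k bnd by (intro young_left[OF y' lam]) auto
        have "absval (L (r, c)) \<le> absval (L (r, c - 1))"
          using L rb nb unfolding tableaux_def skew_boxes_def by auto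
        then show False using right[OF nb] v gt by simp
      qed
      then show ?case using ge v by simp
    qed
    then show ?case by blast
  qed
  then show ?thesis by (auto simp: standard_on_young_def)
qed

text \<open>Part k + 1 of N grows only in the strip of an unbarred k + 1. The Yamanouchi condition
  at that entry counts the k of the same strip too, and its strict inequality leaves room for the
  new entry.\<close>

lemma yamanouchi_counts:
  assumes Y: "yamanouchi d word" and k: "k \<in> {1..<d}"
  shows "lam ! k + unb (int t) (k + 1) \<le> lam ! (k - 1) + unb (int t) k"
proof (induction t)
  case 0
  then show ?case using partitions_nth_mono[OF lam, of "k - 1" k] k by (simp add: unbarred_until_0)
next
  case (Suc t)
  note st = yamanouchi_standard[OF Y]
  show ?case
  proof (cases "\<exists>a \<in> rev_b. L a = Plain (k + 1) \<and> time a = int (Suc t)")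
    case True
    then obtain a where a: "a \<in> rev_b" "L a = Plain (k + 1)" "time a = int (Suc t)" by blast
    have "cnt a (k + 1) < cnt a k"
      using Y k a unfolding yamanouchi_iff[OF lam mu] by (auto simp: skew_boxes_def)
    then show ?thesis
      using count_before_same[OF st a(1)] count_before_pred[OF st a(1), of k] a k True
        unbarred_until_step[of "int (Suc t)" "k + 1"] by simp
  next
    case False
    have "unb (int (Suc t)) (k + 1) = unb (int t) (k + 1)"
      unfolding unbarred_until_step[of "int (Suc t)" "k + 1"] if_not_P[OF False] by simp
    then show ?thesis
      using Suc unbarred_until_mono[of "int t" "int (Suc t)" k] by simp
  qed
qed

lemma yamanouchiI:
  assumes st: "standard_on_young d lam L"
    and counts: "\<And>t k. k \<in> {1..<d} \<Longrightarrow> t \<le> n \<Longrightarrow>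
      lam ! k + unb (int t) (k + 1) \<le> lam ! (k - 1) + unb (int t) k"
  shows "yamanouchi d word"
  unfolding yamanouchi_iff[OF lam mu]
proof (intro ballI impI)
  fix a k assume a: "a \<in> skew_boxes d lam mu" and k: "k \<in> {1..<d}" and La: "L a = Plain (k + 1)"
  show "cnt a (k + 1) < cnt a k"
  proof (cases "a \<in> rev_b")
    case True
    have "time a \<le> int n" "1 \<le> time a" using time_bounds[of "fst a" "snd a"] True by simp_all
    then have "lam ! k + unb (time a) (k + 1) \<le> lam ! (k - 1) + unb (time a) k"
      using counts[OF k, of "nat (time a)"] by simp
    moreover have "\<exists>b \<in> rev_b. L b = Plain (k + 1) \<and> time b = time a" using True La by blast
    ultimately show ?thesis
      using count_before_same[OF st True] count_before_pred[OF st True, of k] La k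
        unbarred_until_step[of "time a" "k + 1"] by simp
  next
    case False
    then have y: "a \<in> young_boxes d lam" using a by (simp add: skew_boxes_def)
    obtain r c where rc: "a = (r, c)" by (cases a)
    have r: "r = 2 * int d - int k"
      using standard_entry_iff[OF st y[unfolded rc]] La by (simp add: rc)
    let ?A = "\<lambda>k. {b \<in> skew_boxes d lam mu. read_before b a \<and> L b = Plain k}"
    have A: "b \<in> young_boxes d lam" if "b \<in> ?A j" for b j
      using that reverse_not_read_before[OF _ y] unfolding skew_boxes_def by blast
    \<comment> \<open>Each k + 1 of \<lambda> has a k directly above it. The k above the entry a is
      also read before a, but stands above no k + 1 read before a, so the inclusion is
      proper.\<close>
    have "(\<lambda>(r, c). (r + 1, c)) ` ?A (k + 1) \<subset> ?A k"
    proof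
      show "(\<lambda>(r, c). (r + 1, c)) ` ?A (k + 1) \<subseteq> ?A k"
      proof
        fix x assume "x \<in> (\<lambda>(r, c). (r + 1, c)) ` ?A (k + 1)"
        then obtain r' c' where x: "x = (r' + 1, c')" "(r', c') \<in> ?A (k + 1)" by auto
        then have y': "(r', c') \<in> young_boxes d lam" using A by blast
        then have r': "r' = 2 * int d - int k"
          using standard_entry_iff[OF st y'] x by simp
        have y2: "(r' + 1, c') \<in> young_boxes d lam"
          using y' r' k by (intro young_left[OF y' lam]) (auto simp: young_boxes_iff)
        then show "x \<in> ?A k"
          using standard_entry_iff[OF st y2, of k] y2 x r' r by (auto simp: skew_boxes_def rc read_before_def)
      qed
      have y2: "(r + 1, c) \<in> young_boxes d lam"
      proof (rule young_left[OF y[unfolded rc] lam])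
        show "c \<le> 0" using y[unfolded rc] by (simp add: young_boxes_iff)
      qed (use r k in simp_all)
      then have "(r + 1, c) \<in> ?A k"
        using standard_entry_iff[OF st y2, of k] y2 r by (auto simp: skew_boxes_def rc read_before_def)
      moreover have "(r + 1, c) \<notin> (\<lambda>(r, c). (r + 1, c)) ` ?A (k + 1)"
        by (auto simp: rc read_before_def)
      ultimately show "(\<lambda>(r, c). (r + 1, c)) ` ?A (k + 1) \<noteq> ?A k" by blast
    qed
    then have "card ((\<lambda>(r, c). (r + 1, c)) ` ?A (k + 1)) < card (?A k)"
      by (intro psubset_card_mono) (simp_all add: finite_skew_boxes)
    moreover have "card ((\<lambda>(r, c). (r + 1, c)) ` ?A (k + 1)) = card (?A (k + 1))"
      by (intro card_image) (auto simp: inj_on_def)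
    ultimately show ?thesis by (simp add: count_before_def)
  qed
qed

end

text \<open>The cardinality counts the crossings of mark r in the first t strips; in each of the
  other strips the mark drops by one from its start on strand d + 1 - r.\<close>

definition tableau_mark :: "nat \<Rightarrow> nat list \<Rightarrow> (box \<Rightarrow> entry) \<Rightarrow> nat \<Rightarrow> int \<Rightarrow> int" where
  "tableau_mark d mu L t r = int d + 1 - int t - r +
     int (card {c \<in> {1..int (mu ! nat (r - 1))}. box_time d L (r, c) \<le> int t})"

definition tableau_strand :: "nat \<Rightarrow> nat \<Rightarrow> nat list \<Rightarrow> nat list \<Rightarrow> (box \<Rightarrow> entry) \<Rightarrow> nat \<Rightarrow> int \<Rightarrow> int"
  where
  "tableau_strand n d lam mu L t k = int n - int d + k - 1 - int (lam ! nat (k - 1)) -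
     int (unbarred_until d mu L (int t) (nat k))"

text \<open>The common index set of the two products: these pairs of a strip and a strand are the
  equivariant pieces of a puzzle and the barred entries of a tableau.\<close>

definition stationary_crossings ::
    "nat \<Rightarrow> nat \<Rightarrow> (nat \<Rightarrow> int \<Rightarrow> int) \<Rightarrow> (nat \<Rightarrow> int \<Rightarrow> int) \<Rightarrow> (nat \<times> int) set" where
  "stationary_crossings n d M S =
     {(t, k). t < n \<and> k \<in> {1..int d} \<and> crosses d (M t) (M (Suc t)) k \<and> S (Suc t) k = S t k}"

lemma finite_stationary_crossings: "finite (stationary_crossings n d M S)"
  by (rule finite_subset[of _ "{..<n} \<times> {1..int d}"]) (auto simp: stationary_crossings_def)

text \<open>Here \<open>n - S t k\<close> is k' + N_k for strand k, and the strip with index t is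
  the one numbered t + 1.\<close>

definition motion_factors ::
    "nat \<Rightarrow> nat \<Rightarrow> (nat \<Rightarrow> int \<Rightarrow> int) \<Rightarrow> (nat \<Rightarrow> int \<Rightarrow> int) \<Rightarrow> factor multiset" where
  "motion_factors n d M S =
     image_mset (\<lambda>(t, k). (int n - S t k, int t + 1)) (mset_set (stationary_crossings n d M S))"

section \<open>The motion of a tableau\<close>

context
  fixes d n :: nat and lam mu :: "nat list" and L :: "box \<Rightarrow> entry"
  assumes lam: "lam \<in> partitions d n" and mu: "mu \<in> partitions d n" and d: "1 \<le> d" and dn: "d \<le> n"
    and L: "L \<in> tableaux d lam mu"
begin

private abbreviation "value_at b \<equiv> absval (L b)"
private abbreviation "boxes \<equiv> reverse_boxes d mu"
private abbreviation "time_of \<equiv> box_time d L"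
private abbreviation "row_until t r \<equiv> {c \<in> {1..int (mu ! nat (r - 1))}. time_of (r, c) \<le> int t}"
private abbreviation "M \<equiv> tableau_mark d mu L"
private abbreviation "S \<equiv> tableau_strand n d lam mu L"

private lemmas tab_facts = lam mu dn L

lemma row_boxes: "r \<in> {1..int d} \<Longrightarrow> c \<in> {1..int (mu ! nat (r - 1))} \<longleftrightarrow> (r, c) \<in> boxes"
  by (auto simp: reverse_boxes_iff)

text \<open>Times increase along a row, so exactly c - 1 boxes of row r have time at most t, and c
  have time at most t + 1. Inserted into \<open>tableau_mark\<close>, this inverts the definition of
  \<open>box_time\<close>.\<close>

lemma mark_at_box:
  assumes b: "(r, c) \<in> boxes" and t: "time_of (r, c) = int t + 1"
  shows "M t r = int (value_at (r, c))" "M (Suc t) r = int (value_at (r, c))"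
proof -
  have r: "r \<in> {1..int d}" and c: "1 \<le> c" using b by (auto simp: reverse_boxes_iff)
  note row = row_boxes[OF r]
  have le: "(r, c') \<in> boxes" if "1 \<le> c'" "c' \<le> c" for c'
    using that r by (intro reverse_right[OF b mu]) auto
  have less: "time_of (r, c') < time_of (r, c) \<longleftrightarrow> c' < c" if "(r, c') \<in> boxes" for c'
    using time_row[OF tab_facts b that] time_row[OF tab_facts that b] by (cases c' c rule: linorder_cases) auto
  have "row_until t r = {1..c - 1}"
  proof (intro set_eqI iffI)
    fix x assume "x \<in> row_until t r"
    then show "x \<in> {1..c - 1}" using less[of x] row[of x] t by auto
  next
    fix x assume "x \<in> {1..c - 1}"
    then have "(r, x) \<in> boxes" "x < c" using le by auto
    then show "x \<in> row_until t r"
      using less[of x] row[of x] t by auto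
  qed
  moreover have "row_until (Suc t) r = {1..c}"
  proof (intro set_eqI iffI)
    fix x assume "x \<in> row_until (Suc t) r"
    then show "x \<in> {1..c}"
      using time_row[OF tab_facts, of r x c] b row[of x] t by (cases "x \<le> c") auto
  next
    fix x assume "x \<in> {1..c}"
    then have "(r, x) \<in> boxes" "x < c \<or> x = c" using le by auto
    then show "x \<in> row_until (Suc t) r"
      using less[of x] row[of x] t by auto
  qed
  ultimately show "M t r = int (value_at (r, c))" "M (Suc t) r = int (value_at (r, c))"
    using t c by (simp_all add: tableau_mark_def box_time_def)
qed

lemma mark_without_box:
  assumes r: "r \<in> {1..int d}" and no: "\<And>c. (r, c) \<in> boxes \<Longrightarrow> time_of (r, c) \<noteq> int t + 1"
  shows "M (Suc t) r = M t r - 1"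
proof -
  have "row_until (Suc t) r =
      row_until t r"
    using no row_boxes[OF r] by force
  then show ?thesis unfolding tableau_mark_def by simp
qed

lemma box_of_mark:
  assumes r: "r \<in> {1..int d}" and same: "M (Suc t) r = M t r"
  obtains c where "(r, c) \<in> boxes" "time_of (r, c) = int t + 1" "M t r = int (value_at (r, c))"
  using mark_without_box[OF r, of t] mark_at_box same that by force

lemma crosses_iff_box:
  "crosses d (M t) (M (Suc t)) k \<longleftrightarrow> (\<exists>b \<in> boxes. int (value_at b) = k \<and> time_of b = int t + 1)"
proof
  assume "crosses d (M t) (M (Suc t)) k"
  then obtain r where r: "r \<in> {1..int d}" "M t r = k" "M (Suc t) r = k" by (auto simp: crosses_def)
  then show "\<exists>b \<in> boxes. int (value_at b) = k \<and> time_of b = int t + 1"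
    using box_of_mark[OF r(1), of t] by metis
next
  assume "\<exists>b \<in> boxes. int (value_at b) = k \<and> time_of b = int t + 1"
  then obtain r c where b: "(r, c) \<in> boxes" "int (value_at (r, c)) = k" "time_of (r, c) = int t + 1" by auto
  moreover have "r \<in> {1..int d}" using b by (auto simp: reverse_boxes_iff)
  ultimately show "crosses d (M t) (M (Suc t)) k"
    using mark_at_box[OF b(1,3)] by (auto simp: crosses_def)
qed

lemma strand_step:
  "S (Suc t) k = S t k - (if \<exists>b \<in> boxes. L b = Plain (nat k) \<and> time_of b = int t + 1 then 1 else 0)"
  using unbarred_until_step[OF tab_facts, of "int t + 1" "nat k"]
  by (simp add: tableau_strand_def add.commute)

text \<open>The mark gives the value and a strand standing still gives the bar, so the motion
  determines the entry.\<close>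

lemma entry_at_box:
  assumes b: "(r, c) \<in> boxes" and t: "time_of (r, c) = int t + 1"
  shows "L (r, c) = (if S (Suc t) (M t r) = S t (M t r) then Barred (nat (M t r)) else Plain (nat (M t r)))"
proof -
  let ?v = "value_at (r, c)"
  have "(\<exists>b \<in> boxes. L b = Plain ?v \<and> time_of b = int t + 1) \<longleftrightarrow> L (r, c) = Plain ?v"
    using value_time_inj[OF tab_facts _ b] t b by force
  then have "S (Suc t) ?v = S t ?v \<longleftrightarrow> L (r, c) \<noteq> Plain ?v"
    using strand_step[of t "int ?v"] by auto
  then show ?thesis using mark_at_box[OF b t] by (cases "L (r, c)") auto
qed

lemma tableau_mark_0: "M 0 r = int d + 1 - r" if "r \<in> {1..int d}"
proof -
  have "row_until 0 r = {}"
    using time_bounds(2)[OF tab_facts] row_boxes[OF that] by force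
  then show ?thesis unfolding tableau_mark_def by (simp only: card.empty)
qed

lemma tableau_mark_n: "M n r = int d + 1 - int n - r + int (mu ! nat (r - 1))" if "r \<in> {1..int d}"
proof -
  have "row_until n r = {1..int (mu ! nat (r - 1))}"
    using time_bounds(3)[OF tab_facts] row_boxes[OF that] by force
  then show ?thesis unfolding tableau_mark_def by simp
qed

text \<open>A lower row is at least as long, and its boxes are not later than those above them, so
  on any line its mark has at least as many crossings behind it.\<close>

lemma tableau_mark_decreasing: "decreasing_upto d (M t)"
  unfolding decreasing_upto_def
proof (intro allI impI)
  fix i j assume ij: "1 \<le> i \<and> i < j \<and> j \<le> int d"
  have "row_until t j \<subseteq>
      row_until t i"
  proof
    fix c assume c: "c \<in> row_until t j"
    then have j: "(j, c) \<in> boxes" using ij by (simp add: reverse_boxes_iff)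
    then have "(i, c) \<in> boxes" using ij by (intro reverse_right[OF j mu]) (auto simp: reverse_boxes_iff)
    moreover have "time_of (i, c) \<le> time_of (j, c)" using ij by (intro time_col[OF tab_facts j]) auto
    ultimately show "c \<in> row_until t i"
      using c by (auto simp: reverse_boxes_iff)
  qed
  then have "card (row_until t j) \<le>
      card (row_until t i)"
    by (rule card_mono[rotated]) (rule finite_subset[of _ "{1..int (mu ! nat (i - 1))}"], auto)
  then show "M t j < M t i" using ij by (simp add: tableau_mark_def)
qed

text \<open>A barred box becomes the pair of its strip and its strand. This map is injective since
  value and time determine a box, and surjective since every crossing comes from a box, which is
  barred if the strand stands still.\<close>

lemma tableau_c_factors_eq:
  assumes st: "standard_on_young d lam L"
  shows "tableau_c_factors d lam mu L = motion_factors n d M S"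
proof -
  let ?B = "barred_boxes d lam mu L"
  let ?h = "\<lambda>a. (nat (time_of a - 1), int (value_at a))"
  have B: "?B = {a \<in> boxes. \<exists>k. L a = Barred k}"
    using st by (force simp: barred_boxes_def skew_boxes_def standard_on_young_def)
  have finB: "finite ?B" unfolding B by (simp add: finite_reverse_boxes)
  have T: "1 \<le> time_of a" "time_of a \<le> int n" if "a \<in> boxes" for a
    using time_bounds[OF tab_facts, of "fst a" "snd a"] that by simp_all
  have inj: "inj_on ?h ?B"
  proof (rule inj_onI)
    fix a b assume "a \<in> ?B" "b \<in> ?B" "?h a = ?h b"
    then show "a = b" using T[of a] T[of b] by (intro value_time_inj[OF tab_facts]) (auto simp: B)
  qed
  have "?h ` ?B = stationary_crossings n d M S"
  proof (intro set_eqI iffI)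
    fix x assume "x \<in> ?h ` ?B"
    then obtain a where a: "a \<in> boxes" "L a = Barred (value_at a)" "x = ?h a" by (auto simp: B)
    define t where "t = nat (time_of a - 1)"
    have t: "time_of a = int t + 1" "t < n" using T[OF a(1)] by (auto simp: t_def)
    have "\<not> (\<exists>b \<in> boxes. L b = Plain (value_at a) \<and> time_of b = int t + 1)"
    proof
      assume "\<exists>b \<in> boxes. L b = Plain (value_at a) \<and> time_of b = int t + 1"
      then obtain b where b: "b \<in> boxes" "L b = Plain (value_at a)" "time_of b = time_of a"
        using t(1) by auto
      have "value_at b = value_at a" by (simp add: b(2))
      then have "b = a" using b value_time_inj[OF tab_facts b(1) a(1)] by simp
      then show False using a(2) b(2) by (metis entry.distinct(1))
    qed
    then have "S (Suc t) (int (value_at a)) = S t (int (value_at a))"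
      using strand_step[of t "int (value_at a)"] by auto
    moreover have "crosses d (M t) (M (Suc t)) (int (value_at a))"
      using a(1) t crosses_iff_box by blast
    ultimately show "x \<in> stationary_crossings n d M S"
      using t(2) reverse_val[OF tab_facts a(1)] unfolding a(3) t_def by (simp add: stationary_crossings_def)
  next
    fix x assume "x \<in> stationary_crossings n d M S"
    then obtain t k where x: "x = (t, k)" "t < n" "k \<in> {1..int d}"
      "crosses d (M t) (M (Suc t)) k" "S (Suc t) k = S t k" by (auto simp: stationary_crossings_def)
    then obtain b where b: "b \<in> boxes" "int (value_at b) = k" "time_of b = int t + 1"
      using crosses_iff_box by blast
    have "L b \<noteq> Plain (nat k)" using x(5) b strand_step[of t k] by (auto split: if_splits)
    then have "b \<in> ?B" using b by (cases "L b") (auto simp: B)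
    moreover have "?h b = x" using b x by simp
    ultimately show "x \<in> ?h ` ?B" by blast
  qed
  then have E: "mset_set (stationary_crossings n d M S) = image_mset ?h (mset_set ?B)"
    using image_mset_mset_set[OF inj] by simp
  show ?thesis
    unfolding motion_factors_def tableau_c_factors_def E multiset.map_comp
  proof (rule image_mset_cong)
    fix a assume "a \<in># mset_set ?B"
    then have a: "a \<in> boxes" using finB by (simp add: B)
    then have sk: "a \<in> skew_boxes d lam mu" by (simp add: skew_boxes_def)
    have v: "1 \<le> value_at a" using reverse_val[OF tab_facts a] by simp
    then have "nat (int (value_at a) - 1) = value_at a - 1" by simp
    then have "int n - S (nat (time_of a - 1)) (int (value_at a)) =
        int d + 1 - int (value_at a) + int (count_list (column_word_before d lam mu L a) (value_at a))"
      using count_before_same[OF tab_facts st a] T[OF a] v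
      by (simp add: tableau_strand_def count_column_word_before[OF lam mu sk])
    moreover have "int (nat (time_of a - 1)) + 1 = int d + 1 - int (value_at a) + snd a - fst a"
      using T[OF a] by (simp add: box_time_def)
    ultimately show "(case a of (r, c) \<Rightarrow> let k = absval (L (r, c)); k' = int d + 1 - int k in
          (k' + int (count_list (column_word_before d lam mu L (r, c)) k), k' + c - r)) =
        ((\<lambda>(t, k). (int n - S t k, int t + 1)) \<circ> ?h) a"
      by (cases a) (simp add: Let_def)
  qed
qed

lemma tableau_motion:
  assumes nu: "nu \<in> partitions d n" and LR: "L \<in> LR_plus d lam mu nu"
  shows "motion n d M S"
    and "k \<in> {1..int d} \<Longrightarrow> S 0 k = int n - int d + k - 1 - int (lam ! nat (k - 1))"
    and "k \<in> {1..int d} \<Longrightarrow> S n k = int n - int d + k - 1 - int (nu ! nat (k - 1))"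
proof -
  have Y: "yamanouchi d (column_word d lam mu L)" and cont: "content d (column_word d lam mu L) = nu"
    and plus: "\<forall>(i, j) \<in># tableau_c_factors d lam mu L. i > j"
    using LR by (auto simp: LR_plus_def LR_def)
  note st = yamanouchi_standard[OF tab_facts Y]
  have len: "length nu = d" using nu by (simp add: partitions_def)
  show S0: "S 0 k = int n - int d + k - 1 - int (lam ! nat (k - 1))" if "k \<in> {1..int d}" for k
    using unbarred_until_0[OF tab_facts, of 0 "nat k"] by (simp add: tableau_strand_def)
  show Sn: "S n k = int n - int d + k - 1 - int (nu ! nat (k - 1))" if k: "k \<in> {1..int d}" for k
  proof -
    have "nu ! (nat k - 1) = lam ! (nat k - 1) + unbarred_until d mu L (int n) (nat k)"
    proof (rule bspec[OF iffD1[OF content_eq_iff[OF tab_facts st len] cont]])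
      show "nat k \<in> {1..d}" using k by auto
    qed
    moreover have "nat k - 1 = nat (k - 1)" using k by auto
    ultimately show ?thesis by (simp add: tableau_strand_def)
  qed
  have inc: "increasing_upto d (S t)" for t
  proof -
    have suc: "S t k < S t (k + 1)" if k: "1 \<le> k" "k < int d" for k
    proof -
      have "lam ! nat k + unbarred_until d mu L (int t) (nat k + 1)
          \<le> lam ! (nat k - 1) + unbarred_until d mu L (int t) (nat k)"
        using k by (intro yamanouchi_counts[OF tab_facts Y]) auto
      moreover have "nat (k + 1) = nat k + 1" "nat (k - 1) = nat k - 1" using k by auto
      ultimately show ?thesis by (simp add: tableau_strand_def)
    qed
    then show ?thesis by (rule increasing_uptoI)
  qed
  have antimono: "S t' k \<le> S t k" if "t \<le> t'" for t t' k
    using unbarred_until_mono[OF tab_facts, of "int t" "int t'" "nat k"] that by (simp add: tableau_strand_def)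
  \<comment> \<open>Positions never increase, and the last one is nonnegative because the parts of
    \<nu> are at most n - d.\<close>
  have nonneg: "0 \<le> S t 1" if "t \<le> n" for t
  proof -
    have "nu ! 0 \<le> n - d" using nu by (simp add: partitions_def)
    then show ?thesis using antimono[OF that, of 1] Sn[of 1] d dn by simp
  qed
  have step: "strip_step n d t (M t) (M (Suc t)) (S t) (S (Suc t))" if t: "t < n" for t
    unfolding strip_step_def
  proof (intro conjI ballI impI)
    fix r assume r: "r \<in> {1..int d}"
    show "M (Suc t) r = M t r \<and> 1 \<le> M t r \<or> M (Suc t) r = M t r - 1"
    proof (cases "\<exists>c. (r, c) \<in> boxes \<and> time_of (r, c) = int t + 1")
      case True
      then obtain c where "(r, c) \<in> boxes" "time_of (r, c) = int t + 1" by blast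
      then show ?thesis using mark_at_box[of r c t] reverse_val[OF tab_facts, of "(r, c)"] by simp
    next
      case False
      then show ?thesis using mark_without_box[OF r, of t] by blast
    qed
  next
    fix k assume k: "k \<in> {1..int d}"
    show "S (Suc t) k = S t k \<or> S (Suc t) k = S t k - 1 \<and> crosses d (M t) (M (Suc t)) k"
    proof (cases "\<exists>b \<in> boxes. L b = Plain (nat k) \<and> time_of b = int t + 1")
      case True
      then obtain b where "b \<in> boxes" "L b = Plain (nat k)" "time_of b = int t + 1" by blast
      then have "crosses d (M t) (M (Suc t)) k"
        unfolding crosses_iff_box using k by (intro bexI[of _ b]) auto
      then show ?thesis using strand_step[of t k] True by simp
    next
      case False
      then show ?thesis using strand_step[of t k] by (simp only: if_False) simp
    qed
  next
    fix k assume k: "k \<in> {1..int d}" and c: "crosses d (M t) (M (Suc t)) k \<and> S (Suc t) k = S t k"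
    \<comment> \<open>Positivity enters here: the factor of this barred entry has i > j, so the
      strand has not yet come to the end of the line.\<close>
    have "(int n - S t k, int t + 1) \<in># tableau_c_factors d lam mu L"
      using c k t unfolding tableau_c_factors_eq[OF st] motion_factors_def
      by (auto simp: finite_stationary_crossings)
        (auto simp: stationary_crossings_def intro!: image_eqI[of _ _ "(t, k)"])
    then show "S t k < int n - 1 - int t" using plus by force
  qed
  have conf: "config n d t (M t) (S t)" if "t \<le> n" for t
    using that
  proof (induction t)
    case 0
    have "S 0 k \<le> int n - 1" if "k \<in> {1..int d}" for k
      using S0[OF that] that by simp
    then show ?case
      using tableau_mark_decreasing inc nonneg[of 0] tableau_mark_0[of 1] d by (auto simp: config_def)
  next
    case (Suc t)
    then show ?case
      using config_step[OF d _ tableau_mark_decreasing inc nonneg step] by simp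
  qed
  show "motion n d M S"
    unfolding motion_def using tableau_mark_0 conf step by blast
qed

end

text \<open>A box of L yields a crossing of mark r in its strip, hence a box of L' in row r with the
  same time. The mark gives both the same value, and equal times then mean equal columns.\<close>

lemma tableau_unique:
  assumes lam: "lam \<in> partitions d n" and mu: "mu \<in> partitions d n" and d: "1 \<le> d" "d \<le> n"
    and L: "L \<in> LR_plus d lam mu nu" and L': "L' \<in> LR_plus d lam mu nu'"
    and M: "\<And>t r. t \<le> n \<Longrightarrow> r \<in> {1..int d} \<Longrightarrow> tableau_mark d mu L t r = tableau_mark d mu L' t r"
    and S: "\<And>t k. t \<le> n \<Longrightarrow> k \<in> {1..int d} \<Longrightarrow> tableau_strand n d lam mu L t k = tableau_strand n d lam mu L' t k"
  shows "L = L'"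
proof -
  have T: "L \<in> tableaux d lam mu" "L' \<in> tableaux d lam mu"
    and Y: "yamanouchi d (column_word d lam mu L)" "yamanouchi d (column_word d lam mu L')"
    using L L' by (auto simp: LR_plus_def LR_def)
  note F = lam mu d(2) T(1) and F' = lam mu d(2) T(2) and G = lam mu d T(1) and G' = lam mu d T(2)
  have "L b = L' b" if b: "b \<in> skew_boxes d lam mu" for b
  proof (cases "b \<in> young_boxes d lam")
    case True
    then show ?thesis
      using yamanouchi_standard[OF F Y(1)] yamanouchi_standard[OF F' Y(2)]
      by (cases b) (force simp: standard_on_young_def)
  next
    case False
    then have bx: "b \<in> reverse_boxes d mu" using b by (simp add: skew_boxes_def)
    obtain r c where rc: "b = (r, c)" by (cases b)
    have r: "r \<in> {1..int d}" using bx by (auto simp: rc reverse_boxes_iff)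
    define t where "t = nat (box_time d L b - 1)"
    have t: "box_time d L (r, c) = int t + 1" "t < n"
      using time_bounds[OF F bx[unfolded rc]] by (auto simp: t_def rc)
    note at = mark_at_box[OF G bx[unfolded rc] t(1)]
    have "tableau_mark d mu L' (Suc t) r = tableau_mark d mu L' t r"
      using at M[of t r] M[of "Suc t" r] r t by simp
    then obtain c' where c': "(r, c') \<in> reverse_boxes d mu" "box_time d L' (r, c') = int t + 1"
      "tableau_mark d mu L' t r = int (absval (L' (r, c')))"
      using box_of_mark[OF G' r] by metis
    have val: "absval (L' (r, c')) = absval (L (r, c))" using c'(3) at M[of t r] r t by simp
    then have "c' = c" using c'(2) t(1) by (simp add: box_time_def)
    have k: "tableau_mark d mu L t r \<in> {1..int d}"
      using at reverse_val[OF F bx] by (simp add: rc)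
    show ?thesis
      using entry_at_box[OF G bx[unfolded rc] t(1)] entry_at_box[OF G' c'(1,2)] \<open>c' = c\<close>
        M[of t r] S[OF _ k, of t] S[OF _ k, of "Suc t"] r t by (simp add: rc)
  qed
  moreover have "L \<in> extensional (skew_boxes d lam mu)" "L' \<in> extensional (skew_boxes d lam mu)"
    using T by (simp_all add: tableaux_def)
  ultimately show ?thesis by (intro extensionalityI[of L _ L']) auto
qed

section \<open>The tableau of a motion\<close>

context
  fixes d n :: nat and lam mu nu :: "nat list" and M S :: "nat \<Rightarrow> int \<Rightarrow> int"
  assumes lam: "lam \<in> partitions d n" and mu: "mu \<in> partitions d n" and nu: "nu \<in> partitions d n"
    and d: "1 \<le> d" and dn: "d \<le> n"
    and mot: "motion n d M S"
    and Mn: "\<And>r. r \<in> {1..int d} \<Longrightarrow> - M n r = int n - int d + r - 1 - int (mu ! nat (r - 1))"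
    and S0: "\<And>k. k \<in> {1..int d} \<Longrightarrow> S 0 k = int n - int d + k - 1 - int (lam ! nat (k - 1))"
    and Sn: "\<And>k. k \<in> {1..int d} \<Longrightarrow> S n k = int n - int d + k - 1 - int (nu ! nat (k - 1))"
begin

private abbreviation "rboxes \<equiv> reverse_boxes d mu"

text \<open>The number of crossings of mark r in the first t strips, obtained by solving the formula
  of \<open>tableau_mark\<close>.\<close>

definition row_count :: "nat \<Rightarrow> int \<Rightarrow> int" where
  "row_count t r = M t r - (int d + 1 - int t - r)"

private lemma row_count_0: "r \<in> {1..int d} \<Longrightarrow> row_count 0 r = 0"
  using motion_0[OF d mot] by (simp add: row_count_def)

private lemma row_count_n: "r \<in> {1..int d} \<Longrightarrow> row_count n r = int (mu ! nat (r - 1))"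
  using Mn by (simp add: row_count_def algebra_simps)

private lemma row_count_step:
  assumes "t < n" "r \<in> {1..int d}"
  shows "row_count (Suc t) r = row_count t r + (if M (Suc t) r = M t r then 1 else 0)"
  using motion_mark_cases[OF d mot assms] by (auto simp: row_count_def)

private lemma row_count_mono: "t \<le> t' \<Longrightarrow> t' \<le> n \<Longrightarrow> r \<in> {1..int d} \<Longrightarrow> row_count t r \<le> row_count t' r"
  using mark_decrease[OF d mot, of t t' r] by (simp add: row_count_def)

private lemma row_count_rows:
  assumes "t \<le> n" "1 \<le> r'" "r' \<le> r" "r \<le> int d"
  shows "row_count t r \<le> row_count t r'"
  using increasing_upto_spread[of d "\<lambda>r. - M t r" r' r] motion_decreasing[OF d mot assms(1)] assms
  by (simp add: row_count_def increasing_upto_def decreasing_upto_def)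

text \<open>For b = (r, c), the strip of the c-th crossing of mark r. At most one strip fits,
  because the count never decreases and grows in this strip.\<close>

definition crossing_time :: "box \<Rightarrow> nat" where
  "crossing_time b = (SOME t. t < n \<and> M (Suc t) (fst b) = M t (fst b) \<and> row_count (Suc t) (fst b) = snd b)"

private lemma crossing_time_exists:
  assumes "(r, c) \<in> rboxes"
  shows "\<exists>t < n. M (Suc t) r = M t r \<and> row_count (Suc t) r = c"
proof -
  have r: "r \<in> {1..int d}" and c: "1 \<le> c" "c \<le> int (mu ! nat (r - 1))"
    using assms by (auto simp: reverse_boxes_iff)
  let ?P = "\<lambda>t. t \<le> n \<and> c \<le> row_count t r"
  have P: "?P n" using row_count_n[OF r] c by simp
  \<comment> \<open>The strip sought is the one just before the first line on which the count has
    reached c.\<close>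
  define u where "u = (LEAST t. ?P t)"
  have u: "?P u" unfolding u_def by (rule LeastI[of ?P, OF P])
  then have "u \<noteq> 0" using row_count_0[OF r] c by (cases u) auto
  then obtain t where t: "u = Suc t" by (cases u) auto
  have "\<not> ?P t" using not_less_Least[of t ?P] t by (simp add: u_def)
  then have "row_count t r < c" "t < n" using u t by auto
  then show ?thesis
    using row_count_step[OF _ r, of t] u t by (intro exI[of _ t]) (auto split: if_splits)
qed

private lemma crossing_time:
  assumes "(r, c) \<in> rboxes"
  shows "crossing_time (r, c) < n" "M (Suc (crossing_time (r, c))) r = M (crossing_time (r, c)) r"
    "row_count (Suc (crossing_time (r, c))) r = c" "row_count (crossing_time (r, c)) r = c - 1"
proof -
  show *: "crossing_time (r, c) < n" "M (Suc (crossing_time (r, c))) r = M (crossing_time (r, c)) r"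
    "row_count (Suc (crossing_time (r, c))) r = c"
    using someI_ex[OF crossing_time_exists[OF assms]] unfolding crossing_time_def by simp_all
  then show "row_count (crossing_time (r, c)) r = c - 1"
    by (simp add: row_count_def)
qed

private lemma crossing_time_eq:
  assumes r: "r \<in> {1..int d}" and t: "t < n" "M (Suc t) r = M t r"
  shows "(r, row_count (Suc t) r) \<in> rboxes" "crossing_time (r, row_count (Suc t) r) = t"
proof -
  let ?c = "row_count (Suc t) r"
  have "row_count (Suc t) r = row_count t r + 1" using row_count_step[OF t(1) r] t(2) by simp
  moreover have "0 \<le> row_count t r" using row_count_mono[of 0 t r] row_count_0[OF r] t r by simp
  moreover have "?c \<le> row_count n r" using row_count_mono[of "Suc t" n r] t r by simp
  ultimately show b: "(r, ?c) \<in> rboxes" using r row_count_n[OF r] by (auto simp: reverse_boxes_iff)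
  note u = crossing_time[OF b]
  have "row_count t r = ?c - 1" using t(2) by (simp add: row_count_def)
  then show "crossing_time (r, ?c) = t"
    using u row_count_mono[of "Suc (crossing_time (r, ?c))" t r] row_count_mono[of "Suc t" "crossing_time (r, ?c)" r] r t
    by (cases "crossing_time (r, ?c)" t rule: linorder_cases) auto
qed

private abbreviation "crossing_value b \<equiv> M (crossing_time b) (fst b)"

text \<open>The value \<open>undefined\<close> outside the diagram is what
  \<open>extensional\<close> demands.\<close>

definition motion_tableau :: "box \<Rightarrow> entry" where
  "motion_tableau b =
     (if b \<in> young_boxes d lam then Plain (nat (2 * int d + 1 - fst b))
      else if b \<in> rboxes then
        (if S (Suc (crossing_time b)) (crossing_value b) = S (crossing_time b) (crossing_value b)
         then Barred else Plain) (nat (crossing_value b))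
      else undefined)"

private abbreviation "L \<equiv> motion_tableau"

private lemma L_young: "b \<in> young_boxes d lam \<Longrightarrow> L b = Plain (nat (2 * int d + 1 - fst b))"
  by (simp add: motion_tableau_def)

private lemma L_reverse:
  assumes "b \<in> rboxes"
  shows "L b = (if S (Suc (crossing_time b)) (crossing_value b) = S (crossing_time b) (crossing_value b)
         then Barred else Plain) (nat (crossing_value b))"
  using assms young_reverse_disjoint[of d lam mu] by (auto simp: motion_tableau_def)

private lemma crossing_value_range:
  assumes "b \<in> rboxes"
  shows "crossing_value b \<in> {1..int d}"
proof -
  obtain r c where rc: "b = (r, c)" by (cases b)
  have r: "r \<in> {1..int d}" using assms by (auto simp: rc reverse_boxes_iff)
  note t = crossing_time[OF assms[unfolded rc]]
  show ?thesis
    using motion_mark_cases[OF d mot t(1) r] t(2) mark_le[OF motion_facts[OF d mot t(1)] r] by (auto simp: rc)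
qed

private lemma L_value: "b \<in> rboxes \<Longrightarrow> int (absval (L b)) = crossing_value b"
  using L_reverse[of b] crossing_value_range[of b] by auto

private lemma reverse_row_value:
  assumes b: "(r, c) \<in> rboxes" "(r, c') \<in> rboxes" "c' < c"
  shows "absval (L (r, c)) \<le> absval (L (r, c'))"
proof -
  have r: "r \<in> {1..int d}" using b by (auto simp: reverse_boxes_iff)
  note t = crossing_time[OF b(1)] and t' = crossing_time[OF b(2)]
  have "crossing_time (r, c') \<le> crossing_time (r, c)"
    using row_count_mono[of "Suc (crossing_time (r, c))" "crossing_time (r, c')" r] t t' r b(3)
    by (cases "crossing_time (r, c') \<le> crossing_time (r, c)") auto
  then have "M (crossing_time (r, c)) r \<le> M (crossing_time (r, c')) r"
    using mark_decrease[OF d mot, of "crossing_time (r, c')" "crossing_time (r, c)" r] r t(1) by simp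
  then show ?thesis using L_value[OF b(1)] L_value[OF b(2)] by simp
qed

text \<open>On each line mark r' has at least as many crossings behind it as mark r, so its c-th
  crossing is not later; and it always sits on a strand with a larger index.\<close>

private lemma reverse_col_value:
  assumes b: "(r, c) \<in> rboxes" "(r', c) \<in> rboxes" "r' < r"
  shows "absval (L (r, c)) < absval (L (r', c))"
proof -
  have r: "r \<in> {1..int d}" "r' \<in> {1..int d}" using b by (auto simp: reverse_boxes_iff)
  note t = crossing_time[OF b(1)] and t' = crossing_time[OF b(2)]
  have "crossing_time (r', c) \<le> crossing_time (r, c)"
    using row_count_mono[of "Suc (crossing_time (r, c))" "crossing_time (r', c)" r'] t t' r b(3)
      row_count_rows[of "Suc (crossing_time (r, c))" r' r]
    by (cases "crossing_time (r', c) \<le> crossing_time (r, c)") auto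
  then have "M (crossing_time (r, c)) r' \<le> M (crossing_time (r', c)) r'"
    using mark_decrease[OF d mot, of "crossing_time (r', c)" "crossing_time (r, c)" r'] r t(1) by simp
  moreover have "M (crossing_time (r, c)) r < M (crossing_time (r, c)) r'"
    using motion_decreasing[OF d mot less_imp_le[OF t(1)]] r b(3) by (simp add: decreasing_upto_def)
  ultimately show ?thesis using L_value[OF b(1)] L_value[OF b(2)] by simp
qed

private lemma tableau: "L \<in> tableaux d lam mu"
  unfolding tableaux_def
proof (intro CollectI conjI ballI allI impI)
  show "L \<in> extensional (skew_boxes d lam mu)"
    by (auto simp: extensional_def motion_tableau_def skew_boxes_def)
  fix b assume "b \<in> young_boxes d lam"
  moreover from this have "nat (2 * int d + 1 - fst b) \<in> {1..d}"
    by (cases b) (auto simp: young_boxes_iff)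
  ultimately show "L b \<in> Plain ` {1..d}" using L_young by simp
next
  fix b assume b: "b \<in> rboxes"
  have "nat (crossing_value b) \<in> {1..d}" using crossing_value_range[OF b] by auto
  then show "L b \<in> Plain ` {1..d} \<union> Barred ` {1..d}" using L_reverse[OF b] by simp
next
  fix r c c' assume *: "(r, c) \<in> skew_boxes d lam mu \<and> (r, c') \<in> skew_boxes d lam mu \<and> c > c'"
  then consider "(r, c) \<in> young_boxes d lam" "(r, c') \<in> young_boxes d lam"
    | "(r, c) \<in> rboxes" "(r, c') \<in> rboxes"
    unfolding skew_boxes_def by (force simp: young_boxes_iff reverse_boxes_iff)
  then show "absval (L (r, c)) \<le> absval (L (r, c'))"
    using L_young reverse_row_value * by cases auto
next
  fix r r' c assume *: "(r, c) \<in> skew_boxes d lam mu \<and> (r', c) \<in> skew_boxes d lam mu \<and> r > r'"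
  then consider "(r, c) \<in> young_boxes d lam" "(r', c) \<in> young_boxes d lam"
    | "(r, c) \<in> rboxes" "(r', c) \<in> rboxes"
    unfolding skew_boxes_def by (force simp: young_boxes_iff reverse_boxes_iff)
  then show "absval (L (r, c)) < absval (L (r', c))"
  proof cases
    case 1
    then show ?thesis using L_young * by (auto simp: young_boxes_iff)
  next
    case 2
    then show ?thesis using reverse_col_value * by auto
  qed
qed

private lemma standard: "standard_on_young d lam L"
  using L_young by (auto simp: standard_on_young_def)

private lemma L_time:
  assumes "b \<in> rboxes"
  shows "box_time d L b = int (crossing_time b) + 1"
proof -
  obtain r c where rc: "b = (r, c)" by (cases b)
  show ?thesis
    using L_value[OF assms] crossing_time(4)[OF assms[unfolded rc]] by (simp add: rc box_time_def row_count_def)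
qed

private lemmas T = lam mu d dn tableau

private lemma mark_eq: "t \<le> n \<Longrightarrow> r \<in> {1..int d} \<Longrightarrow> tableau_mark d mu L t r = M t r"
proof (induction t)
  case 0
  then show ?case using tableau_mark_0[OF T] motion_0[OF d mot] by simp
next
  case (Suc t)
  then have t: "t < n" by simp
  show ?case
  proof (cases "M (Suc t) r = M t r")
    case True
    note b = crossing_time_eq[OF Suc.prems(2) t True]
    show ?thesis using mark_at_box[OF T b(1), of t] L_time[OF b(1)] b(2) Suc t True by simp
  next
    case False
    have "box_time d L (r, c) \<noteq> int t + 1" if b: "(r, c) \<in> rboxes" for c
      using L_time[OF b] crossing_time(2)[OF b] False by auto
    then show ?thesis
      using mark_without_box[OF T Suc.prems(2), of t] motion_mark_cases[OF d mot t Suc.prems(2)] Suc t False by auto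
  qed
qed

private lemma moves_iff:
  assumes t: "t < n" and k: "k \<in> {1..int d}"
  shows "S (Suc t) k \<noteq> S t k \<longleftrightarrow> (\<exists>b \<in> rboxes. L b = Plain (nat k) \<and> box_time d L b = int t + 1)"
proof
  assume mv: "S (Suc t) k \<noteq> S t k"
  then have "crosses d (M t) (M (Suc t)) k" using motion_strand_moves[OF d mot t k] by simp
  then obtain r where r: "r \<in> {1..int d}" "M t r = k" "M (Suc t) r = k" by (auto simp: crosses_def)
  then have eq: "M (Suc t) r = M t r" by simp
  note b = crossing_time_eq[OF r(1) t eq]
  have "L (r, row_count (Suc t) r) = Plain (nat k)" using L_reverse[OF b(1)] b(2) r mv by simp
  moreover have "box_time d L (r, row_count (Suc t) r) = int t + 1" using L_time[OF b(1)] b(2) by simp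
  ultimately show "\<exists>b \<in> rboxes. L b = Plain (nat k) \<and> box_time d L b = int t + 1" using b(1) by blast
next
  assume "\<exists>b \<in> rboxes. L b = Plain (nat k) \<and> box_time d L b = int t + 1"
  then obtain b where b: "b \<in> rboxes" "L b = Plain (nat k)" "box_time d L b = int t + 1" by blast
  have "crossing_time b = t" using L_time[OF b(1)] b(3) by simp
  moreover have "crossing_value b = k" using L_value[OF b(1)] b(2) k by simp
  ultimately show "S (Suc t) k \<noteq> S t k" using L_reverse[OF b(1)] b(2) by (auto split: if_splits)
qed

private lemma strand_eq: "t \<le> n \<Longrightarrow> k \<in> {1..int d} \<Longrightarrow> tableau_strand n d lam mu L t k = S t k"
proof (induction t)
  case 0
  then show ?case using S0 unbarred_until_0[OF lam mu dn tableau, of 0 "nat k"] by (simp add: tableau_strand_def)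
next
  case (Suc t)
  then have t: "t < n" by simp
  show ?case
  proof (cases "S (Suc t) k = S t k")
    case True
    then have no: "\<not> (\<exists>b \<in> rboxes. L b = Plain (nat k) \<and> box_time d L b = int t + 1)"
      using moves_iff[OF t Suc.prems(2)] by blast
    show ?thesis unfolding strand_step[OF T] if_not_P[OF no] using Suc True by simp
  next
    case False
    then have yes: "\<exists>b \<in> rboxes. L b = Plain (nat k) \<and> box_time d L b = int t + 1"
      using moves_iff[OF t Suc.prems(2)] by blast
    show ?thesis unfolding strand_step[OF T] if_P[OF yes]
      using Suc motion_strand_moves[OF d mot t Suc.prems(2) False] by simp
  qed
qed

private lemma unbarred_eq:
  assumes "t \<le> n" "k \<in> {1..d}"
  shows "int (lam ! (k - 1)) + int (unbarred_until d mu L (int t) k) = int n - int d + int k - 1 - S t (int k)"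
proof -
  have "nat (int k - 1) = k - 1" using assms by auto
  then show ?thesis using strand_eq[OF assms(1), of "int k"] assms(2) by (simp add: tableau_strand_def)
qed

text \<open>Increasing strands turn into the Yamanouchi condition, their last positions into the
  content, and the last clause of \<open>strip_step\<close> into positivity.\<close>

lemma tableau_of_motion:
  "\<exists>L \<in> LR_plus d lam mu nu. (\<forall>t \<le> n. \<forall>k \<in> {1..int d}.
     tableau_mark d mu L t k = M t k \<and> tableau_strand n d lam mu L t k = S t k)"
proof -
  have "yamanouchi d (column_word d lam mu L)"
  proof (rule yamanouchiI[OF lam mu dn tableau standard])
    fix t k assume k: "k \<in> {1..<d}" and t: "t \<le> n"
    have "S t (int k) < S t (int (k + 1))"
      using motion_increasing[OF d mot t] k by (auto simp: increasing_upto_def)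
    moreover have "k + 1 - 1 = k" by simp
    ultimately show "lam ! k + unbarred_until d mu L (int t) (k + 1) \<le> lam ! (k - 1) + unbarred_until d mu L (int t) k"
      using unbarred_eq[OF t, of k] unbarred_eq[OF t, of "k + 1"] k by simp
  qed
  moreover have "content d (column_word d lam mu L) = nu"
  proof (rule iffD2[OF content_eq_iff[OF lam mu dn tableau standard]])
    show "length nu = d" using nu by (simp add: partitions_def)
    show "\<forall>k \<in> {1..d}. nu ! (k - 1) = lam ! (k - 1) + unbarred_until d mu L (int n) k"
    proof
      fix k assume k: "k \<in> {1..d}"
      have "nat (int k - 1) = k - 1" using k by auto
      then have "int (nu ! (k - 1)) = int (lam ! (k - 1) + unbarred_until d mu L (int n) k)"
        using unbarred_eq[of n k] Sn[of "int k"] k by simp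
      then show "nu ! (k - 1) = lam ! (k - 1) + unbarred_until d mu L (int n) k" by simp
    qed
  qed
  moreover have "i > j" if ij: "(i, j) \<in># tableau_c_factors d lam mu L" for i j
  proof -
    let ?E = "stationary_crossings n d (tableau_mark d mu L) (tableau_strand n d lam mu L)"
    obtain t k where tk: "(t, k) \<in> ?E" "i = int n - tableau_strand n d lam mu L t k" "j = int t + 1"
      using ij unfolding tableau_c_factors_eq[OF T standard] motion_factors_def
      by (auto simp: finite_stationary_crossings)
    then have t: "t < n" "k \<in> {1..int d}" "crosses d (tableau_mark d mu L t) (tableau_mark d mu L (Suc t)) k"
      "tableau_strand n d lam mu L (Suc t) k = tableau_strand n d lam mu L t k"
      by (auto simp: stationary_crossings_def)
    have "crosses d (M t) (M (Suc t)) k"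
      using t(1,3) mark_eq[of t] mark_eq[of "Suc t"] by (auto simp: crosses_def)
    moreover have "S (Suc t) k = S t k" using t strand_eq[of t k] strand_eq[of "Suc t" k] by simp
    ultimately have "S t k < int n - 1 - int t"
      using motion_step[OF d mot t(1)] t(2) by (auto simp: strip_step_def)
    then show ?thesis using tk strand_eq[of t k] t by simp
  qed
  ultimately have "L \<in> LR_plus d lam mu nu" using tableau by (auto simp: LR_plus_def LR_def)
  then show ?thesis using mark_eq strand_eq by blast
qed

end

section \<open>The bijection\<close>

text \<open>Outside the ranges of the indices the functions of a motion are arbitrary.\<close>

lemma marked_cong:
  "(\<And>r. r \<in> {1..int d} \<Longrightarrow> m r = m1 r) \<Longrightarrow> marked d m k \<longleftrightarrow> marked d m1 k"
  by (auto simp: marked_def)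

lemma motion_kind_cong:
  assumes eq: "\<And>t k. t \<le> n \<Longrightarrow> k \<in> {1..int d} \<Longrightarrow> M t k = M' t k \<and> S t k = S' t k"
    and z: "z \<in> up_region n"
  shows "motion_kind n d M S z = motion_kind n d M' S' z"
proof -
  obtain x y where xy: "z = (x, y)" by (cases z)
  define t where "t = nat (int n - 1 - x - y)"
  have t: "t < n" using z by (auto simp: t_def xy up_region_def)
  have e: "M t k = M' t k" "S t k = S' t k" "M (Suc t) k = M' (Suc t) k" "S (Suc t) k = S' (Suc t) k"
    if "k \<in> {1..int d}" for k
    using eq that t by auto
  have l: "leaves d (M t) (M (Suc t)) k \<longleftrightarrow> leaves d (M' t) (M' (Suc t)) k" for k
    unfolding leaves_def using e by auto
  have "(\<exists>k \<in> {1..int d}. leaves d (M t) (M (Suc t)) k \<and> x \<le> S t k \<and> (k = 1 \<or> S t (k - 1) < x)) \<longleftrightarrow>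
      (\<exists>k \<in> {1..int d}. leaves d (M' t) (M' (Suc t)) k \<and> x \<le> S' t k \<and> (k = 1 \<or> S' t (k - 1) < x))"
  proof (intro bex_cong refl)
    fix k assume k: "k \<in> {1..int d}"
    \<comment> \<open>For k = 1 the index k - 1 is outside the range in which the two motions
      agree.\<close>
    then have "k = 1 \<or> S t (k - 1) = S' t (k - 1)" using e(2)[of "k - 1"] by fastforce
    then show "leaves d (M t) (M (Suc t)) k \<and> x \<le> S t k \<and> (k = 1 \<or> S t (k - 1) < x) \<longleftrightarrow>
      leaves d (M' t) (M' (Suc t)) k \<and> x \<le> S' t k \<and> (k = 1 \<or> S' t (k - 1) < x)"
      using l e k by auto
  qed
  moreover have "(\<exists>k \<in> {1..int d}. S t k = x \<and> S (Suc t) k \<noteq> x) \<longleftrightarrow>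
      (\<exists>k \<in> {1..int d}. S' t k = x \<and> S' (Suc t) k \<noteq> x)"
    using e by (intro bex_cong refl) simp
  ultimately have "strip_label d (M t) (M (Suc t)) (S t) (S (Suc t)) x =
      strip_label d (M' t) (M' (Suc t)) (S' t) (S' (Suc t)) x"
    unfolding strip_label_def by (simp only:)
  moreover have "line_label d (M t) (S t) x = line_label d (M' t) (S' t) x"
  proof -
    have "marked d (M t) k \<longleftrightarrow> marked d (M' t) k" for k using e by (intro marked_cong) simp
    then have "(\<exists>k \<in> {1..int d}. S t k = x \<and> marked d (M t) k) \<longleftrightarrow>
        (\<exists>k \<in> {1..int d}. S' t k = x \<and> marked d (M' t) k)"
      "(\<exists>k \<in> {1..int d}. S t k = x) \<longleftrightarrow> (\<exists>k \<in> {1..int d}. S' t k = x)"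
      using e by (auto intro!: bex_cong)
    then show ?thesis unfolding line_label_def by (simp only:)
  qed
  ultimately show ?thesis unfolding xy motion_kind.simps t_def[symmetric] Let_def by simp
qed

section \<open>Weights\<close>

lemma puzzle_c_factors_eq:
  assumes d: "1 \<le> d" and mot: "motion n d M S" and P: "P \<in> puzzles n"
    and kind: "\<And>z. z \<in> up_region n \<Longrightarrow> up_kind P z = motion_kind n d M S z"
  shows "puzzle_c_factors n P = motion_factors n d M S"
proof -
  let ?E = "stationary_crossings n d M S"
  \<comment> \<open>The upward half of the equivariant piece is the cell at position
    \<open>S t k\<close> of strip t; its base vertex lies one step to the right and one row down.
    From there the two lines meet the S side in the edges \<open>n - S t k\<close> and t +
    1.\<close>
  let ?h = "\<lambda>(t, k). (S t k + 1, int n - 2 - int t - S t k)"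
  have inj: "inj_on ?h ?E"
  proof (rule inj_onI)
    fix a b assume ab: "a \<in> ?E" "b \<in> ?E" "?h a = ?h b"
    obtain t k t' k' where tk: "a = (t, k)" "b = (t', k')" by (cases a; cases b)
    have t: "t' = t" using ab(3) by (simp add: tk)
    moreover have "k \<in> {1..int d}" "k' \<in> {1..int d}" "t < n"
      using ab by (auto simp: tk stationary_crossings_def)
    moreover have "S t k = S t k'" using ab(3) t by (simp add: tk)
    ultimately show "a = b"
      using increasing_upto_inj[OF motion_increasing[OF d mot, of t], of k k'] by (simp add: tk)
  qed
  have "equivariant_places P = ?h ` ?E"
    unfolding equivariant_places_eq[OF P]
  proof (intro set_eqI iffI)
    fix z assume "z \<in> (\<lambda>(x, y). (x + 1, y - 1)) ` {z \<in> up_region n. up_kind P z = Equivariant}"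
    then obtain x y where xy: "(x, y) \<in> up_region n" "up_kind P (x, y) = Equivariant" "z = (x + 1, y - 1)"
      by auto
    then obtain t where t: "t < n" "x + y = int n - 1 - int t" using strip_of_point[OF d mot] by blast
    have y: "y = int n - 1 - int t - x" "0 \<le> x" "x \<le> int n - 1 - int t"
      using t xy by (auto simp: up_region_def)
    have "motion_kind n d M S (x, int n - 1 - int t - x) = Equivariant"
      using kind[OF xy(1)] xy(2) y(1) by simp
    then obtain k where "k \<in> {1..int d}" "crosses d (M t) (M (Suc t)) k" "S t k = x" "S (Suc t) k = x"
      using motion_equivariant_iff[OF d mot t(1) y(2,3)] by blast
    then have "(t, k) \<in> ?E" "z = ?h (t, k)" using t xy(3) y(1) by (auto simp: stationary_crossings_def)
    then show "z \<in> ?h ` ?E" by blast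
  next
    fix z assume "z \<in> ?h ` ?E"
    then obtain t k where tk: "(t, k) \<in> ?E" "z = ?h (t, k)" by auto
    then have t: "t < n" "k \<in> {1..int d}" "crosses d (M t) (M (Suc t)) k" "S (Suc t) k = S t k"
      by (auto simp: stationary_crossings_def)
    have x: "0 \<le> S t k" "S t k \<le> int n - 1 - int t"
      using strand_ge[OF d mot less_imp_le[OF t(1)] t(2)] motion_step[OF d mot t(1)] t
      by (auto simp: strip_step_def)
    then have "motion_kind n d M S (S t k, int n - 1 - int t - S t k) = Equivariant"
      using motion_equivariant_iff[OF d mot t(1) x] t by blast
    moreover have "(S t k, int n - 1 - int t - S t k) \<in> up_region n" using x by (simp add: up_region_def)
    ultimately show "z \<in> (\<lambda>(x, y). (x + 1, y - 1)) ` {z \<in> up_region n. up_kind P z = Equivariant}"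
      using kind tk(2) by (intro image_eqI[of _ _ "(S t k, int n - 1 - int t - S t k)"]) auto
  qed
  then have "mset_set (equivariant_places P) = image_mset ?h (mset_set ?E)"
    using image_mset_mset_set[OF inj] by simp
  then show ?thesis
    unfolding puzzle_c_factors_def motion_factors_def
    by (auto simp: multiset.map_comp S_edge_met_Slash S_edge_met_Backslash Let_def intro!: image_mset_cong)
qed

text \<open>Since n + 1 - k' = n - d + k, the same substitution works on both sides, so that only
  the factors of the first product have to be compared.\<close>

lemma C_factors_from_c_factors:
  "puzzle_C_factors n P = image_mset (\<lambda>(e, f). (int n + 1 - f, int n + 1 - e)) (puzzle_c_factors n P)"
  "tableau_C_factors n d lam mu L =
     image_mset (\<lambda>(e, f). (int n + 1 - f, int n + 1 - e)) (tableau_c_factors d lam mu L)"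
  by (auto simp: puzzle_C_factors_def puzzle_c_factors_def tableau_C_factors_def tableau_c_factors_def
      multiset.map_comp Let_def intro!: image_mset_cong)

text \<open>The graph of the bijection. The motion is always that of the tableau; the puzzle enters
  only through its kinds.\<close>

definition same_motion :: "nat \<Rightarrow> nat \<Rightarrow> nat list \<Rightarrow> nat list \<Rightarrow> piece set \<Rightarrow> (box \<Rightarrow> entry) \<Rightarrow> bool" where
  "same_motion n d lam mu P L \<longleftrightarrow>
     (\<forall>z \<in> up_region n. up_kind P z = motion_kind n d (tableau_mark d mu L) (tableau_strand n d lam mu L) z)"

context
  fixes n d :: nat and lam mu nu :: "nat list"
  assumes d: "1 \<le> d" and dn: "d \<le> n"
    and lam: "lam \<in> partitions d n" and mu: "mu \<in> partitions d n" and nu: "nu \<in> partitions d n"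
begin

text \<open>The NE word gives the positions from which \<open>local_rules_motion\<close> starts; the
  other two words are the final conditions on marks and strands that
  \<open>tableau_of_motion\<close> asks for.\<close>

lemma tableau_of_puzzle:
  assumes P: "P \<in> LP_plus n lam mu nu"
  shows "\<exists>L \<in> LR_plus d lam mu nu. same_motion n d lam mu P L"
proof -
  have Pz: "P \<in> puzzles n" and words: "word_partition (NE_word n P) = lam"
    "word_partition (NW_word n P) = mu" "word_partition (S_word n P) = nu"
    using P by (auto simp: LP_plus_def)
  note rules = puzzle_local_rules[OF Pz]
  define S0 where "S0 k = int n - int d + k - 1 - int (lam ! nat (k - 1))" for k
  have inc: "increasing_upto d S0"
  proof (rule increasing_uptoI)
    fix k assume "1 \<le> k" "k < int d"
    then have "lam ! nat k \<le> lam ! nat (k - 1)" by (intro partitions_nth_mono[OF lam]) auto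
    then show "S0 k < S0 (k + 1)" by (simp add: S0_def)
  qed
  have "lam ! 0 \<le> n - d" using partitions_nth_le[OF lam, of 0] d by simp
  then have S0: "0 \<le> S0 1" "S0 (int d) < int n" using dn by (auto simp: S0_def)
  have bin: "back_label (up_kind P (int i, int n - 1 - int i)) \<in> {0, 1}" if "i < n" for i
    using rules that by (auto simp: local_rules_def le_Suc_eq)
  have ones: "back_label (up_kind P (int i, int n - 1 - int i)) = (if \<exists>k \<in> {1..int d}. S0 k = int i then 1 else 0)"
    if i: "i < n" for i
  proof -
    let ?w = "NE_word n P"
    have w: "length ?w = n" "?w ! i = back_label (up_kind P (int i, int n - 1 - int i))"
      using i unfolding boundary_words(1)[OF Pz] by simp_all
    have w01: "set ?w \<subseteq> {0, 1}"
      unfolding boundary_words(1)[OF Pz] set_map image_subset_iff by (intro ballI bin) simp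
    have len: "length lam = d" using lam by (simp add: partitions_def)
    have "?w ! i = 1 \<longleftrightarrow> (\<exists>j < d. int i = int n - int d + int j - int (lam ! j))"
      using word_ones[OF w01, of i] w(1) i words(1) len by simp
    also have "\<dots> \<longleftrightarrow> (\<exists>k \<in> {1..int d}. S0 k = int i)"
    proof
      assume "\<exists>j < d. int i = int n - int d + int j - int (lam ! j)"
      then obtain j where "j < d" "int i = int n - int d + int j - int (lam ! j)" by blast
      then show "\<exists>k \<in> {1..int d}. S0 k = int i" by (intro bexI[of _ "int j + 1"]) (auto simp: S0_def)
    next
      assume "\<exists>k \<in> {1..int d}. S0 k = int i"
      then obtain k where "k \<in> {1..int d}" "S0 k = int i" by blast
      then show "\<exists>j < d. int i = int n - int d + int j - int (lam ! j)"
        by (intro exI[of _ "nat (k - 1)"]) (auto simp: S0_def)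
    qed
    finally show ?thesis using w(2) bin[OF i] by auto
  qed
  obtain M S where mot: "motion n d M S" and MS: "S 0 = S0"
    "\<And>z. z \<in> up_region n \<Longrightarrow> motion_kind n d M S z = up_kind P z"
    using local_rules_motion[OF d rules inc S0 ones] by blast
  note words_iff = motion_words[OF d mot dn _ MS(2)[symmetric]]
  have "\<exists>L \<in> LR_plus d lam mu nu. (\<forall>t \<le> n. \<forall>k \<in> {1..int d}.
     tableau_mark d mu L t k = M t k \<and> tableau_strand n d lam mu L t k = S t k)"
  proof (rule tableau_of_motion[OF lam mu nu d dn mot])
    show "- M n r = int n - int d + r - 1 - int (mu ! nat (r - 1))" if "r \<in> {1..int d}" for r
      using words_iff(2)[OF mu] words(2) that unfolding boundary_words(2)[OF Pz] by blast
    show "S 0 k = int n - int d + k - 1 - int (lam ! nat (k - 1))" for k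
      by (simp add: MS(1) S0_def)
    show "S n k = int n - int d + k - 1 - int (nu ! nat (k - 1))" if "k \<in> {1..int d}" for k
      using words_iff(3)[OF nu] words(3) that unfolding boundary_words(3)[OF Pz] by blast
  qed
  then obtain L where L: "L \<in> LR_plus d lam mu nu" and eq: "\<And>t k. t \<le> n \<Longrightarrow> k \<in> {1..int d} \<Longrightarrow>
     tableau_mark d mu L t k = M t k \<and> tableau_strand n d lam mu L t k = S t k" by blast
  have "same_motion n d lam mu P L"
    unfolding same_motion_def
    using motion_kind_cong[of n d M "tableau_mark d mu L" S "tableau_strand n d lam mu L"] eq MS(2) by simp
  then show ?thesis using L by blast
qed

lemma LR_plus_tableau: "L \<in> LR_plus d lam mu nu \<Longrightarrow> L \<in> tableaux d lam mu"
  by (simp add: LR_plus_def LR_def)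

lemma puzzle_of_tableau:
  assumes L: "L \<in> LR_plus d lam mu nu"
  shows "\<exists>P \<in> LP_plus n lam mu nu. same_motion n d lam mu P L"
proof -
  let ?M = "tableau_mark d mu L" and ?S = "tableau_strand n d lam mu L"
  note T = LR_plus_tableau[OF L]
  note mot = tableau_motion[OF lam mu d dn T nu L]
  obtain P where P: "P \<in> puzzles n" "\<And>z. z \<in> up_region n \<Longrightarrow> up_kind P z = motion_kind n d ?M ?S z"
    using puzzle_of_local_rules[OF motion_local_rules[OF d mot(1)]] by blast
  note words_iff = motion_words[OF d mot(1) dn _ P(2), folded boundary_words[OF P(1)]]
  have "- ?M n k = int n - int d + k - 1 - int (mu ! nat (k - 1))" if "k \<in> {1..int d}" for k
    using tableau_mark_n[OF lam mu d dn T that] by simp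
  then have "P \<in> LP_plus n lam mu nu"
    using words_iff(1)[OF lam] words_iff(2)[OF mu] words_iff(3)[OF nu] mot(2,3) P(1)
    by (simp add: LP_plus_def)
  moreover have "same_motion n d lam mu P L" using P(2) by (simp add: same_motion_def)
  ultimately show ?thesis by blast
qed

text \<open>The motions of both tableaux have the same kinds and the same start, so they agree
  within the index ranges, and the motion determines the tableau.\<close>

lemma same_motion_tableau_unique:
  assumes L: "L \<in> LR_plus d lam mu nu" "L' \<in> LR_plus d lam mu nu"
    and same: "same_motion n d lam mu P L" "same_motion n d lam mu P L'"
  shows "L = L'"
proof -
  note mot = tableau_motion[OF lam mu d dn LR_plus_tableau[OF L(1)] nu L(1)]
    and mot' = tableau_motion[OF lam mu d dn LR_plus_tableau[OF L(2)] nu L(2)]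
  have eq: "tableau_mark d mu L t r = tableau_mark d mu L' t r \<and>
      tableau_strand n d lam mu L t r = tableau_strand n d lam mu L' t r"
    if "t \<le> n" "r \<in> {1..int d}" for t r
    using that same mot(2) mot'(2) unfolding same_motion_def
    by (intro motion_unique[OF d mot(1) mot'(1)]) simp_all
  show ?thesis by (rule tableau_unique[OF lam mu d dn L]) (use eq in blast)+
qed

lemma same_motion_puzzle_unique:
  "P \<in> LP_plus n lam mu nu \<Longrightarrow> P' \<in> LP_plus n lam mu nu \<Longrightarrow>
   same_motion n d lam mu P L \<Longrightarrow> same_motion n d lam mu P' L \<Longrightarrow> P = P'"
  by (rule puzzle_eqI[of P n P']) (auto simp: LP_plus_def same_motion_def)

lemma same_motion_factors:
  assumes P: "P \<in> LP_plus n lam mu nu" and L: "L \<in> LR_plus d lam mu nu" and same: "same_motion n d lam mu P L"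
  shows "puzzle_c_factors n P = tableau_c_factors d lam mu L"
proof -
  note T = LR_plus_tableau[OF L]
  have "yamanouchi d (column_word d lam mu L)" using L by (simp add: LR_plus_def LR_def)
  then have "tableau_c_factors d lam mu L = motion_factors n d (tableau_mark d mu L) (tableau_strand n d lam mu L)"
    by (intro tableau_c_factors_eq[OF lam mu d dn T] yamanouchi_standard[OF lam mu dn T])
  moreover have "P \<in> puzzles n" using P by (simp add: LP_plus_def)
  ultimately show ?thesis
    using puzzle_c_factors_eq[OF d tableau_motion(1)[OF lam mu d dn T nu L]] same by (simp add: same_motion_def)
qed

end

theorem proposition9p2:
  fixes n d :: nat and lam mu nu :: "nat list"
  assumes "1 \<le> d" and "d \<le> n"
    and "lam \<in> partitions d n" and "mu \<in> partitions d n" and "nu \<in> partitions d n"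
  shows "\<exists>\<Phi>. bij_betw \<Phi> (LP_plus n lam mu nu) (LR_plus d lam mu nu) \<and>
    (\<forall>P \<in> LP_plus n lam mu nu.
       puzzle_c n P = tableau_c d lam mu (\<Phi> P) \<and>
       puzzle_c_factors n P = tableau_c_factors d lam mu (\<Phi> P) \<and>
       puzzle_C n P = tableau_C n d lam mu (\<Phi> P) \<and>
       puzzle_C_factors n P = tableau_C_factors n d lam mu (\<Phi> P))"
proof -
  have "\<forall>P \<in> LP_plus n lam mu nu. \<exists>L. L \<in> LR_plus d lam mu nu \<and> same_motion n d lam mu P L"
    using tableau_of_puzzle[OF assms] by blast
  from bchoice[OF this] obtain \<Phi> where \<Phi>: "\<And>P. P \<in> LP_plus n lam mu nu \<Longrightarrow>
      \<Phi> P \<in> LR_plus d lam mu nu \<and> same_motion n d lam mu P (\<Phi> P)" by blast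
  have "bij_betw \<Phi> (LP_plus n lam mu nu) (LR_plus d lam mu nu)"
    unfolding bij_betw_def
  proof
    show "inj_on \<Phi> (LP_plus n lam mu nu)"
      using \<Phi> same_motion_puzzle_unique[OF assms] by (metis inj_onI)
    show "\<Phi> ` LP_plus n lam mu nu = LR_plus d lam mu nu"
    proof
      show "LR_plus d lam mu nu \<subseteq> \<Phi> ` LP_plus n lam mu nu"
      proof
        fix L assume L: "L \<in> LR_plus d lam mu nu"
        then obtain P where P: "P \<in> LP_plus n lam mu nu" "same_motion n d lam mu P L"
          using puzzle_of_tableau[OF assms] by blast
        then have "\<Phi> P = L" using same_motion_tableau_unique[OF assms _ L] \<Phi> by blast
        then show "L \<in> \<Phi> ` LP_plus n lam mu nu" using P by blast
      qed
    qed (use \<Phi> in blast)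
  qed
  moreover have "puzzle_c_factors n P = tableau_c_factors d lam mu (\<Phi> P)" if "P \<in> LP_plus n lam mu nu" for P
    using same_motion_factors[OF assms that] \<Phi>[OF that] by blast
  ultimately show ?thesis
    by (intro exI[of _ \<Phi>])
      (simp add: puzzle_c_def tableau_c_def puzzle_C_def tableau_C_def C_factors_from_c_factors)
qed

end
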